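(* Let $d\in\{2,3\}$, let $\Omega\subset\mathbb{R}^d$ be an open, bounded, convex polytope, let $s\in(\tfrac d4,1)$, and let $\theta\in(\tfrac d2-s,\,s)$. Let $\mathcal{D}\subset\Omega$ be a finite set with $\ell=\#\mathcal{D}$ elements, let $u_\Omega\in L^2(\Omega)$, $\alpha>0$, and let $\mathbf a=\{a_z\}_{z\in\mathcal{D}}$, $\mathbf b=\{b_z\}_{z\in\mathcal{D}}\in\mathbb{R}^\ell$ satisfy $a_z<b_z$ for every $z\in\mathcal{D}$. Set $\mathbf{Q}_{ad}=\{\mathbf q\in\mathbb{R}^\ell:\ a_z\le q_z\le b_z\ \ \forall z\in\mathcal{D}\}$ and $$J(u,\mathbf q)=\tfrac12\|u-u_\Omega\|_{L^2(\Omega)}^2+\tfrac\alpha2\|\mathbf q\|_{\mathbb{R}^\ell}^2 .$$ Then the problem of minimizing $J(u,\mathbf q)$ over all pairs $(u,\mathbf q)\in\mathbb{H}^{s-\theta}(\Omega)\times\mathbf{Q}_{ad}$ satisfying the state equation $$\mathcal{A}(u,v)=\sum_{z\in\mathcal{D}}q_z\,v(z)\qquad\forall v\in\mathbb{H}^{s+\theta}(\Omega)$$ has a unique solution $(\bar u,\bar{\mathbf q})\in\mathbb{H}^{s-\theta}(\Omega)\times\mathbf{Q}_{ad}$.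
   Context: Let $\{(\lambda_k,\varphi_k)\}_{k\in\mathbb{N}}$ be the eigenpairs of the Dirichlet Laplacian on $\Omega$, i.e. $\varphi_k\in H^1_0(\Omega)\setminus\{0\}$ and $(\nabla\varphi_k,\nabla v)_{L^2(\Omega)}=\lambda_k(\varphi_k,v)_{L^2(\Omega)}$ for all $v\in H_0^1(\Omega)$, with $\lambda_k>0$, $\lambda_k\to\infty$, and $\{\varphi_k\}$ an orthonormal basis of $L^2(\Omega)$. For $w\in L^2(\Omega)$ write $w_k=\int_\Omega w\varphi_k\,dx$. For $r\ge0$, $$\mathbb{H}^r(\Omega)=\Big\{w\in L^2(\Omega):\ \sum_{k}\lambda_k^r|w_k|^2<\infty\Big\},\qquad \|w\|_{\mathbb{H}^r(\Omega)}=\Big(\sum_k\lambda_k^r|w_k|^2\Big)^{1/2}.$$ The bilinear form $\mathcal{A}:\mathbb{H}^{s-\theta}(\Omega)\times\mathbb{H}^{s+\theta}(\Omega)\to\mathbb{R}$ is $\mathcal{A}(v,w)=\sum_{k=1}^\infty\lambda_k^s v_kw_k$. Since $s+\theta>\tfrac d2$, one has the continuous embedding of $\mathbb{H}^{s+\theta}(\Omega)$ into $C_0(\Omega)$, the continuous functions on $\bar\Omega$ vanishing on $\partial\Omega$; elements of $\mathbb{H}^{s+\theta}(\Omega)$ are identified with their continuous representatives, so that $v(z)$ is well defined. The state equation is the weak form of $(-\Delta)^su=\sum_{z\in\mathcal{D}}q_z\delta_z$ in $\Omega$, with $(-\Delta)^s$ the spectral fractional Laplacian, $(-\Delta)^sw=\sum_k\lambda_k^sw_k\varphi_k$.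 $\|\cdot\|_{\mathbb{R}^\ell}$ is the Euclidean norm. *)

theory Defs
  imports "HOL-Analysis.Analysis"
begin

section \<open>Square-integrable functions on a domain\<close>

text \<open>Elements of \<open>L\<^sup>2(\<Omega>)\<close> are represented by functions on the ambient space; two of them are the
  same element iff they agree almost everywhere in \<open>\<Omega>\<close>. Values outside \<open>\<Omega>\<close> are irrelevant. The
  codomain is \<open>real\<close> for scalar functions and the ambient space for gradients.\<close>

definition L2 :: "'a::euclidean_space set \<Rightarrow> ('a \<Rightarrow> 'b::euclidean_space) set" where
  "L2 \<Omega> = {f. f \<in> borel_measurable (lebesgue_on \<Omega>) \<and>
               integrable (lebesgue_on \<Omega>) (\<lambda>x. (norm (f x))\<^sup>2)}"

definition l2_inner ::
    "'a::euclidean_space set \<Rightarrow> ('a \<Rightarrow> 'b::euclidean_space) \<Rightarrow> ('a \<Rightarrow> 'b) \<Rightarrow> real" where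
  "l2_inner \<Omega> f g = (\<integral>x. f x \<bullet> g x \<partial>lebesgue_on \<Omega>)"

definition l2_norm ::
    "'a::euclidean_space set \<Rightarrow> ('a \<Rightarrow> 'b::euclidean_space) \<Rightarrow> real" where
  "l2_norm \<Omega> f = sqrt (l2_inner \<Omega> f f)"

section \<open>The Sobolev spaces \<open>H\<^sup>1\<close> and \<open>H\<^sup>1\<^sub>0\<close>\<close>

primrec C_k :: "nat \<Rightarrow> ('a::euclidean_space \<Rightarrow> real) \<Rightarrow> bool" where
  "C_k 0 f = continuous_on UNIV f"
| "C_k (Suc k) f = ((\<forall>x. f differentiable (at x)) \<and>
      (\<forall>i\<in>Basis. C_k k (\<lambda>x. frechet_derivative f (at x) i)))"

definition test_functions :: "'a::euclidean_space set \<Rightarrow> ('a \<Rightarrow> real) set" where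
  "test_functions \<Omega> = {\<psi>. (\<forall>k. C_k k \<psi>) \<and> compact (closure {x. \<psi> x \<noteq> 0}) \<and>
                          closure {x. \<psi> x \<noteq> 0} \<subseteq> \<Omega>}"

definition has_weak_gradient ::
    "'a::euclidean_space set \<Rightarrow> ('a \<Rightarrow> real) \<Rightarrow> ('a \<Rightarrow> 'a) \<Rightarrow> bool" where
  "has_weak_gradient \<Omega> w G \<longleftrightarrow> w \<in> L2 \<Omega> \<and> G \<in> L2 \<Omega> \<and>
     (\<forall>\<psi>\<in>test_functions \<Omega>. \<forall>i\<in>Basis.
        l2_inner \<Omega> w (\<lambda>x. frechet_derivative \<psi> (at x) i) = - l2_inner \<Omega> (\<lambda>x. G x \<bullet> i) \<psi>)"

definition H1 :: "'a::euclidean_space set \<Rightarrow> ('a \<Rightarrow> real) set" where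
  "H1 \<Omega> = {w. \<exists>G. has_weak_gradient \<Omega> w G}"

text \<open>The weak gradient is unique up to null sets, so the choice is immaterial under integrals.\<close>

definition weak_grad :: "'a::euclidean_space set \<Rightarrow> ('a \<Rightarrow> real) \<Rightarrow> 'a \<Rightarrow> 'a" where
  "weak_grad \<Omega> w = (SOME G. has_weak_gradient \<Omega> w G)"

definition h1_norm :: "'a::euclidean_space set \<Rightarrow> ('a \<Rightarrow> real) \<Rightarrow> real" where
  "h1_norm \<Omega> w = sqrt ((l2_norm \<Omega> w)\<^sup>2 + (l2_norm \<Omega> (weak_grad \<Omega> w))\<^sup>2)"

definition H1_0 :: "'a::euclidean_space set \<Rightarrow> ('a \<Rightarrow> real) set" where
  "H1_0 \<Omega> = {w \<in> H1 \<Omega>. \<exists>\<psi>. (\<forall>n. \<psi> n \<in> test_functions \<Omega>) \<and>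
                 (\<lambda>n. h1_norm \<Omega> (\<lambda>x. \<psi> n x - w x)) \<longlonglongrightarrow> 0}"

section \<open>Spectral spaces of the Dirichlet Laplacian\<close>

definition coef ::
    "'a::euclidean_space set \<Rightarrow> (nat \<Rightarrow> 'a \<Rightarrow> real) \<Rightarrow> ('a \<Rightarrow> real) \<Rightarrow> nat \<Rightarrow> real" where
  "coef \<Omega> \<phi> w k = (\<integral>x. w x * \<phi> k x \<partial>lebesgue_on \<Omega>)"

definition orthonormal_basis_L2 ::
    "'a::euclidean_space set \<Rightarrow> (nat \<Rightarrow> 'a \<Rightarrow> real) \<Rightarrow> bool" where
  "orthonormal_basis_L2 \<Omega> \<phi> \<longleftrightarrow>
     (\<forall>k. \<phi> k \<in> L2 \<Omega>) \<and>
     (\<forall>j k. l2_inner \<Omega> (\<phi> j) (\<phi> k) = (if j = k then 1 else 0)) \<and>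
     (\<forall>w\<in>L2 \<Omega>. (\<lambda>n. l2_norm \<Omega> (\<lambda>x. w x - (\<Sum>k<n. coef \<Omega> \<phi> w k * \<phi> k x))) \<longlonglongrightarrow> 0)"

definition dirichlet_eigenpairs ::
    "'a::euclidean_space set \<Rightarrow> (nat \<Rightarrow> real) \<Rightarrow> (nat \<Rightarrow> 'a \<Rightarrow> real) \<Rightarrow> bool" where
  "dirichlet_eigenpairs \<Omega> lam \<phi> \<longleftrightarrow>
     (\<forall>k. \<phi> k \<in> H1_0 \<Omega> \<and> \<not> (AE x in lebesgue_on \<Omega>. \<phi> k x = 0)) \<and>
     (\<forall>k. \<forall>v\<in>H1_0 \<Omega>.
        l2_inner \<Omega> (weak_grad \<Omega> (\<phi> k)) (weak_grad \<Omega> v) = lam k * l2_inner \<Omega> (\<phi> k) v) \<and>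
     (\<forall>k. lam k > 0) \<and> filterlim lam at_top sequentially \<and>
     orthonormal_basis_L2 \<Omega> \<phi>"

definition spectral_H ::
    "'a::euclidean_space set \<Rightarrow> (nat \<Rightarrow> real) \<Rightarrow> (nat \<Rightarrow> 'a \<Rightarrow> real) \<Rightarrow> real \<Rightarrow> ('a \<Rightarrow> real) set" where
  "spectral_H \<Omega> lam \<phi> r =
     {w \<in> L2 \<Omega>. summable (\<lambda>k. lam k powr r * \<bar>coef \<Omega> \<phi> w k\<bar>\<^sup>2)}"

definition bilinear_A ::
    "'a::euclidean_space set \<Rightarrow> (nat \<Rightarrow> real) \<Rightarrow> (nat \<Rightarrow> 'a \<Rightarrow> real) \<Rightarrow> real \<Rightarrow>
     ('a \<Rightarrow> real) \<Rightarrow> ('a \<Rightarrow> real) \<Rightarrow> real" where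
  "bilinear_A \<Omega> lam \<phi> s v w = (\<Sum>k. lam k powr s * coef \<Omega> \<phi> v k * coef \<Omega> \<phi> w k)"

text \<open>For open \<open>\<Omega>\<close>, a representative that is continuous on \<open>\<Omega>\<close> is determined at every point of
  \<open>\<Omega>\<close>. In particular, if \<open>v\<close> has a representative in \<open>C\<^sub>0(\<Omega>)\<close> (continuous up to the boundary and
  vanishing there), then \<open>cont_rep \<Omega> v\<close> coincides with it on \<open>\<Omega>\<close>.\<close>

definition cont_rep :: "'a::euclidean_space set \<Rightarrow> ('a \<Rightarrow> real) \<Rightarrow> 'a \<Rightarrow> real" where
  "cont_rep \<Omega> v = (SOME g. continuous_on \<Omega> g \<and> (AE x in lebesgue_on \<Omega>. g x = v x))"

lemma cont_rep_eq:
  fixes \<Omega> :: "'a::euclidean_space set"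
  assumes "open \<Omega>" "continuous_on \<Omega> g" "AE x in lebesgue_on \<Omega>. g x = v x" "z \<in> \<Omega>"
  shows "cont_rep \<Omega> v z = g z"
proof -
  define h where "h = cont_rep \<Omega> v"
  have h: "continuous_on \<Omega> h \<and> (AE x in lebesgue_on \<Omega>. h x = v x)"
    unfolding h_def cont_rep_def
    by (rule someI[of "\<lambda>g. continuous_on \<Omega> g \<and> (AE x in lebesgue_on \<Omega>. g x = v x)" g])
      (use assms in auto)
  have "AE x in lebesgue_on \<Omega>. h x = g x"
    using h assms(3) by (auto elim: AE_mp)
  then have ae: "AE x in lebesgue. x \<in> \<Omega> \<longrightarrow> h x = g x"
    using assms(1) by (subst (asm) AE_restrict_space_iff) auto
  show ?thesis
  proof (rule ccontr)
    assume neq: "cont_rep \<Omega> v z \<noteq> g z"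
    define U where "U = \<Omega> \<inter> (\<lambda>x. h x - g x) -` (- {0})"
    have "continuous_on \<Omega> (\<lambda>x. h x - g x)"
      using h assms(2) by (intro continuous_on_diff) auto
    then have opn: "open U"
      unfolding U_def using assms(1) by (intro continuous_open_preimage) auto
    have zU: "z \<in> U"
      using neq assms(4) by (auto simp: U_def h_def)
    obtain N where N: "N \<in> null_sets lebesgue" "{x. \<not> (x \<in> \<Omega> \<longrightarrow> h x = g x)} \<subseteq> N"
      using ae by (auto simp: eventually_ae_filter)
    have "U \<subseteq> N"
      using N(2) by (auto simp: U_def)
    then have "negligible U"
      using N(1) negligible_iff_null_sets negligible_subset by blast
    then show False
      using opn zU open_not_negligible by blast
  qed
qed

section \<open>The optimal control problem\<close>

text \<open>A vector in \<open>\<real>\<^sup>\<ell>\<close> indexed by \<open>D\<close> is an extensional function on \<open>D\<close>.\<close>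

definition Q_ad :: "'a set \<Rightarrow> ('a \<Rightarrow> real) \<Rightarrow> ('a \<Rightarrow> real) \<Rightarrow> ('a \<Rightarrow> real) set" where
  "Q_ad D a b = (\<Pi>\<^sub>E z\<in>D. {a z..b z})"

definition cost_J ::
    "'a::euclidean_space set \<Rightarrow> 'a set \<Rightarrow> ('a \<Rightarrow> real) \<Rightarrow> real \<Rightarrow>
     ('a \<Rightarrow> real) \<Rightarrow> ('a \<Rightarrow> real) \<Rightarrow> real" where
  "cost_J \<Omega> D u\<^sub>\<Omega> \<alpha> u q =
     1 / 2 * (l2_norm \<Omega> (\<lambda>x. u x - u\<^sub>\<Omega> x))\<^sup>2 + \<alpha> / 2 * (L2_set q D)\<^sup>2"

definition state_eq ::
    "'a::euclidean_space set \<Rightarrow> (nat \<Rightarrow> real) \<Rightarrow> (nat \<Rightarrow> 'a \<Rightarrow> real) \<Rightarrow> real \<Rightarrow> real \<Rightarrow> 'a set \<Rightarrow>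
     ('a \<Rightarrow> real) \<Rightarrow> ('a \<Rightarrow> real) \<Rightarrow> bool" where
  "state_eq \<Omega> lam \<phi> s \<theta> D u q \<longleftrightarrow>
     (\<forall>v\<in>spectral_H \<Omega> lam \<phi> (s + \<theta>).
        bilinear_A \<Omega> lam \<phi> s u v = (\<Sum>z\<in>D. q z * cont_rep \<Omega> v z))"

definition is_optimal ::
    "'a::euclidean_space set \<Rightarrow> (nat \<Rightarrow> real) \<Rightarrow> (nat \<Rightarrow> 'a \<Rightarrow> real) \<Rightarrow> real \<Rightarrow> real \<Rightarrow> 'a set \<Rightarrow>
     ('a \<Rightarrow> real) \<Rightarrow> real \<Rightarrow> ('a \<Rightarrow> real) \<Rightarrow> ('a \<Rightarrow> real) \<Rightarrow> ('a \<Rightarrow> real) \<Rightarrow> ('a \<Rightarrow> real) \<Rightarrow> bool" where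
  "is_optimal \<Omega> lam \<phi> s \<theta> D u\<^sub>\<Omega> \<alpha> a b u q \<longleftrightarrow>
     is_arg_min (\<lambda>(u, q). cost_J \<Omega> D u\<^sub>\<Omega> \<alpha> u q)
       (\<lambda>(u, q). u \<in> spectral_H \<Omega> lam \<phi> (s - \<theta>) \<and> q \<in> Q_ad D a b \<and>
                  state_eq \<Omega> lam \<phi> s \<theta> D u q)
       (u, q)"

end

theory Submission
  imports Defs "HOL-Computational_Algebra.Polynomial"
begin

text \<open>Testing the state equation with the eigenfunctions shows that the state belonging to \<open>q\<close> has the
  coefficients \<open>\<lambda>\<^sub>k\<^sup>-\<^sup>s (\<Sum>z\<in>D. q\<^sub>z \<phi>\<^sub>k(z))\<close>; it depends linearly on \<open>q\<close>, so the reduced cost is a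
  continuous, strictly convex function on a compact box. What has to be proved is that
  \<open>\<Sum>\<^sub>k \<lambda>\<^sub>k\<^sup>-\<^sup>r \<phi>\<^sub>k(z)\<^sup>2\<close> is finite, locally uniformly in \<open>z\<close>, for \<open>r > d/2\<close>: by Cauchy--Schwarz this
  makes the eigenfunction expansion of \<open>v \<in> H\<^sup>r\<close> converge locally uniformly, hence to the continuous
  representative of \<open>v\<close>, and it puts the states into \<open>H\<^sup>s\<^sup>-\<^sup>\<theta>\<close>. Only interior regularity is needed for
  point values in \<open>\<Omega>\<close>, so the boundary plays no role.

  If \<open>-\<Delta>f = g\<close> in the sense of distributions with \<open>f, g \<in> L\<^sup>2\<close>, then the derivative in \<open>R\<close> of the
  mollification of \<open>f\<close> at radius \<open>R\<close> is a multiple of the integral of \<open>g\<close> against a bump of radius \<open>R\<close>,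
  and integrating in \<open>R\<close> gives (as \<open>d < 4\<close>)
  \<open>\<bar>f(z)\<bar> \<le> C (R\<^sup>-\<^sup>d\<^sup>/\<^sup>2 \<parallel>f\<parallel> + R\<^sup>2\<^sup>-\<^sup>d\<^sup>/\<^sup>2 \<parallel>g\<parallel>)\<close>. For combinations \<open>f\<close> of eigenfunctions with
  \<open>\<lambda>\<^sub>k \<le> \<Lambda>\<close> and \<open>R\<close> of order \<open>\<Lambda>\<^sup>-\<^sup>1\<^sup>/\<^sup>2\<close> this yields
  \<open>(\<Sum>\<lambda>\<^sub>k \<le> \<Lambda>. \<phi>\<^sub>k(z)\<^sup>2) \<le> C \<Lambda>\<^sup>d\<^sup>/\<^sup>2\<close>, and a dyadic decomposition gives the weighted sum.\<close>

section \<open>Smooth functions\<close>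

text \<open>An eigenfunction is given only as an element of L^2, so its point values must first be
  constructed: they are limits of averages over shrinking balls, and one estimate for the dependence
  of the average on the radius yields existence of the limit, continuity and the size bound
  together. With b(t) = e^(-1/t) for t > 0 and 0 otherwise, the R-derivative of the kernel 2 R^(-d)
  b'(1 - |y - z|^2/R^2) is exactly R^(1-d) times the Laplacian in y of b(1 - |y - z|^2/R^2), so a
  single test function per radius brings in the equation.

  Bounding the eigenfunctions one by one would lose a factor equal to the number of eigenvalues up
  to \<Lambda>. The bound is therefore proved for all of them together, through the combination
  whose value at z is the sum of squares.

  The weighted sum is used at two exponents: r = 2s makes the coefficients of the states
  square-summable, and r = s + \<theta> serves both point evaluation on H^(s+\<theta>) and
  membership of the states in H^(s-\<theta>), since (s-\<theta>) - 2s = -(s+\<theta>).\<close>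

definition exp_tail :: "real poly \<Rightarrow> real \<Rightarrow> real" where
  "exp_tail p x = (if x > 0 then poly p (1 / x) * exp (- (1 / x)) else 0)"

text \<open>With y = 1/x one has dy/dx = -y^2, so the derivative of p(y) e^(-y) is y^2 (p - p')(y)
  e^(-y): the family is closed under differentiation, and this is the new polynomial.\<close>

definition exp_tail_next :: "real poly \<Rightarrow> real poly" where
  "exp_tail_next p = [:0, 0, 1:] * (p - pderiv p)"

lemma poly_exp_decay: "((\<lambda>y. poly p y * exp (- y)) \<longlongrightarrow> (0::real)) at_top"
proof -
  have "((\<lambda>y. \<Sum>i\<le>degree p. coeff p i * (y ^ i / exp y)) \<longlongrightarrow> (\<Sum>i\<le>degree p. coeff p i * 0)) at_top"
    by (intro tendsto_intros tendsto_power_div_exp_0)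
  then show ?thesis
    by (simp add: poly_altdef sum_distrib_right exp_minus divide_inverse mult.assoc)
qed

lemma exp_tail_tendsto_0: "(exp_tail p \<longlongrightarrow> 0) (at 0)"
proof -
  have "filterlim (\<lambda>x::real. 1 / x) at_top (at_right 0)"
    by (simp add: divide_inverse filterlim_inverse_at_top_right)
  from filterlim_compose[OF poly_exp_decay this]
  have "((\<lambda>x. poly p (1 / x) * exp (- (1 / x))) \<longlongrightarrow> 0) (at_right 0)" .
  then have R: "(exp_tail p \<longlongrightarrow> 0) (at_right 0)"
    by (rule Lim_transform_eventually)
      (auto simp: exp_tail_def eventually_at_right_less eventually_at_topological intro!: exI[of _ UNIV])
  have "((\<lambda>_. 0) \<longlongrightarrow> (0::real)) (at_left (0::real))" by simp
  then have L: "(exp_tail p \<longlongrightarrow> 0) (at_left 0)"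
    by (rule Lim_transform_eventually)
      (auto simp: exp_tail_def eventually_at_topological intro!: exI[of _ UNIV])
  show ?thesis
    using L R by (simp add: filterlim_split_at)
qed

lemma exp_tail_has_derivative:
  "(exp_tail p has_real_derivative exp_tail (exp_tail_next p) x) (at x)"
proof -
  consider "x > 0" | "x = 0" | "x < 0" by linarith
  then show ?thesis
  proof cases
    case 1
    have "((\<lambda>x. poly p (1 / x) * exp (- (1 / x))) has_real_derivative
        exp_tail (exp_tail_next p) x) (at x)"
      using 1
      by (auto intro!: derivative_eq_intros poly_DERIV[THEN DERIV_chain2]
          simp: exp_tail_def exp_tail_next_def field_simps power2_eq_square)
    then show ?thesis
    proof (rule has_field_derivative_transform_within_open[of _ _ _ "{0<..}"])
    qed (use 1 in \<open>auto simp: exp_tail_def\<close>)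
  next
    case 2
    \<comment> \<open>Division by h multiplies p(1/h) by 1/h, so the difference quotient at 0 is
      again an \<open>exp_tail\<close>, now of \<open>pCons 0 p\<close>.\<close>
    have "((\<lambda>h. exp_tail p h / h) \<longlongrightarrow> 0) (at 0)"
      using exp_tail_tendsto_0[of "pCons 0 p"]
      by (rule Lim_transform_eventually)
        (auto simp: exp_tail_def eventually_at_topological intro!: exI[of _ UNIV])
    then show ?thesis
      using 2 by (auto simp: DERIV_def exp_tail_def)
  next
    case 3
    have "((\<lambda>x. 0) has_real_derivative exp_tail (exp_tail_next p) x) (at x)"
      using 3 by (auto simp: exp_tail_def)
    then show ?thesis
    proof (rule has_field_derivative_transform_within_open[of _ _ _ "{..<0}"])
    qed (use 3 in \<open>auto simp: exp_tail_def\<close>)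
  qed
qed

text \<open>The n-th derivative of e^(-1/x), extended by 0 to x \<le> 0. Indexing by the order turns
  differentiation into a shift of n.\<close>

definition bump :: "nat \<Rightarrow> real \<Rightarrow> real" where
  "bump n = exp_tail ((exp_tail_next ^^ n) 1)"

lemma bump_deriv: "(bump n has_real_derivative bump (Suc n) x) (at x)"
  unfolding bump_def funpow.simps o_def by (rule exp_tail_has_derivative)

lemma bump_zero: "x \<le> 0 \<Longrightarrow> bump n x = 0"
  by (simp add: bump_def exp_tail_def)

lemma bump_0: "bump 0 x = (if x > 0 then exp (- (1 / x)) else 0)"
  by (simp add: bump_def exp_tail_def)

lemma bump_1: "bump 1 x = (if x > 0 then exp (- (1 / x)) / x\<^sup>2 else 0)"
  by (simp add: bump_def exp_tail_def exp_tail_next_def power2_eq_square)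

lemma bump_0_bounds: "0 \<le> bump 0 x" "bump 0 x \<le> 1"
  by (auto simp: bump_0)

lemma continuous_on_bump: "continuous_on S (bump n)"
  by (meson bump_deriv DERIV_isCont continuous_at_imp_continuous_on)

lemma continuous_on_bump' [continuous_intros]:
  "continuous_on S f \<Longrightarrow> continuous_on S (\<lambda>x. bump n (f x))"
  using continuous_on_compose2[OF continuous_on_bump[of UNIV]] by blast

text \<open>The range x \<le> 1 is the one that occurs, since the arguments are 1 - |y - z|^2/R^2.
  Below 0 the function vanishes, and [0,1] is compact.\<close>

lemma bump_bounded:
  obtains B where "B > 0" "\<And>x. x \<le> 1 \<Longrightarrow> \<bar>bump n x\<bar> \<le> B"
proof -
  have "compact (bump n ` {0..1})"
    by (intro compact_continuous_image continuous_on_bump) auto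
  then obtain B where B: "B > 0" "\<forall>y\<in>bump n ` {0..1}. norm y \<le> B"
    using bounded_pos compact_imp_bounded by metis
  have "\<bar>bump n x\<bar> \<le> B" if "x \<le> 1" for x
    using B that bump_zero[of x n] by (cases "x \<ge> 0") auto
  then show ?thesis using B(1) that by blast
qed

section \<open>Closure properties of k-fold differentiability\<close>

lemma C_k_imp_continuous: "C_k k f \<Longrightarrow> continuous_on S f"
  by (cases k)
    (auto intro: continuous_on_subset differentiable_imp_continuous_within
      simp: continuous_on_eq_continuous_within intro: continuous_at_imp_continuous_at_within)

lemma C_k_SucD: "C_k (Suc k) f \<Longrightarrow> C_k k f"
proof (induction k arbitrary: f)
  case 0
  then show ?case using C_k_imp_continuous by fastforce
qed auto

lemma frechet_derivative_eqI:
  "(f has_derivative f') (at x) \<Longrightarrow> frechet_derivative f (at x) = f'"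
  by (metis frechet_derivative_at)

lemma C_k_const: "C_k k (\<lambda>x. c)"
  by (induction k arbitrary: c) auto

lemma C_k_inner: "C_k k (\<lambda>x. x \<bullet> u)"
proof (cases k)
  case (Suc m)
  have D: "((\<lambda>x. x \<bullet> u) has_derivative (\<lambda>h. h \<bullet> u)) (at x)" for x :: 'a
    by (auto intro!: derivative_eq_intros)
  then show ?thesis
    by (auto simp: Suc frechet_derivative_eqI[OF D] C_k_const differentiable_def)
qed (auto intro!: continuous_intros)

lemma C_k_add: "C_k k f \<Longrightarrow> C_k k g \<Longrightarrow> C_k k (\<lambda>x. f x + g x)"
proof (induction k arbitrary: f g)
  case (Suc k)
  have D: "((\<lambda>x. f x + g x) has_derivative
      (\<lambda>h. frechet_derivative f (at x) h + frechet_derivative g (at x) h)) (at x)" for x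
    using Suc.prems by (auto intro!: derivative_eq_intros simp: frechet_derivative_works[symmetric])
  then show ?case
    using Suc.prems by (auto simp: frechet_derivative_eqI[OF D] differentiable_def intro!: Suc.IH)
qed (auto intro: continuous_intros)

lemma C_k_mult: "C_k k f \<Longrightarrow> C_k k g \<Longrightarrow> C_k k (\<lambda>x. f x * g x)"
proof (induction k arbitrary: f g)
  case (Suc k)
  have D: "((\<lambda>x. f x * g x) has_derivative
      (\<lambda>h. f x * frechet_derivative g (at x) h + frechet_derivative f (at x) h * g x)) (at x)" for x
    using Suc.prems by (intro has_derivative_mult) (auto simp: frechet_derivative_works[symmetric])
  show ?case
    using Suc.prems C_k_SucD[OF Suc.prems(1)] C_k_SucD[OF Suc.prems(2)] D
    by (auto simp: frechet_derivative_eqI[OF D] differentiable_def intro!: Suc.IH C_k_add)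
qed (auto intro: continuous_intros)

text \<open>Differentiating \<open>G n\<close> after q gives \<open>G (Suc n)\<close> after q times
  a derivative of q, so the induction on k has to run over all members of the family G at
  once.\<close>

lemma C_k_compose:
  assumes G: "\<And>n x. (G n has_real_derivative G (Suc n) x) (at x)"
    and q: "\<And>k. C_k k q"
  shows "C_k k (\<lambda>x. G n (q x))"
proof (induction k arbitrary: n)
  case 0
  have "continuous_on UNIV (G n)" 
    by (meson G DERIV_isCont continuous_at_imp_continuous_on)
  then show ?case
    using continuous_on_compose2[OF _ C_k_imp_continuous[OF q[of 0]], of UNIV "G n"] by auto
next
  case (Suc k)
  have q1: "(q has_derivative frechet_derivative q (at x)) (at x)" for x
    using q[of 1] by (auto simp: frechet_derivative_works[symmetric])
  have D: "((\<lambda>x. G n (q x)) has_derivative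
      (\<lambda>h. G (Suc n) (q x) * frechet_derivative q (at x) h)) (at x)" for x
    using has_derivative_compose[OF q1 G[of n, unfolded has_field_derivative_def]] by simp
  have "C_k k (\<lambda>x. frechet_derivative q (at x) i)" if "i \<in> Basis" for i
    using q[of "Suc k"] that by auto
  then show ?case
    using D by (auto simp: frechet_derivative_eqI[OF D] differentiable_def intro!: C_k_mult Suc.IH)
qed

lemma C_k_sum: "(\<And>i. i \<in> A \<Longrightarrow> C_k k (f i)) \<Longrightarrow> C_k k (\<lambda>x. \<Sum>i\<in>A. f i x)"
  by (induction A rule: infinite_finite_induct) (auto intro: C_k_const C_k_add)

lemma C_k_prod: "(\<And>i. i \<in> A \<Longrightarrow> C_k k (f i)) \<Longrightarrow> C_k k (\<lambda>x. \<Prod>i\<in>A. f i x)"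
  by (induction A rule: infinite_finite_induct) (auto intro: C_k_const C_k_mult)

lemma C_k_minus: "C_k k f \<Longrightarrow> C_k k (\<lambda>x. - f x)"
  using C_k_mult[OF C_k_const[of k "-1"]] by auto

lemma C_k_diff: "C_k k f \<Longrightarrow> C_k k g \<Longrightarrow> C_k k (\<lambda>x. f x - g x)"
  using C_k_add[OF _ C_k_minus] by auto

section \<open>Test functions\<close>

lemma test_functionD:
  assumes "\<psi> \<in> test_functions \<Omega>"
  shows "C_k k \<psi>" "compact (closure {x. \<psi> x \<noteq> 0})" "closure {x. \<psi> x \<noteq> 0} \<subseteq> \<Omega>"
    "continuous_on S \<psi>" "\<psi> differentiable (at x)"
    "\<psi> x \<noteq> 0 \<Longrightarrow> x \<in> \<Omega>"
  using assms C_k_imp_continuous[of 0 \<psi>] C_k.simps(2)[of 0 \<psi>] closure_subset[of "{x. \<psi> x \<noteq> 0}"]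
  by (auto simp: test_functions_def simp del: C_k.simps compact_closure intro: continuous_on_subset)

lemma test_functionI:
  assumes "\<And>k. C_k k \<psi>" "compact K" "K \<subseteq> \<Omega>" "\<And>x. \<psi> x \<noteq> 0 \<Longrightarrow> x \<in> K"
  shows "\<psi> \<in> test_functions \<Omega>"
proof -
  have "closure {x. \<psi> x \<noteq> 0} \<subseteq> K"
    using assms(2,4) by (intro closure_minimal) (auto simp: compact_imp_closed)
  then have "compact (closure {x. \<psi> x \<noteq> 0})"
    by (meson assms(2) bounded_subset closed_closure compact_eq_bounded_closed)
  then show ?thesis
    using assms \<open>closure _ \<subseteq> K\<close> by (auto simp: test_functions_def)
qed

lemma frechet_derivative_eq_0_outside_support:
  assumes "x \<notin> closure {x. \<psi> x \<noteq> 0}"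
  shows "frechet_derivative \<psi> (at x) = (\<lambda>h. 0)"
proof (rule frechet_derivative_eqI)
  show "(\<psi> has_derivative (\<lambda>h. 0)) (at x)"
    using closure_subset[of "{x. \<psi> x \<noteq> 0}"] assms
    by (intro has_derivative_transform_within_open[OF has_derivative_const[of 0],
          where s="- closure {x. \<psi> x \<noteq> 0}"]) auto
qed

lemma test_function_deriv:
  assumes "\<psi> \<in> test_functions \<Omega>" "i \<in> Basis"
  shows "(\<lambda>x. frechet_derivative \<psi> (at x) i) \<in> test_functions \<Omega>"
proof (rule test_functionI[of _ "closure {x. \<psi> x \<noteq> 0}"])
  show "C_k k (\<lambda>x. frechet_derivative \<psi> (at x) i)" for k
    using test_functionD(1)[OF assms(1), of "Suc k"] assms(2) by auto
  show "x \<in> closure {x. \<psi> x \<noteq> 0}" if "frechet_derivative \<psi> (at x) i \<noteq> 0" for x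
    using that frechet_derivative_eq_0_outside_support by metis
qed (use test_functionD[OF assms(1)] in auto)

lemma test_function_mult:
  assumes "f \<in> test_functions \<Omega>" "\<And>k. C_k k g"
  shows "(\<lambda>x. f x * g x) \<in> test_functions \<Omega>"
  by (rule test_functionI[of _ "closure {x. f x \<noteq> 0}"])
    (use assms closure_subset[of "{x. f x \<noteq> 0}"] in \<open>auto simp: test_functionD simp del: compact_closure intro!: C_k_mult\<close>)

lemma test_function_zero: "(\<lambda>x. 0) \<in> test_functions \<Omega>"
  by (rule test_functionI[of _ "{}"]) (auto intro: C_k_const)

lemma test_function_bounded:
  assumes "\<psi> \<in> test_functions \<Omega>"
  obtains B where "B > 0" "\<And>x. \<bar>\<psi> x\<bar> \<le> B"
proof -
  have "compact (\<psi> ` closure {x. \<psi> x \<noteq> 0})"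
    by (intro compact_continuous_image test_functionD[OF assms])
  then obtain B where B: "B > 0" "\<forall>y\<in>\<psi> ` closure {x. \<psi> x \<noteq> 0}. norm y \<le> B"
    using bounded_pos compact_imp_bounded by metis
  then have "\<bar>\<psi> x\<bar> \<le> B" for x
    using closure_subset[of "{x. \<psi> x \<noteq> 0}"] by (cases "\<psi> x = 0") auto
  then show ?thesis using B(1) that by blast
qed

text \<open>These functions increase to the indicator function of an open box as \<open>n \<rightarrow> \<infinity>\<close>.\<close>

lemma box_test_function:
  assumes "cbox a b \<subseteq> \<Omega>"
  shows "(\<lambda>x. \<Prod>i\<in>Basis. bump 0 (real n * (x \<bullet> i - a \<bullet> i)) * bump 0 (real n * (b \<bullet> i - x \<bullet> i)))
    \<in> test_functions \<Omega>" (is "?\<psi> \<in> _")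
proof (rule test_functionI[OF _ compact_cbox assms])
  fix x assume "?\<psi> x \<noteq> 0"
  then have "\<forall>i\<in>Basis. bump 0 (real n * (x \<bullet> i - a \<bullet> i)) \<noteq> 0 \<and> bump 0 (real n * (b \<bullet> i - x \<bullet> i)) \<noteq> 0"
    by auto
  then have "\<forall>i\<in>Basis. a \<bullet> i \<le> x \<bullet> i \<and> x \<bullet> i \<le> b \<bullet> i"
    by (auto simp: bump_0 zero_less_mult_iff split: if_splits)
  then show "x \<in> cbox a b" by (auto simp: mem_box)
qed (intro C_k_prod C_k_mult C_k_compose[of bump] bump_deriv C_k_diff C_k_inner C_k_const)+

lemma bump_scaled_tendsto: "(\<lambda>n. bump 0 (real n * t)) \<longlonglongrightarrow> (if t > 0 then 1 else 0)"
proof (cases "t > 0")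
  case True
  have "(\<lambda>n. exp (- (1 / (real n * t)))) \<longlonglongrightarrow> exp (- (0 * (1 / t)))"
    using tendsto_mult[OF lim_1_over_n tendsto_const[of "1/t"]]
    by (intro tendsto_exp tendsto_minus) simp
  then have "(\<lambda>n. exp (- (1 / (real n * t)))) \<longlonglongrightarrow> 1" by simp
  then have "(\<lambda>n. bump 0 (real n * t)) \<longlonglongrightarrow> 1"
    by (rule Lim_transform_eventually)
      (use eventually_gt_at_top[of 0] in eventually_elim, use True in \<open>auto simp: bump_0\<close>)
  then show ?thesis using True by simp
next
  case False
  then have "real n * t \<le> 0" for n by (simp add: mult_le_0_iff)
  then show ?thesis using False by (simp add: bump_zero)
qed

lemma box_test_function_tendsto:
  "(\<lambda>n. \<Prod>i\<in>Basis. bump 0 (real n * (x \<bullet> i - a \<bullet> i)) * bump 0 (real n * (b \<bullet> i - x \<bullet> i)))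
    \<longlonglongrightarrow> indicator (box a b) x"
proof -
  have "(\<lambda>n. \<Prod>i\<in>Basis. bump 0 (real n * (x \<bullet> i - a \<bullet> i)) * bump 0 (real n * (b \<bullet> i - x \<bullet> i)))
    \<longlonglongrightarrow> (\<Prod>i\<in>Basis. (if x \<bullet> i - a \<bullet> i > 0 then 1 else 0) * (if b \<bullet> i - x \<bullet> i > 0 then 1 else 0))"
    by (intro tendsto_intros bump_scaled_tendsto)
  also have "(\<Prod>i\<in>Basis. (if x \<bullet> i - a \<bullet> i > 0 then 1 else 0) * (if b \<bullet> i - x \<bullet> i > 0 then 1 else 0))
    = (indicator (box a b) x :: real)"
    by (auto simp: indicator_def mem_box split: if_splits)
  finally show ?thesis .
qed

section \<open>Square-integrable functions on bounded open sets\<close>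

lemma open_bounded_lebesgue:
  assumes "open \<Omega>" "bounded \<Omega>"
  shows "\<Omega> \<in> sets lebesgue" "finite_measure (lebesgue_on \<Omega>)" "\<Omega> \<in> lmeasurable"
  using assms by (auto intro!: finite_measure_lebesgue_on bounded_set_imp_lmeasurable)

lemma L2_realD:
  fixes f :: "'a::euclidean_space \<Rightarrow> real"
  assumes "f \<in> L2 \<Omega>"
  shows "f \<in> borel_measurable (lebesgue_on \<Omega>)" "integrable (lebesgue_on \<Omega>) (\<lambda>x. (f x)\<^sup>2)"
  using assms by (auto simp: L2_def)

lemma L2_mult_integrable:
  fixes f g :: "'a::euclidean_space \<Rightarrow> real"
  assumes "f \<in> L2 \<Omega>" "g \<in> L2 \<Omega>"
  shows "integrable (lebesgue_on \<Omega>) (\<lambda>x. f x * g x)"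
proof (rule Bochner_Integration.integrable_bound[of _ "\<lambda>x. (f x)\<^sup>2 + (g x)\<^sup>2"])
  have "\<bar>f x * g x\<bar> \<le> (f x)\<^sup>2 + (g x)\<^sup>2" for x
    using sum_squares_bound[of "\<bar>f x\<bar>" "\<bar>g x\<bar>"] abs_ge_zero[of "f x * g x"]
    unfolding abs_mult power2_abs by linarith
  then show "AE x in lebesgue_on \<Omega>. norm (f x * g x) \<le> norm ((f x)\<^sup>2 + (g x)\<^sup>2)"
    by auto
qed (use L2_realD[OF assms(1)] L2_realD[OF assms(2)] in auto)

lemma L2_add:
  fixes f g :: "'a::euclidean_space \<Rightarrow> real"
  assumes "f \<in> L2 \<Omega>" "g \<in> L2 \<Omega>"
  shows "(\<lambda>x. f x + g x) \<in> L2 \<Omega>"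
proof -
  have "integrable (lebesgue_on \<Omega>) (\<lambda>x. (f x)\<^sup>2 + (g x)\<^sup>2 + 2 * (f x * g x))"
    using L2_mult_integrable[OF assms] L2_realD[OF assms(1)] L2_realD[OF assms(2)] by simp
  then show ?thesis
    using L2_realD[OF assms(1)] L2_realD[OF assms(2)] by (simp add: L2_def power2_sum mult.assoc)
qed

lemma L2_cmult:
  fixes f :: "'a::euclidean_space \<Rightarrow> real"
  assumes "f \<in> L2 \<Omega>"
  shows "(\<lambda>x. c * f x) \<in> L2 \<Omega>"
  using L2_realD[OF assms] by (auto simp: L2_def power_mult_distrib)

lemma L2_diff:
  fixes f g :: "'a::euclidean_space \<Rightarrow> real"
  assumes "f \<in> L2 \<Omega>" "g \<in> L2 \<Omega>"
  shows "(\<lambda>x. f x - g x) \<in> L2 \<Omega>"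
  using L2_add[OF assms(1) L2_cmult[OF assms(2), of "-1"]] by simp

lemma L2_zero: "(\<lambda>x. 0 :: real) \<in> L2 \<Omega>"
  by (simp add: L2_def)

lemma L2_sum:
  fixes f :: "'i \<Rightarrow> 'a::euclidean_space \<Rightarrow> real"
  assumes "\<And>i. i \<in> A \<Longrightarrow> f i \<in> L2 \<Omega>"
  shows "(\<lambda>x. \<Sum>i\<in>A. f i x) \<in> L2 \<Omega>"
  using assms by (induction A rule: infinite_finite_induct) (auto intro: L2_zero L2_add)

lemma L2_bounded:
  fixes f :: "'a::euclidean_space \<Rightarrow> real"
  assumes "open \<Omega>" "bounded \<Omega>" "f \<in> borel_measurable (lebesgue_on \<Omega>)" "\<And>x. \<bar>f x\<bar> \<le> B"
  shows "f \<in> L2 \<Omega>"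
proof -
  interpret finite_measure "lebesgue_on \<Omega>" by (rule open_bounded_lebesgue[OF assms(1,2)])
  have "(f x)\<^sup>2 \<le> B\<^sup>2" for x
    using assms(4)[of x] power_mono[of "\<bar>f x\<bar>" B 2] by auto
  then have "integrable (lebesgue_on \<Omega>) (\<lambda>x. (f x)\<^sup>2)"
    using assms(3) by (intro integrable_const_bound[where B="B\<^sup>2"]) auto
  then show ?thesis using assms(3) by (simp add: L2_def)
qed

lemma L2_integrable:
  fixes f :: "'a::euclidean_space \<Rightarrow> real"
  assumes "open \<Omega>" "bounded \<Omega>" "f \<in> L2 \<Omega>"
  shows "integrable (lebesgue_on \<Omega>) f"
  using L2_mult_integrable[OF assms(3) L2_bounded[OF assms(1,2), of "\<lambda>_. 1" 1]] by simp

lemma test_function_measurable: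
  assumes "open \<Omega>" "\<psi> \<in> test_functions \<Omega>'"
  shows "\<psi> \<in> borel_measurable (lebesgue_on \<Omega>)"
  using assms by (intro continuous_imp_measurable_on_sets_lebesgue test_functionD) auto

lemma test_function_L2:
  assumes "open \<Omega>" "bounded \<Omega>" "\<psi> \<in> test_functions \<Omega>'"
  shows "\<psi> \<in> L2 \<Omega>"
proof -
  obtain B where "\<And>x. \<bar>\<psi> x\<bar> \<le> B" using test_function_bounded[OF assms(3)] by blast
  then show ?thesis
    using test_function_measurable[OF assms(1,3)] by (intro L2_bounded[OF assms(1,2)])
qed

lemma L2_component:
  assumes "G \<in> L2 \<Omega>" "norm i \<le> 1"
  shows "(\<lambda>x. G x \<bullet> i) \<in> L2 \<Omega>"
proof -
  have "\<bar>G x \<bullet> i\<bar> \<le> norm (G x)" for x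
    using Cauchy_Schwarz_ineq2[of "G x" i] assms(2)
    by (meson mult_left_le norm_ge_zero order_trans)
  then have "(G x \<bullet> i)\<^sup>2 \<le> (norm (G x))\<^sup>2" for x
    using power_mono[of "\<bar>G x \<bullet> i\<bar>" "norm (G x)" 2] by simp
  then show ?thesis
    using assms by (auto simp: L2_def intro: Bochner_Integration.integrable_bound[of _ "\<lambda>x. (norm (G x))\<^sup>2"])
qed

lemma L2_from_components:
  fixes f :: "'a \<Rightarrow> 'a::euclidean_space \<Rightarrow> real"
  assumes "\<And>i. i \<in> Basis \<Longrightarrow> f i \<in> L2 \<Omega>"
  shows "(\<lambda>x. \<Sum>i\<in>Basis. f i x *\<^sub>R i) \<in> L2 \<Omega>"
proof -
  have "(norm (\<Sum>i\<in>Basis. f i x *\<^sub>R i))\<^sup>2 = (\<Sum>i\<in>Basis. (f i x)\<^sup>2)" for x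
    by (subst power2_norm_eq_inner, subst euclidean_inner) (simp add: power2_eq_square)
  moreover have "(\<lambda>x. \<Sum>i\<in>Basis. f i x *\<^sub>R i) \<in> borel_measurable (lebesgue_on \<Omega>)"
    by (intro borel_measurable_sum borel_measurable_scaleR L2_realD[OF assms] measurable_const) auto
  moreover have "integrable (lebesgue_on \<Omega>) (\<lambda>x. \<Sum>i\<in>Basis. (f i x)\<^sup>2)"
    by (intro Bochner_Integration.integrable_sum L2_realD[OF assms])
  ultimately show ?thesis
    by (simp add: L2_def)
qed

lemma L2_inner_integrable:
  assumes "F \<in> L2 \<Omega>" "G \<in> L2 \<Omega>" "i \<in> Basis"
  shows "integrable (lebesgue_on \<Omega>) (\<lambda>x. (F x \<bullet> i) * (G x \<bullet> i))"
  using assms by (intro L2_mult_integrable L2_component) auto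

section \<open>The fundamental lemma of the calculus of variations\<close>

text \<open>Open boxes are an intersection-stable generator of the Borel sets, so a Dynkin argument
  makes the integrals of g vanish on every Borel set, and uniqueness of densities gives g = 0. The
  integral over the whole space enters in the complement step.\<close>

lemma AE_eq_0_if_box_integrals_0:
  fixes g :: "'a::euclidean_space \<Rightarrow> real"
  assumes g: "integrable lborel g"
    and box: "\<And>a b. (LINT x:box a b|lborel. g x) = 0"
    and UNIV: "(LINT x|lborel. g x) = 0"
  shows "AE x in lborel. g x = 0"
proof (rule density_unique_real)
  have si: "set_integrable lborel A g" if "A \<in> sets borel" for A
    unfolding set_integrable_def by (rule integrable_mult_indicator) (use g that in auto)
  fix A :: "'a set" assume "A \<in> sets lborel"
  then have A: "A \<in> sigma_sets UNIV (range (\<lambda>(a, b). box a b))"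
    by (subst (asm) sets_lborel, subst (asm) borel_eq_box) auto
  have st: "Int_stable (range (\<lambda>(a, b). box a b :: 'a set))"
    by (auto simp: Int_stable_def box_Int_box)
  have borel: "B \<in> sets borel"
    if "B \<in> sigma_sets UNIV (range (\<lambda>(a, b). box a b :: 'a set))" for B
    using that by (subst borel_eq_box) auto
  have "range (\<lambda>(a, b). box a b :: 'a set) \<subseteq> Pow UNIV" by simp
  from st this A have "(LINT x:A|lborel. g x) = 0"
  proof (induction rule: sigma_sets_induct_disjoint)
    case (compl A)
    have "(LINT x:A \<union> (UNIV - A)|lborel. g x) = (LINT x:A|lborel. g x) + (LINT x:UNIV - A|lborel. g x)"
      using borel[OF compl(1)] by (intro set_integral_Un si) auto
    moreover have "(LINT x:A \<union> (UNIV - A)|lborel. g x) = 0"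
      using UNIV by (simp add: set_lebesgue_integral_def)
    ultimately show ?case using compl(2) by linarith
  next
    case (union A)
    have A: "A i \<in> sets borel" for i using borel union(2) by blast
    have disj: "A i \<inter> A j = {}" if "i \<noteq> j" for i j
      using union(1) that by (auto simp: disjoint_family_on_def)
    have "(LINT x:(\<Union>i. A i)|lborel. g x) = (\<Sum>i. LINT x:A i|lborel. g x)"
      by (rule lebesgue_integral_countable_add[OF _ disj si]) (use A in auto)
    then show ?case unfolding union(3) by simp
  next
    case (basic A)
    then obtain a b where "A = box a b" by auto
    then show ?case by (simp add: box)
  next
    case empty
    show ?case by (simp add: set_lebesgue_integral_def)
  qed
  then show "(LINT x:A|lborel. g x) = (LINT x:A|lborel. 0)" by simp
qed (use g in auto)

text \<open>The functions of \<open>box_test_function\<close> are bounded by 1 and tend to the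
  indicator of the open box, so |f| is a majorant for dominated convergence.\<close>

lemma integral_box_eq_0:
  fixes f :: "'a::euclidean_space \<Rightarrow> real"
  assumes f: "integrable (lebesgue_on \<Omega>) f" and "open \<Omega>" "cbox a b \<subseteq> \<Omega>"
    and test: "\<And>\<psi>. \<psi> \<in> test_functions \<Omega> \<Longrightarrow> (\<integral>x. f x * \<psi> x \<partial>lebesgue_on \<Omega>) = 0"
  shows "(\<integral>x. f x * indicator (box a b) x \<partial>lebesgue_on \<Omega>) = 0"
proof -
  define \<psi> where "\<psi> n x = (\<Prod>i\<in>Basis. bump 0 (real n * (x \<bullet> i - a \<bullet> i)) * bump 0 (real n * (b \<bullet> i - x \<bullet> i)))" for n x
  have \<psi>: "\<psi> n \<in> test_functions \<Omega>" for n
    unfolding \<psi>_def by (rule box_test_function[OF assms(3)])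
  have le: "\<bar>\<psi> n x\<bar> \<le> 1" for n x
    by (auto simp: \<psi>_def abs_prod abs_mult bump_0_bounds intro!: prod_le_1 mult_le_one)
  have "(\<lambda>n. \<integral>x. f x * \<psi> n x \<partial>lebesgue_on \<Omega>) \<longlonglongrightarrow> (\<integral>x. f x * indicator (box a b) x \<partial>lebesgue_on \<Omega>)"
  proof (rule integral_dominated_convergence[where w="\<lambda>x. \<bar>f x\<bar>"])
    have "\<psi> n \<in> borel_measurable (lebesgue_on \<Omega>)" for n
      by (rule test_function_measurable[OF assms(2) \<psi>])
    then show "(\<lambda>x. f x * \<psi> n x) \<in> borel_measurable (lebesgue_on \<Omega>)" for n
      using f by auto
    have "(indicator (box a b) :: 'a \<Rightarrow> real) \<in> borel_measurable (lebesgue_on \<Omega>)"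
      by (intro measurable_restrict_space1 borel_measurable_indicator) auto
    then show "(\<lambda>x. f x * indicator (box a b) x) \<in> borel_measurable (lebesgue_on \<Omega>)"
      by (intro borel_measurable_times borel_measurable_integrable[OF f])
    show "AE x in lebesgue_on \<Omega>. (\<lambda>n. f x * \<psi> n x) \<longlonglongrightarrow> f x * indicator (box a b) x"
      unfolding \<psi>_def by (intro AE_I2 tendsto_mult tendsto_const box_test_function_tendsto)
    show "AE x in lebesgue_on \<Omega>. norm (f x * \<psi> n x) \<le> \<bar>f x\<bar>" for n
      using le by (intro AE_I2) (simp add: abs_mult mult_left_le)
  qed (use f in auto)
  then show ?thesis using test[OF \<psi>] by (simp add: LIMSEQ_const_iff)
qed

text \<open>An open set is a countable union of closed boxes, and the boundary of a box is a null
  set. This reduces statements on \<Omega> to boxes that stay compactly inside it.\<close>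

lemma AE_on_open_if_boxes:
  fixes \<Omega> :: "'a::euclidean_space set"
  assumes "open \<Omega>" and box: "\<And>c d. cbox c d \<subseteq> \<Omega> \<Longrightarrow> AE x in lebesgue_on (box c d). P x"
  shows "AE x in lebesgue_on \<Omega>. P x"
proof -
  have cbox: "AE x in lebesgue. x \<in> cbox c d \<longrightarrow> P x" if "cbox c d \<subseteq> \<Omega>" for c d
  proof -
    have "AE x in lebesgue. x \<in> box c d \<longrightarrow> P x"
      using box[OF that] by (simp add: AE_restrict_space_iff)
    moreover have "AE x in lebesgue. x \<notin> cbox c d - box c d"
      using negligible_frontier_interval[of c d]
      by (intro AE_not_in) (simp add: negligible_iff_null_sets)
    ultimately show ?thesis by eventually_elim blast
  qed
  obtain \<D> where \<D>: "countable \<D>" "\<D> \<subseteq> Pow \<Omega>" "\<And>X. X \<in> \<D> \<Longrightarrow> \<exists>a b. X = cbox a b" "\<Union>\<D> = \<Omega>"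
    using open_countable_Union_open_cbox[OF assms(1)] by metis
  have "\<forall>X\<in>\<D>. AE x in lebesgue. x \<in> X \<longrightarrow> P x"
    using \<D>(2,3) cbox by (metis PowD subsetD)
  then have "AE x in lebesgue. \<forall>X\<in>\<D>. x \<in> X \<longrightarrow> P x"
    by (simp only: AE_ball_countable[OF \<D>(1)])
  then have "AE x in lebesgue. x \<in> \<Omega> \<longrightarrow> P x"
    by eventually_elim (use \<D>(4) in blast)
  then show ?thesis using assms(1) by (simp add: AE_restrict_space_iff)
qed

section \<open>Borel versions of Lebesgue measurable functions\<close>

text \<open>The Dynkin argument and the exchange of integrals work with Borel functions on the whole
  space, whereas f is Lebesgue measurable on \<Omega>. Extending f by 0 and changing it on a null
  set bridges the two.\<close>

lemma integrable_lborel_representative: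
  fixes f :: "'a::euclidean_space \<Rightarrow> real"
  assumes "open \<Omega>" "integrable (lebesgue_on \<Omega>) f"
  obtains h where "integrable lborel h" "AE x in lebesgue. indicator \<Omega> x * f x = h x"
proof -
  have fi: "integrable lebesgue (\<lambda>x. indicator \<Omega> x * f x)"
    using assms by (simp add: integrable_restrict_space)
  then obtain h where h: "h \<in> borel_measurable lborel" "AE x in lborel. indicator \<Omega> x * f x = h x"
    using completion_ex_borel_measurable_real[of "\<lambda>x. indicator \<Omega> x * f x" lborel] by auto
  have hL: "h \<in> borel_measurable lebesgue" using h(1) measurable_completion by blast
  have ae: "AE x in lebesgue. indicator \<Omega> x * f x = h x" using h(2) by (rule AE_completion)
  have "integrable lebesgue h"
    using fi by (rule integrable_cong_AE_imp[OF _ hL]) (use ae in eventually_elim, simp)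
  then have "integrable lborel h" using h(1) by (simp add: integrable_completion)
  then show ?thesis using ae that by blast
qed

text \<open>The condition \<open>k_supp\<close> covers two uses: a small set U that contains the
  support of k, and U = \<Omega> with arbitrary k, where h itself vanishes almost everywhere outside
  \<Omega>.\<close>

lemma integral_lborel_representative:
  fixes f :: "'a::euclidean_space \<Rightarrow> real"
  assumes "open U" "U \<subseteq> \<Omega>" "open \<Omega>" "integrable (lebesgue_on \<Omega>) f" "integrable lborel h"
    "AE x in lebesgue. indicator \<Omega> x * f x = h x" and k: "k \<in> borel_measurable borel"
    and k_supp: "\<And>x. k x \<noteq> 0 \<Longrightarrow> x \<in> U \<or> U = \<Omega>"
  shows "(\<integral>x. f x * k x \<partial>lebesgue_on U) = (\<integral>x. h x * k x \<partial>lborel)"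
proof -
  have kL: "k \<in> borel_measurable lebesgue" by (rule measurable_completion) (simp add: k)
  have hb: "h \<in> borel_measurable borel" using borel_measurable_integrable[OF assms(5)] by simp
  then have hL: "h \<in> borel_measurable lebesgue" by (intro measurable_completion) simp
  have fm: "(\<lambda>x. indicator \<Omega> x * f x) \<in> borel_measurable lebesgue"
    by (rule borel_measurable_integrable) (use assms(3,4) in \<open>simp add: integrable_restrict_space\<close>)
  have eq: "indicator U x * (f x * k x) = indicator U x * (indicator \<Omega> x * f x) * k x" for x
    using assms(2) by (cases "x \<in> U") auto
  have "(\<integral>x. f x * k x \<partial>lebesgue_on U) = (\<integral>x. indicator U x * (f x * k x) \<partial>lebesgue)"
    using assms(1) by (simp add: integral_restrict_space)
  also have "\<dots> = (\<integral>x. h x * k x \<partial>lebesgue)"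
  proof (rule integral_cong_AE)
    show "(\<lambda>x. indicator U x * (f x * k x)) \<in> borel_measurable lebesgue"
      unfolding eq using assms(1) by (intro borel_measurable_times borel_measurable_indicator fm kL) simp
    show "(\<lambda>x. h x * k x) \<in> borel_measurable lebesgue"
      by (intro borel_measurable_times hL kL)
    show "AE x in lebesgue. indicator U x * (f x * k x) = h x * k x"
      using assms(6)
    proof eventually_elim
      case (elim x)
      consider "x \<in> U" | "x \<notin> U" "k x = 0" | "x \<notin> U" "x \<notin> \<Omega>"
        using k_supp[of x] by blast
      then show ?case
      proof cases
        case 1
        then have "x \<in> \<Omega>" using assms(2) by blast
        then show ?thesis using elim 1 by simp
      next
        case 3
        then have "h x = 0" using elim by simp
        then show ?thesis using 3 by simp
      qed simp
    qed
  qed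
  also have "\<dots> = (\<integral>x. h x * k x \<partial>lborel)"
    by (rule integral_completion) (simp add: hb k borel_measurable_times)
  finally show ?thesis .
qed

text \<open>Test functions reach only boxes whose closure lies in \<Omega>, so f is cut off to one
  such box at a time. The integral of the cut-off over an arbitrary box is an integral over the
  intersection of two boxes, which is again a box of the admissible kind.\<close>

lemma fundamental_lemma:
  fixes f :: "'a::euclidean_space \<Rightarrow> real"
  assumes f: "integrable (lebesgue_on \<Omega>) f" and "open \<Omega>"
    and test: "\<And>\<psi>. \<psi> \<in> test_functions \<Omega> \<Longrightarrow> (\<integral>x. f x * \<psi> x \<partial>lebesgue_on \<Omega>) = 0"
  shows "AE x in lebesgue_on \<Omega>. f x = 0"
proof (rule AE_on_open_if_boxes[OF assms(2)])
  fix c d :: 'a assume cd: "cbox c d \<subseteq> \<Omega>"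
  obtain h where h: "integrable lborel h" "AE x in lebesgue. indicator \<Omega> x * f x = h x"
    using integrable_lborel_representative[OF assms(2) f] .
  have zero: "(\<integral>x. h x * indicator (box p q) x \<partial>lborel) = 0" if pq: "box p q \<subseteq> box c d" for p q
  proof (cases "box p q = {}")
    case False
    have "box p q \<subseteq> cbox c d" using pq box_subset_cbox by blast
    then have "closure (box p q) \<subseteq> cbox c d" by (intro closure_minimal closed_cbox)
    then have "cbox p q \<subseteq> \<Omega>" using cd closure_box[OF False] by auto
    from integral_box_eq_0[OF f assms(2) this test]
    have "(\<integral>x. f x * indicator (box p q) x \<partial>lebesgue_on \<Omega>) = 0" .
    moreover have "(\<integral>x. f x * indicator (box p q) x \<partial>lebesgue_on \<Omega>) = (\<integral>x. h x * indicator (box p q) x \<partial>lborel)"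
      by (rule integral_lborel_representative[OF assms(2) _ assms(2) f h]) simp_all
    ultimately show ?thesis by simp
  qed simp
  have "AE x in lborel. h x * indicator (box c d) x = 0"
  proof (rule AE_eq_0_if_box_integrals_0)
    show "integrable lborel (\<lambda>x. h x * indicator (box c d) x)"
      by (intro integrable_real_mult_indicator h(1)) simp
    show "(LINT x:box a b|lborel. h x * indicator (box c d) x) = 0" for a b
    proof -
      obtain p q where pq: "box c d \<inter> box a b = box p q" by (rule that[OF box_Int_box])
      then have "box p q \<subseteq> box c d" by blast
      moreover have "(LINT x:box a b|lborel. h x * indicator (box c d) x) = (\<integral>x. h x * indicator (box p q) x \<partial>lborel)"
        unfolding set_lebesgue_integral_def
        by (intro Bochner_Integration.integral_cong refl) (simp add: pq[symmetric] indicator_inter_arith)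
      ultimately show ?thesis by (simp add: zero)
    qed
    show "(\<integral>x. h x * indicator (box c d) x \<partial>lborel) = 0" by (rule zero) simp
  qed
  then have "AE x in lebesgue. h x * indicator (box c d) x = 0" by (rule AE_completion)
  with h(2) have "AE x in lebesgue. x \<in> box c d \<longrightarrow> f x = 0"
  proof eventually_elim
    case (elim x)
    show ?case
    proof
      assume x: "x \<in> box c d"
      then have "x \<in> \<Omega>" using cd box_subset_cbox by blast
      then show "f x = 0" using elim x by simp
    qed
  qed
  then show "AE x in lebesgue_on (box c d). f x = 0" by (simp add: AE_restrict_space_iff)
qed

section \<open>Differentiation under the integral sign\<close>

text \<open>By the mean value theorem the difference quotients of k are bounded by B, so |f| B is a
  majorant for dominated convergence along every sequence of increments tending to 0.\<close>

lemma has_derivative_integral_param: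
  fixes k k' :: "real \<Rightarrow> 'b \<Rightarrow> real"
  assumes f: "integrable M f" and r: "r \<in> {a<..<b}"
    and int: "\<And>t. t \<in> {a<..<b} \<Longrightarrow> integrable M (\<lambda>x. f x * k t x)"
    and meas: "k' r \<in> borel_measurable M"
    and deriv: "\<And>t x. t \<in> {a<..<b} \<Longrightarrow> x \<in> space M \<Longrightarrow> ((\<lambda>t. k t x) has_real_derivative k' t x) (at t)"
    and bound: "\<And>t x. t \<in> {a<..<b} \<Longrightarrow> x \<in> space M \<Longrightarrow> \<bar>k' t x\<bar> \<le> B"
  shows "((\<lambda>t. \<integral>x. f x * k t x \<partial>M) has_real_derivative (\<integral>x. f x * k' r x \<partial>M)) (at r)"
proof -
  have lip: "\<bar>k t x - k r x\<bar> \<le> B * \<bar>t - r\<bar>" if "t \<in> {a<..<b}" "x \<in> space M" for t x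
    unfolding real_norm_def[symmetric]
    by (rule field_differentiable_bound[of "{a<..<b}" "\<lambda>t. k t x" "\<lambda>t. k' t x"])
      (use that r bound in \<open>auto intro: has_field_derivative_at_within[OF deriv]\<close>)
  have "((\<lambda>h. ((\<integral>x. f x * k (r + h) x \<partial>M) - (\<integral>x. f x * k r x \<partial>M)) / h) \<longlongrightarrow> (\<integral>x. f x * k' r x \<partial>M)) (at 0)"
    unfolding tendsto_at_iff_sequentially
  proof (intro allI impI)
    fix X :: "nat \<Rightarrow> real"
    assume X0: "\<forall>i. X i \<in> UNIV - {0}" and X: "X \<longlonglongrightarrow> 0"
    have "(\<lambda>n. r + X n) \<longlonglongrightarrow> r + 0" by (intro tendsto_intros X)
    then have "\<forall>\<^sub>F n in sequentially. r + X n \<in> {a<..<b}"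
      using r by (intro topological_tendstoD) auto
    then obtain N where N: "\<And>n. r + X (n + N) \<in> {a<..<b}"
      unfolding eventually_sequentially by (metis le_add2)
    \<comment> \<open>Dropping N terms puts every r + h n into the interval, so that measurability
      and the majorant hold for all n; \<open>LIMSEQ_offset\<close> undoes the shift.\<close>
    define h where "h n = X (n + N)" for n
    have h0: "h n \<noteq> 0" for n using X0 by (auto simp: h_def)
    have h: "h \<longlonglongrightarrow> 0" unfolding h_def by (rule LIMSEQ_ignore_initial_segment[OF X])
    have "(\<lambda>n. \<integral>x. f x * ((k (r + h n) x - k r x) / h n) \<partial>M) \<longlonglongrightarrow> (\<integral>x. f x * k' r x \<partial>M)"
    proof (rule integral_dominated_convergence[where w="\<lambda>x. \<bar>f x\<bar> * B"])
      show "(\<lambda>x. f x * ((k (r + h n) x - k r x) / h n)) \<in> borel_measurable M" for n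
      proof -
        have "integrable M (\<lambda>x. (f x * k (r + h n) x - f x * k r x) / h n)"
          using int[OF N[of n]] int[OF r] by (auto simp: h_def)
        then show ?thesis by (auto simp: algebra_simps diff_divide_distrib)
      qed
      show "AE x in M. (\<lambda>n. f x * ((k (r + h n) x - k r x) / h n)) \<longlonglongrightarrow> f x * k' r x"
      proof (intro AE_I2 tendsto_mult tendsto_const)
        fix x assume "x \<in> space M"
        then have "((\<lambda>h. (k (r + h) x - k r x) / h) \<longlongrightarrow> k' r x) (at 0)"
          using deriv[OF r] by (simp add: DERIV_def)
        then show "(\<lambda>n. (k (r + h n) x - k r x) / h n) \<longlonglongrightarrow> k' r x"
          unfolding tendsto_at_iff_sequentially using h h0 by (auto simp: o_def)
      qed
      show "AE x in M. norm (f x * ((k (r + h n) x - k r x) / h n)) \<le> \<bar>f x\<bar> * B" for n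
      proof (intro AE_I2)
        fix x assume "x \<in> space M"
        then show "norm (f x * ((k (r + h n) x - k r x) / h n)) \<le> \<bar>f x\<bar> * B"
          using lip[OF N[of n], of x] h0[of n]
          unfolding h_def real_norm_def abs_mult abs_divide
          by (intro mult_left_mono) (simp_all add: divide_le_eq)
      qed
    qed (use f meas in auto)
    moreover have "(\<integral>x. f x * ((k (r + h n) x - k r x) / h n) \<partial>M)
        = ((\<integral>x. f x * k (r + h n) x \<partial>M) - (\<integral>x. f x * k r x \<partial>M)) / h n" for n
    proof -
      have "(\<integral>x. f x * ((k (r + h n) x - k r x) / h n) \<partial>M)
        = (\<integral>x. (f x * k (r + h n) x - f x * k r x) / h n \<partial>M)"
        by (simp add: algebra_simps diff_divide_distrib)
      then show ?thesis using int[OF N[of n]] int[OF r] by (simp add: h_def del: divide_eq_eq eq_divide_eq)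
    qed
    ultimately have "(\<lambda>n. ((\<lambda>h. ((\<integral>x. f x * k (r + h) x \<partial>M) - (\<integral>x. f x * k r x \<partial>M)) / h) \<circ> X) (n + N))
        \<longlonglongrightarrow> (\<integral>x. f x * k' r x \<partial>M)"
      by (simp add: o_def h_def[symmetric] h0)
    then show "((\<lambda>h. ((\<integral>x. f x * k (r + h) x \<partial>M) - (\<integral>x. f x * k r x \<partial>M)) / h) \<circ> X)
        \<longlonglongrightarrow> (\<integral>x. f x * k' r x \<partial>M)"
      by (rule LIMSEQ_offset)
  qed
  then show ?thesis by (simp add: DERIV_def)
qed

section \<open>Weak gradients of test functions\<close>

lemma lborel_integral_translate:
  fixes w :: "'a::euclidean_space \<Rightarrow> real"
  assumes "w \<in> borel_measurable borel"
  shows "(\<integral>x. w (x + c) \<partial>lborel) = (\<integral>x. w x \<partial>lborel)"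
proof -
  have "(\<integral>x. w x \<partial>lborel) = (\<integral>x. w x \<partial>distr lborel borel ((+) c))"
    by (simp add: lborel_distr_plus)
  also have "\<dots> = (\<integral>x. w (c + x) \<partial>lborel)"
    using assms by (subst integral_distr) auto
  finally show ?thesis by (simp add: add.commute)
qed

lemma lebesgue_on_integral_lborel:
  fixes w :: "'a::euclidean_space \<Rightarrow> real"
  assumes "open \<Omega>" "w \<in> borel_measurable borel" "\<And>x. w x \<noteq> 0 \<Longrightarrow> x \<in> \<Omega>"
  shows "(\<integral>x. w x \<partial>lebesgue_on \<Omega>) = (\<integral>x. w x \<partial>lborel)"
proof -
  have "(\<lambda>x. indicator \<Omega> x *\<^sub>R w x) = w" using assms(3) by (force simp: indicator_def)
  then show ?thesis
    using assms(1,2) by (simp add: integral_restrict_space integral_completion del: real_scaleR_def)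
qed

text \<open>The translates of \<open>w\<close> all have the same integral; differentiate in the translation parameter.\<close>

lemma integral_partial_derivative_eq_0:
  fixes w :: "'a::euclidean_space \<Rightarrow> real"
  assumes "open \<Omega>" and w: "w \<in> test_functions \<Omega>" and i: "i \<in> Basis"
  shows "(\<integral>x. frechet_derivative w (at x) i \<partial>lebesgue_on \<Omega>) = 0"
proof -
  define w' where "w' x = frechet_derivative w (at x) i" for x
  have w': "w' \<in> test_functions \<Omega>"
    unfolding w'_def by (rule test_function_deriv[OF w i])
  obtain B where B: "\<And>x. \<bar>w' x\<bar> \<le> B" using test_function_bounded[OF w'] by blast
  have "bounded {x. w x \<noteq> 0}"
    using test_functionD(2)[OF w] bounded_closure_image compact_imp_bounded bounded_subset closure_subset
    by metis
  then obtain C where C: "\<And>x. w x \<noteq> 0 \<Longrightarrow> norm x \<le> C" by (auto simp: bounded_iff)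
  \<comment> \<open>The cut-off is the integrable factor that
    \<open>has_derivative_integral_param\<close> asks for. The radius C + 1 leaves room for
    translations with |t| < 1, so multiplying by f changes none of the translates.\<close>
  define f where "f = (indicator (cball (0::'a) (C + 1)) :: 'a \<Rightarrow> real)"
  have fi: "integrable lborel f"
    unfolding f_def by (intro integrable_real_indicator emeasure_bounded_finite) auto
  have wb: "w \<in> borel_measurable borel" "w' \<in> borel_measurable borel"
    using test_functionD(4)[OF w] test_functionD(4)[OF w'] borel_measurable_continuous_onI by blast+
  have fw: "f x * w (x + t *\<^sub>R i) = w (x + t *\<^sub>R i)" if "t \<in> {-1<..<1}" for t x
  proof (cases "w (x + t *\<^sub>R i) = 0")
    case False
    have "norm x \<le> norm (x + t *\<^sub>R i) + norm (t *\<^sub>R i)" by (metis add_diff_cancel norm_triangle_ineq4)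
    moreover have "norm (t *\<^sub>R i) \<le> 1" using that i by auto
    ultimately have "norm x \<le> C + 1" using C[OF False] by linarith
    then show ?thesis by (simp add: f_def)
  qed auto
  have cint: "integrable lborel w"
  proof -
    have "compact (closure {x. w x \<noteq> 0})" using test_functionD(2)[OF w] .
    then have "integrable lborel (\<lambda>x. indicator (closure {x. w x \<noteq> 0}) x *\<^sub>R w x)"
      using test_functionD(4)[OF w] by (rule borel_integrable_compact)
    moreover have "(\<lambda>x. indicator (closure {x. w x \<noteq> 0}) x *\<^sub>R w x) = w"
      using closure_subset[of "{x. w x \<noteq> 0}"] by (force simp: indicator_def)
    ultimately show ?thesis by (simp only:)
  qed
  have "((\<lambda>t. \<integral>x. f x * w (x + t *\<^sub>R i) \<partial>lborel) has_real_derivative (\<integral>x. f x * w' (x + 0 *\<^sub>R i) \<partial>lborel)) (at 0)"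
  proof (rule has_derivative_integral_param[OF fi, where a="-1" and b=1 and B=B])
    fix t :: real assume t: "t \<in> {-1<..<1}"
    have "integrable (distr lborel borel ((+) (t *\<^sub>R i))) w"
      using cint by (simp add: lborel_distr_plus)
    then show "integrable lborel (\<lambda>x. f x * w (x + t *\<^sub>R i))"
      unfolding fw[OF t] using wb by (subst (asm) integrable_distr_eq) (auto simp: add.commute)
    fix x
    have "(w has_derivative frechet_derivative w (at (x + t *\<^sub>R i))) (at (x + t *\<^sub>R i))"
      using test_functionD(5)[OF w] frechet_derivative_works by blast
    then have "((\<lambda>t. w (x + t *\<^sub>R i)) has_derivative
        (\<lambda>h. frechet_derivative w (at (x + t *\<^sub>R i)) (h *\<^sub>R i))) (at t)"
      by (rule has_derivative_compose[rotated]) (auto intro!: derivative_eq_intros)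
    moreover have "linear (frechet_derivative w (at (x + t *\<^sub>R i)))"
      by (intro linear_frechet_derivative test_functionD(5)[OF w])
    ultimately show "((\<lambda>t. w (x + t *\<^sub>R i)) has_real_derivative w' (x + t *\<^sub>R i)) (at t)"
      by (simp add: has_field_derivative_def linear_cmul w'_def mult.commute[of _ "frechet_derivative _ _ _"])
    show "\<bar>w' (x + t *\<^sub>R i)\<bar> \<le> B" by (rule B)
  qed (use wb in auto)
  moreover have "((\<lambda>t. \<integral>x. f x * w (x + t *\<^sub>R i) \<partial>lborel) has_real_derivative 0) (at 0)"
  proof (rule has_field_derivative_transform_within_open[where S="{-1<..<1}" and f="\<lambda>_. \<integral>x. w x \<partial>lborel"])
    fix t :: real assume "t \<in> {-1<..<1}"
    then show "(\<integral>x. w x \<partial>lborel) = (\<integral>x. f x * w (x + t *\<^sub>R i) \<partial>lborel)"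
      by (simp add: fw lborel_integral_translate[OF wb(1)])
  qed auto
  ultimately have "(\<integral>x. f x * w' x \<partial>lborel) = 0"
    using DERIV_unique by fastforce
  moreover have "f x * w' x = w' x" for x
  proof (cases "w' x = 0")
    case False
    have "closure {x. w x \<noteq> 0} \<subseteq> cball 0 C"
      using C by (intro closure_minimal) auto
    moreover have "x \<in> closure {x. w x \<noteq> 0}"
      using False frechet_derivative_eq_0_outside_support[of x w] unfolding w'_def by metis
    ultimately show ?thesis by (auto simp: f_def)
  qed auto
  ultimately have "(\<integral>x. w' x \<partial>lborel) = 0" by simp
  then show ?thesis
    using lebesgue_on_integral_lborel[OF assms(1) wb(2) test_functionD(6)[OF w']] by (simp add: w'_def)
qed

lemma integration_by_parts_test:
  fixes \<psi> \<eta> :: "'a::euclidean_space \<Rightarrow> real"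
  assumes "open \<Omega>" "bounded \<Omega>" and \<psi>: "\<psi> \<in> test_functions \<Omega>" and \<eta>: "\<eta> \<in> test_functions \<Omega>" and i: "i \<in> Basis"
  shows "(\<integral>x. \<psi> x * frechet_derivative \<eta> (at x) i \<partial>lebesgue_on \<Omega>)
    = - (\<integral>x. frechet_derivative \<psi> (at x) i * \<eta> x \<partial>lebesgue_on \<Omega>)"
proof -
  have D: "((\<lambda>x. \<psi> x * \<eta> x) has_derivative
      (\<lambda>h. \<psi> x * frechet_derivative \<eta> (at x) h + frechet_derivative \<psi> (at x) h * \<eta> x)) (at x)" for x
    using test_functionD(5)[OF \<psi>] test_functionD(5)[OF \<eta>]
    by (intro has_derivative_mult) (auto simp: frechet_derivative_works[symmetric])
  have "(\<integral>x. frechet_derivative (\<lambda>x. \<psi> x * \<eta> x) (at x) i \<partial>lebesgue_on \<Omega>) = 0"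
    using test_function_mult[OF \<psi> test_functionD(1)[OF \<eta>]]
    by (intro integral_partial_derivative_eq_0[OF assms(1) _ i])
  then have "(\<integral>x. \<psi> x * frechet_derivative \<eta> (at x) i + frechet_derivative \<psi> (at x) i * \<eta> x \<partial>lebesgue_on \<Omega>) = 0"
    by (simp add: frechet_derivative_eqI[OF D])
  then show ?thesis
    using test_function_L2[OF assms(1,2)] \<psi> \<eta> test_function_deriv[OF \<psi> i] test_function_deriv[OF \<eta> i]
    by (subst (asm) Bochner_Integration.integral_add) (auto intro!: L2_mult_integrable)
qed

definition grad :: "('a::euclidean_space \<Rightarrow> real) \<Rightarrow> 'a \<Rightarrow> 'a" where
  "grad \<psi> x = (\<Sum>i\<in>Basis. frechet_derivative \<psi> (at x) i *\<^sub>R i)"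

lemma grad_component: "i \<in> Basis \<Longrightarrow> grad \<psi> x \<bullet> i = frechet_derivative \<psi> (at x) i"
  by (simp add: grad_def inner_sum_left inner_Basis if_distrib sum.delta cong: if_cong)

lemma test_function_has_weak_gradient:
  assumes "open \<Omega>" "bounded \<Omega>" and \<psi>: "\<psi> \<in> test_functions \<Omega>"
  shows "has_weak_gradient \<Omega> \<psi> (grad \<psi>)"
  unfolding has_weak_gradient_def
proof (intro conjI ballI)
  have "(\<lambda>x. \<Sum>i\<in>Basis. frechet_derivative \<psi> (at x) i *\<^sub>R i) \<in> L2 \<Omega>"
    by (intro L2_from_components test_function_L2[OF assms(1,2) test_function_deriv[OF \<psi>]])
  then show "grad \<psi> \<in> L2 \<Omega>" by (simp add: grad_def[abs_def])
qed (use assms in \<open>auto simp: l2_inner_def grad_component integration_by_parts_test intro: test_function_L2\<close>)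

text \<open>Since \<open>weak_grad\<close> is an arbitrary choice, this is what lets a computed
  gradient replace it under integrals. Each component of the difference of two weak gradients is
  orthogonal to all test functions.\<close>

lemma weak_gradient_unique:
  assumes "open \<Omega>" "bounded \<Omega>" and G: "has_weak_gradient \<Omega> w G" and G': "has_weak_gradient \<Omega> w G'"
  shows "AE x in lebesgue_on \<Omega>. G x = G' x"
proof -
  have L2: "G \<in> L2 \<Omega>" "G' \<in> L2 \<Omega>" using G G' by (auto simp: has_weak_gradient_def)
  have "AE x in lebesgue_on \<Omega>. G x \<bullet> i - G' x \<bullet> i = 0" if i: "i \<in> Basis" for i
  proof (rule fundamental_lemma[OF _ assms(1)])
    have c: "(\<lambda>x. G x \<bullet> i) \<in> L2 \<Omega>" "(\<lambda>x. G' x \<bullet> i) \<in> L2 \<Omega>"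
      using L2 i by (auto intro!: L2_component)
    then show "integrable (lebesgue_on \<Omega>) (\<lambda>x. G x \<bullet> i - G' x \<bullet> i)"
      by (intro L2_integrable[OF assms(1,2)] L2_diff)
    fix \<psi> assume \<psi>: "\<psi> \<in> test_functions \<Omega>"
    have "(\<integral>x. (G x \<bullet> i) * \<psi> x \<partial>lebesgue_on \<Omega>) = (\<integral>x. (G' x \<bullet> i) * \<psi> x \<partial>lebesgue_on \<Omega>)"
      using G G' \<psi> i by (auto simp: has_weak_gradient_def l2_inner_def)
    then show "(\<integral>x. (G x \<bullet> i - G' x \<bullet> i) * \<psi> x \<partial>lebesgue_on \<Omega>) = 0"
      using L2_mult_integrable[OF c(1) test_function_L2[OF assms(1,2) \<psi>]]
        L2_mult_integrable[OF c(2) test_function_L2[OF assms(1,2) \<psi>]]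
      by (simp add: left_diff_distrib)
  qed
  then have "AE x in lebesgue_on \<Omega>. \<forall>i\<in>Basis. G x \<bullet> i - G' x \<bullet> i = 0"
    by (intro AE_finite_allI) auto
  then show ?thesis
    by eventually_elim (auto intro!: euclidean_eqI[where 'a='a])
qed

lemma weak_grad_works: "w \<in> H1 \<Omega> \<Longrightarrow> has_weak_gradient \<Omega> w (weak_grad \<Omega> w)"
  unfolding H1_def weak_grad_def using someI_ex[of "has_weak_gradient \<Omega> w"] by simp

lemma weak_grad_test_function:
  assumes "open \<Omega>" "bounded \<Omega>" and \<psi>: "\<psi> \<in> test_functions \<Omega>"
  shows "AE x in lebesgue_on \<Omega>. weak_grad \<Omega> \<psi> x = grad \<psi> x"
  using test_function_has_weak_gradient[OF assms]
  by (intro weak_gradient_unique[OF assms(1,2) weak_grad_works]) (auto simp: H1_def)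

text \<open>The constant sequence is the approximating one. That the \<open>h1_norm\<close> of the
  zero function is 0 still needs an argument, because its \<open>weak_grad\<close> is a choice that
  is known only up to a null set.\<close>

lemma test_function_H1_0:
  assumes "open \<Omega>" "bounded \<Omega>" and \<psi>: "\<psi> \<in> test_functions \<Omega>"
  shows "\<psi> \<in> H1_0 \<Omega>"
proof -
  have "AE x in lebesgue_on \<Omega>. weak_grad \<Omega> (\<lambda>x. 0) x = 0"
    using weak_grad_test_function[OF assms(1,2) test_function_zero] by (simp add: grad_def)
  then have "(\<integral>x. weak_grad \<Omega> (\<lambda>x. 0) x \<bullet> weak_grad \<Omega> (\<lambda>x. 0) x \<partial>lebesgue_on \<Omega>) = 0"
    by (intro integral_eq_zero_AE) auto
  then have "h1_norm \<Omega> (\<lambda>x. \<psi> x - \<psi> x) = 0"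
    by (simp add: h1_norm_def l2_norm_def l2_inner_def)
  then have "(\<lambda>n::nat. h1_norm \<Omega> (\<lambda>x. \<psi> x - \<psi> x)) \<longlonglongrightarrow> 0"
    by simp
  then show ?thesis
    using test_function_has_weak_gradient[OF assms] \<psi> 
    by (auto simp: H1_0_def H1_def intro!: exI[of _ "\<lambda>_. \<psi>"])
qed

section \<open>From the weak to the distributional equation\<close>

definition laplacian :: "('a::euclidean_space \<Rightarrow> real) \<Rightarrow> 'a \<Rightarrow> real" where
  "laplacian \<psi> x = (\<Sum>i\<in>Basis. frechet_derivative (\<lambda>y. frechet_derivative \<psi> (at y) i) (at x) i)"

text \<open>The partial derivatives of \<psi> are test functions, so the definition of the weak
  gradient moves one derivative back to \<phi>. The result pairs the two gradients, and the weak
  equation with v = \<psi> evaluates it once the classical gradient of \<psi> is replaced by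
  \<open>weak_grad\<close>.\<close>

lemma weak_to_distributional:
  fixes \<phi> :: "'a::euclidean_space \<Rightarrow> real"
  assumes "open \<Omega>" "bounded \<Omega>" and \<phi>: "\<phi> \<in> H1_0 \<Omega>" and \<psi>: "\<psi> \<in> test_functions \<Omega>"
    and eq: "\<And>v. v \<in> H1_0 \<Omega> \<Longrightarrow> l2_inner \<Omega> (weak_grad \<Omega> \<phi>) (weak_grad \<Omega> v) = l * l2_inner \<Omega> \<phi> v"
  shows "(\<integral>x. \<phi> x * laplacian \<psi> x \<partial>lebesgue_on \<Omega>) = - l * (\<integral>x. \<phi> x * \<psi> x \<partial>lebesgue_on \<Omega>)"
proof -
  let ?M = "lebesgue_on \<Omega>"
  define G where "G = weak_grad \<Omega> \<phi>"
  have hG: "has_weak_gradient \<Omega> \<phi> G"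
    using \<phi> weak_grad_works by (auto simp: H1_0_def G_def)
  then have L2: "\<phi> \<in> L2 \<Omega>" "G \<in> L2 \<Omega>" by (auto simp: has_weak_gradient_def)
  have hgr: "has_weak_gradient \<Omega> \<psi> (grad \<psi>)" "has_weak_gradient \<Omega> \<psi> (weak_grad \<Omega> \<psi>)"
    using test_function_has_weak_gradient[OF assms(1,2) \<psi>]
    by (auto intro!: weak_grad_works simp: H1_def)
  then have gr: "grad \<psi> \<in> L2 \<Omega>" "weak_grad \<Omega> \<psi> \<in> L2 \<Omega>" by (auto simp: has_weak_gradient_def)
  have \<psi>2: "(\<lambda>x. frechet_derivative (\<lambda>y. frechet_derivative \<psi> (at y) i) (at x) i) \<in> L2 \<Omega>" if "i \<in> Basis" for i
    using that by (intro test_function_L2[OF assms(1,2) test_function_deriv[OF test_function_deriv[OF \<psi>]]])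
  have "(\<integral>x. \<phi> x * laplacian \<psi> x \<partial>?M)
      = (\<Sum>i\<in>Basis. \<integral>x. \<phi> x * frechet_derivative (\<lambda>y. frechet_derivative \<psi> (at y) i) (at x) i \<partial>?M)"
    unfolding laplacian_def sum_distrib_left
    using L2 \<psi>2 by (intro Bochner_Integration.integral_sum L2_mult_integrable)
  also have "\<dots> = (\<Sum>i\<in>Basis. - (\<integral>x. (G x \<bullet> i) * frechet_derivative \<psi> (at x) i \<partial>?M))"
    using hG test_function_deriv[OF \<psi>]
    by (intro sum.cong) (auto simp: has_weak_gradient_def l2_inner_def)
  also have "\<dots> = - (\<Sum>i\<in>Basis. (\<integral>x. (G x \<bullet> i) * (grad \<psi> x \<bullet> i) \<partial>?M))"
    by (simp add: sum_negf grad_component)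
  also have "(\<Sum>i\<in>Basis. (\<integral>x. (G x \<bullet> i) * (grad \<psi> x \<bullet> i) \<partial>?M)) = (\<integral>x. G x \<bullet> grad \<psi> x \<partial>?M)"
  proof -
    have "(\<integral>x. G x \<bullet> grad \<psi> x \<partial>?M) = (\<integral>x. (\<Sum>i\<in>Basis. (G x \<bullet> i) * (grad \<psi> x \<bullet> i)) \<partial>?M)"
      by (intro Bochner_Integration.integral_cong refl euclidean_inner)
    also have "\<dots> = (\<Sum>i\<in>Basis. (\<integral>x. (G x \<bullet> i) * (grad \<psi> x \<bullet> i) \<partial>?M))"
      using L2 gr by (intro Bochner_Integration.integral_sum L2_inner_integrable)
    finally show ?thesis by simp
  qed
  also have "\<dots> = (\<integral>x. G x \<bullet> weak_grad \<Omega> \<psi> x \<partial>?M)"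
  proof (rule integral_cong_AE)
    show "AE x in ?M. G x \<bullet> grad \<psi> x = G x \<bullet> weak_grad \<Omega> \<psi> x"
      using weak_grad_test_function[OF assms(1,2) \<psi>] by eventually_elim simp
  qed (use L2 gr in \<open>auto simp: L2_def\<close>)
  also have "\<dots> = l * l2_inner \<Omega> \<phi> \<psi>"
    using eq[OF test_function_H1_0[OF assms(1,2) \<psi>]] by (simp add: l2_inner_def G_def)
  finally show ?thesis by (simp add: l2_inner_def)
qed

section \<open>The Hilbert space structure of \<open>L\<^sup>2\<close>\<close>

lemma l2_inner_real: "l2_inner \<Omega> f g = (\<integral>x. f x * g x \<partial>lebesgue_on \<Omega>)" for f g :: "_ \<Rightarrow> real"
  by (simp add: l2_inner_def)

lemma l2_norm_nonneg: "0 \<le> l2_norm \<Omega> f"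
  by (auto simp: l2_norm_def l2_inner_def intro!: Bochner_Integration.integral_nonneg)

lemma l2_norm_power2: "(l2_norm \<Omega> f)\<^sup>2 = (\<integral>x. (f x)\<^sup>2 \<partial>lebesgue_on \<Omega>)" for f :: "_ \<Rightarrow> real"
  by (auto simp: l2_norm_def l2_inner_real power2_eq_square intro!: Bochner_Integration.integral_nonneg)

text \<open>The quadratic function t -> A - 2tB + t^2 C is the squared norm of f - t g. It is
  evaluated at its minimizer B/C; if C = 0 and B were nonzero, t = (A + 1)/(2B) would give the value
  -1.\<close>

lemma l2_cauchy_schwarz:
  fixes f g :: "'a::euclidean_space \<Rightarrow> real"
  assumes f: "f \<in> L2 \<Omega>" and g: "g \<in> L2 \<Omega>"
  shows "\<bar>\<integral>x. f x * g x \<partial>lebesgue_on \<Omega>\<bar> \<le> l2_norm \<Omega> f * l2_norm \<Omega> g"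
proof -
  define A where "A = (\<integral>x. (f x)\<^sup>2 \<partial>lebesgue_on \<Omega>)"
  define B where "B = (\<integral>x. f x * g x \<partial>lebesgue_on \<Omega>)"
  define C where "C = (\<integral>x. (g x)\<^sup>2 \<partial>lebesgue_on \<Omega>)"
  have q: "0 \<le> A - 2 * t * B + t\<^sup>2 * C" for t
  proof -
    have "0 \<le> (\<integral>x. (f x - t * g x)\<^sup>2 \<partial>lebesgue_on \<Omega>)" by simp
    also have "\<dots> = (\<integral>x. (f x)\<^sup>2 - 2 * t * (f x * g x) + t\<^sup>2 * (g x)\<^sup>2 \<partial>lebesgue_on \<Omega>)"
      by (intro Bochner_Integration.integral_cong refl) (simp add: power2_eq_square algebra_simps)
    also have "\<dots> = A - 2 * t * B + t\<^sup>2 * C"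
      unfolding A_def B_def C_def
      using L2_realD(2)[OF f] L2_realD(2)[OF g] L2_mult_integrable[OF f g] by simp
    finally show ?thesis .
  qed
  have C: "C \<ge> 0" by (simp add: C_def)
  have "B\<^sup>2 \<le> A * C"
  proof (cases "C = 0")
    case True
    have "B = 0"
    proof (rule ccontr)
      assume "B \<noteq> 0"
      then show False using q[of "(A + 1) / (2 * B)"] True by (simp add: field_simps)
    qed
    then show ?thesis using True by simp
  next
    case False
    then show ?thesis using q[of "B / C"] C by (simp add: field_simps power2_eq_square)
  qed
  then have "B\<^sup>2 \<le> (l2_norm \<Omega> f * l2_norm \<Omega> g)\<^sup>2"
    by (simp add: power_mult_distrib l2_norm_power2 A_def C_def)
  then have "\<bar>B\<bar> \<le> \<bar>l2_norm \<Omega> f * l2_norm \<Omega> g\<bar>"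
    by (simp only: abs_le_square_iff)
  then show ?thesis by (simp add: B_def l2_norm_nonneg)
qed

section \<open>A radial family of kernels\<close>

text \<open>The index n counts derivatives of the profile, not of the function of y. The profile
  takes |y - z|^2 instead of |y - z|, which keeps the function smooth at the centre.\<close>

definition radial_bump :: "nat \<Rightarrow> real \<Rightarrow> 'a::euclidean_space \<Rightarrow> 'a \<Rightarrow> real" where
  "radial_bump n R z y = bump n (1 - (norm (y - z))\<^sup>2 / R\<^sup>2)"

lemma radial_bump_zero: "R > 0 \<Longrightarrow> R \<le> norm (y - z) \<Longrightarrow> radial_bump n R z y = 0"
  unfolding radial_bump_def by (intro bump_zero) (simp add: field_simps)

lemma C_k_one_minus_norm2: "C_k k (\<lambda>y::'a::euclidean_space. 1 - (norm (y - z))\<^sup>2 / R\<^sup>2)"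
proof -
  have "(\<lambda>y. 1 - (norm (y - z))\<^sup>2 / R\<^sup>2)
      = (\<lambda>y. 1 - (1 / R\<^sup>2) * (\<Sum>i\<in>Basis. (y \<bullet> i - z \<bullet> i) * (y \<bullet> i - z \<bullet> i)))"
    by (intro ext, subst power2_norm_eq_inner, subst euclidean_inner) (simp add: inner_diff_left)
  then show ?thesis
    by (simp only:) (intro C_k_diff C_k_const C_k_mult C_k_sum C_k_inner)
qed

lemma radial_bump_test_function:
  assumes "R > 0" "cball z R \<subseteq> \<Omega>"
  shows "radial_bump n R z \<in> test_functions \<Omega>"
proof (rule test_functionI[OF _ compact_cball assms(2)])
  show "C_k k (radial_bump n R z)" for k
    unfolding radial_bump_def by (intro C_k_compose[of bump] bump_deriv C_k_one_minus_norm2)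
  show "x \<in> cball z R" if "radial_bump n R z x \<noteq> 0" for x
    using that radial_bump_zero[OF assms(1), of x z n] by (force simp: dist_norm norm_minus_commute)
qed

lemma radial_bump_frechet:
  "frechet_derivative (radial_bump n R z) (at y) = (\<lambda>h. radial_bump (Suc n) R z y * (- 2 * ((y - z) \<bullet> h) / R\<^sup>2))"
proof (rule frechet_derivative_eqI)
  have q: "((\<lambda>y. 1 - (norm (y - z))\<^sup>2 / R\<^sup>2) has_derivative (\<lambda>h. - 2 * ((y - z) \<bullet> h) / R\<^sup>2)) (at y)"
    unfolding power2_norm_eq_inner
    by (auto intro!: derivative_eq_intros simp: inner_commute divide_inverse)
  from has_derivative_compose[OF q bump_deriv[unfolded has_field_derivative_def]]
  show "(radial_bump n R z has_derivative (\<lambda>h. radial_bump (Suc n) R z y * (- 2 * ((y - z) \<bullet> h) / R\<^sup>2))) (at y)"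
    by (simp add: radial_bump_def[abs_def])
qed

text \<open>By the chain rule the second derivative of the profile is multiplied by the squared
  gradient of |y - z|^2/R^2, and the first derivative by minus its Laplacian 2d/R^2.\<close>

lemma laplacian_radial_bump:
  fixes y z :: "'a::euclidean_space"
  shows "laplacian (radial_bump 0 R z) y =
    radial_bump 2 R z y * (4 * (norm (y - z))\<^sup>2 / R ^ 4) - 2 * DIM('a) / R\<^sup>2 * radial_bump 1 R z y"
proof -
  have "frechet_derivative (\<lambda>y. frechet_derivative (radial_bump 0 R z) (at y) i) (at y) i
      = radial_bump 2 R z y * (4 * ((y - z) \<bullet> i)\<^sup>2 / R ^ 4) - 2 / R\<^sup>2 * radial_bump 1 R z y"
    if i: "i \<in> Basis" for i
  proof -
    have "(radial_bump 1 R z has_derivative frechet_derivative (radial_bump 1 R z) (at y)) (at y)"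
      using C_k_compose[of bump "\<lambda>y. 1 - (norm (y - z))\<^sup>2 / R\<^sup>2" 1 1, OF bump_deriv C_k_one_minus_norm2]
      by (auto simp: frechet_derivative_works[symmetric] radial_bump_def[abs_def])
    then have rb: "(radial_bump 1 R z has_derivative (\<lambda>h. radial_bump 2 R z y * (- 2 * ((y - z) \<bullet> h) / R\<^sup>2))) (at y)"
      by (simp add: radial_bump_frechet numeral_2_eq_2)
    have lin: "((\<lambda>y. - 2 * ((y - z) \<bullet> i) / R\<^sup>2) has_derivative (\<lambda>h. - 2 * (h \<bullet> i) / R\<^sup>2)) (at y)"
      by (auto intro!: derivative_eq_intros simp: divide_inverse)
    have "((\<lambda>y. radial_bump 1 R z y * (- 2 * ((y - z) \<bullet> i) / R\<^sup>2)) has_derivative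
      (\<lambda>h. radial_bump 1 R z y * (- 2 * (h \<bullet> i) / R\<^sup>2)
        + radial_bump 2 R z y * (- 2 * ((y - z) \<bullet> h) / R\<^sup>2) * (- 2 * ((y - z) \<bullet> i) / R\<^sup>2))) (at y)"
      by (rule has_derivative_mult[OF rb lin])
    from frechet_derivative_eqI[OF this] show ?thesis
      using i by (simp add: radial_bump_frechet power2_eq_square power4_eq_xxxx algebra_simps
          diff_divide_distrib add_divide_distrib)
  qed
  then have "laplacian (radial_bump 0 R z) y = (\<Sum>i\<in>Basis.
      radial_bump 2 R z y * (4 * ((y - z) \<bullet> i)\<^sup>2 / R ^ 4) - 2 / R\<^sup>2 * radial_bump 1 R z y)"
    by (simp add: laplacian_def)
  also have "\<dots> = radial_bump 2 R z y * (4 * (\<Sum>i\<in>Basis. ((y - z) \<bullet> i)\<^sup>2) / R ^ 4)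
      - DIM('a) * (2 / R\<^sup>2 * radial_bump 1 R z y)"
    by (simp add: sum_subtractf sum_distrib_left sum_divide_distrib)
  also have "(\<Sum>i\<in>Basis. ((y - z) \<bullet> i)\<^sup>2) = (norm (y - z))\<^sup>2"
    by (subst power2_norm_eq_inner, subst euclidean_inner) (simp add: power2_eq_square)
  finally show ?thesis by (simp add: algebra_simps)
qed

text \<open>The power R^(-d) makes the total mass independent of R. The mass is
  \<open>moll_mass\<close>, not 1; the factor 2 makes the R-derivative exactly R^(1-d) times a
  Laplacian.\<close>

definition mollifier :: "real \<Rightarrow> 'a::euclidean_space \<Rightarrow> 'a \<Rightarrow> real" where
  "mollifier R z y = 2 * R powr (- real DIM('a)) * radial_bump 1 R z y"

text \<open>The identity behind the interior estimate: the mollifiers form a one-parameter family whose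
  derivative in the radius is a Laplacian.\<close>

lemma mollifier_deriv:
  fixes y z :: "'a::euclidean_space"
  assumes "R > 0"
  shows "((\<lambda>R. mollifier R z y) has_real_derivative
    R powr (1 - real DIM('a)) * laplacian (radial_bump 0 R z) y) (at R)"
proof -
  define d where "d = real DIM('a)"
  define c where "c = (norm (y - z))\<^sup>2"
  have p: "R powr (- d - 1) = R powr (1 - d) / R\<^sup>2" "R powr (- d) = R powr (1 - d) / R"
    using assms by (simp_all add: powr_diff powr_minus power2_eq_square field_simps)
  have "((\<lambda>R. 1 - c / R\<^sup>2) has_real_derivative 2 * c / R ^ 3) (at R)"
    using assms by (auto intro!: derivative_eq_intros simp: field_simps power_numeral_reduce)
  from DERIV_chain2[OF bump_deriv this]
  have "((\<lambda>R. bump 1 (1 - c / R\<^sup>2)) has_real_derivative bump 2 (1 - c / R\<^sup>2) * (2 * c / R ^ 3)) (at R)"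
    by (simp add: numeral_2_eq_2)
  note X = DERIV_mult[OF DERIV_cmult[OF has_real_derivative_powr[OF assms], of 2 "- d"] this, unfolded d_def]
  show ?thesis
    unfolding mollifier_def laplacian_radial_bump radial_bump_def c_def[symmetric]
    using assms X by (simp add: p[unfolded d_def] algebra_simps power_numeral_reduce add_divide_distrib diff_divide_distrib)
qed

text \<open>For x > 0 and y = 1/x the function is y^2 e^(-y), and the bound 2 comes from e^y \<ge>
  y^2/2.\<close>

lemma bump_1_le: "0 \<le> bump 1 x" "bump 1 x \<le> 2"
proof -
  show "0 \<le> bump 1 x" unfolding bump_1 by simp
  show "bump 1 x \<le> 2"
  proof (cases "x > 0")
    case True
    have "1 + 1 / x + (1 / x)\<^sup>2 / 2 \<le> exp (1 / x)"
      using True by (intro exp_lower_Taylor_quadratic) auto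
    moreover have "0 \<le> 1 / x" using True by simp
    ultimately have "(1 / x)\<^sup>2 \<le> 2 * exp (1 / x)" by linarith
    then have "(1 / x)\<^sup>2 * exp (- (1 / x)) \<le> 2 * exp (1 / x) * exp (- (1 / x))"
      by (intro mult_right_mono) auto
    also have "\<dots> = 2" by (simp add: exp_minus)
    finally show ?thesis using True unfolding bump_1 by (simp add: power_divide)
  qed (simp add: bump_zero)
qed

lemma continuous_on_radial_bump: "continuous_on S (radial_bump n R z)"
  unfolding radial_bump_def divide_inverse by (intro continuous_intros)

lemma radial_bump_le: "R > 0 \<Longrightarrow> 0 \<le> radial_bump 0 R z y"
  "R > 0 \<Longrightarrow> radial_bump 0 R z y \<le> indicator (cball z R) y"
  "R > 0 \<Longrightarrow> 0 \<le> radial_bump 1 R z y" "R > 0 \<Longrightarrow> radial_bump 1 R z y \<le> 2 * indicator (cball z R) y"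
  using radial_bump_zero[of R y z] bump_0_bounds bump_1_le
  by (auto simp: radial_bump_def indicator_def dist_norm norm_minus_commute not_le
      split: if_splits)

lemma mollifier_le:
  fixes z y :: "'a::euclidean_space"
  assumes "R > 0"
  shows "0 \<le> mollifier R z y" "mollifier R z y \<le> 4 * R powr (- real DIM('a)) * indicator (cball z R) y"
    "\<bar>mollifier R z y\<bar> \<le> 4 * R powr (- real DIM('a))"
proof -
  show "0 \<le> mollifier R z y"
    unfolding mollifier_def by (intro mult_nonneg_nonneg radial_bump_le assms) auto
  show le: "mollifier R z y \<le> 4 * R powr (- real DIM('a)) * indicator (cball z R) y"
  proof -
    have "mollifier R z y \<le> 2 * R powr (- real DIM('a)) * (2 * indicator (cball z R) y)"
      unfolding mollifier_def by (intro mult_left_mono radial_bump_le assms) auto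
    then show ?thesis by simp
  qed
  have "indicator (cball z R) y \<le> (1::real)" by (simp add: indicator_def)
  then have "4 * R powr (- real DIM('a)) * indicator (cball z R) y \<le> 4 * R powr (- real DIM('a)) * 1"
    by (intro mult_left_mono) auto
  then show "\<bar>mollifier R z y\<bar> \<le> 4 * R powr (- real DIM('a))"
    using le \<open>0 \<le> mollifier R z y\<close> by linarith
qed

lemma continuous_on_mollifier: "continuous_on S (mollifier R z)"
  unfolding mollifier_def by (intro continuous_intros continuous_on_radial_bump)

text \<open>The factor R^(d/2) is the root of the volume of the ball. It turns pointwise bounds on
  the kernels into the powers of R in the interior estimate.\<close>

lemma l2_norm_le_ball:
  fixes f :: "'a::euclidean_space \<Rightarrow> real"
  assumes "open \<Omega>" "bounded \<Omega>" "f \<in> L2 \<Omega>" "\<And>y. 0 \<le> f y" "\<And>y. f y \<le> B * indicator (cball z R) y"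
    "B \<ge> 0" "R > 0"
  shows "l2_norm \<Omega> f \<le> B * sqrt (unit_ball_vol DIM('a)) * R powr (real DIM('a) / 2)"
proof -
  have int: "integrable lebesgue (\<lambda>y. B\<^sup>2 * indicator (cball z R) y)"
    using lmeasurable_cball[of z R] by (intro integrable_mult_right) (simp add: fmeasurable_def)
  have le: "(f y)\<^sup>2 \<le> B\<^sup>2 * indicator (cball z R) y" for y
    using power_mono[OF assms(5,4), of y 2] by (cases "y \<in> cball z R") (simp_all add: power_mult_distrib)
  have "(l2_norm \<Omega> f)\<^sup>2 = (\<integral>y. indicator \<Omega> y * (f y)\<^sup>2 \<partial>lebesgue)"
    using assms(1) by (simp add: l2_norm_power2 integral_restrict_space)
  also have "\<dots> \<le> (\<integral>y. B\<^sup>2 * indicator (cball z R) y \<partial>lebesgue)"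
  proof (rule integral_mono[OF _ int])
    show "integrable lebesgue (\<lambda>y. indicator \<Omega> y * (f y)\<^sup>2)"
      using L2_realD(2)[OF assms(3)] assms(1) by (simp add: integrable_restrict_space)
    show "indicator \<Omega> y * (f y)\<^sup>2 \<le> B\<^sup>2 * indicator (cball z R) y" for y
      using le[of y] by (auto simp: indicator_def split: if_splits)
  qed
  also have "\<dots> = B\<^sup>2 * measure lborel (cball z R)" by simp
  also have "measure lborel (cball z R) = unit_ball_vol DIM('a) * R ^ DIM('a)"
    using assms(7) by (simp add: content_cball)
  also have "R ^ DIM('a) = (R powr (real DIM('a) / 2))\<^sup>2"
    using assms(7) by (simp add: powr_power powr_realpow)
  also have "B\<^sup>2 * (unit_ball_vol DIM('a) * (R powr (real DIM('a) / 2))\<^sup>2)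
      = (B * sqrt (unit_ball_vol DIM('a)) * R powr (real DIM('a) / 2))\<^sup>2"
    by (simp add: power_mult_distrib)
  finally show ?thesis
    by (rule power2_le_imp_le) (use assms in auto)
qed

section \<open>Interior regularity\<close>

definition moll_avg :: "'a::euclidean_space set \<Rightarrow> ('a \<Rightarrow> real) \<Rightarrow> real \<Rightarrow> 'a \<Rightarrow> real" where
  "moll_avg \<Omega> f R z = (\<integral>y. f y * mollifier R z y \<partial>lebesgue_on \<Omega>)"

text \<open>The radii 1/(n+1) are positive from the start. As the kernel is not normalised, the
  limit is \<open>moll_mass\<close> times the value of f.\<close>

definition moll_lim :: "'a::euclidean_space set \<Rightarrow> ('a \<Rightarrow> real) \<Rightarrow> 'a \<Rightarrow> real" where
  "moll_lim \<Omega> f z = lim (\<lambda>n. moll_avg \<Omega> f (1 / real (Suc n)) z)"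

text \<open>The equation -\<Delta>f = g in the sense of distributions. It passes to finite linear
  combinations, so everything proved here applies to sums of eigenfunctions and not only to single
  ones.\<close>

locale poisson_solution =
  fixes \<Omega> :: "'a::euclidean_space set" and f g :: "'a \<Rightarrow> real"
  assumes dim: "DIM('a) < 4" and opn: "open \<Omega>" and bdd: "bounded \<Omega>"
    and f: "f \<in> L2 \<Omega>" and g: "g \<in> L2 \<Omega>"
    and weak_eq: "\<And>\<psi>. \<psi> \<in> test_functions \<Omega> \<Longrightarrow>
      (\<integral>x. f x * laplacian \<psi> x \<partial>lebesgue_on \<Omega>) = - (\<integral>x. g x * \<psi> x \<partial>lebesgue_on \<Omega>)"
begin

lemma mollifier_L2: "R > 0 \<Longrightarrow> mollifier R z \<in> L2 \<Omega>"
  using opn by (intro L2_bounded[OF opn bdd _ mollifier_le(3)] continuous_imp_measurable_on_sets_lebesgue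
      continuous_on_mollifier) auto

lemma radial_bump_L2: "R > 0 \<Longrightarrow> radial_bump 0 R z \<in> L2 \<Omega>"
  using opn bump_0_bounds by (intro L2_bounded[OF opn bdd, where B=1] continuous_imp_measurable_on_sets_lebesgue
      continuous_on_radial_bump) (auto simp: radial_bump_def)

lemma f_integrable: "integrable (lebesgue_on \<Omega>) f"
  by (rule L2_integrable[OF opn bdd f])

text \<open>The R-derivative of the kernel is R^(1-d) times the Laplacian of
  \<open>radial_bump 0 R z\<close>, which is a test function because the closed ball lies in
  \<Omega>; the equation then trades the Laplacian on f for -g.\<close>

lemma moll_avg_deriv:
  assumes R: "R > 0" and cb: "cball z R \<subseteq> \<Omega>"
  shows "((\<lambda>R. moll_avg \<Omega> f R z) has_real_derivative
    - (R powr (1 - real DIM('a)) * (\<integral>y. g y * radial_bump 0 R z y \<partial>lebesgue_on \<Omega>))) (at R)"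
proof -
  define d where "d = real DIM('a)"
  define k' where "k' t y = t powr (1 - d) * laplacian (radial_bump 0 t z) y" for t y
  obtain B1 where B1: "B1 > 0" "\<And>x. x \<le> 1 \<Longrightarrow> \<bar>bump 1 x\<bar> \<le> B1" using bump_bounded by blast
  obtain B2 where B2: "B2 > 0" "\<And>x. x \<le> 1 \<Longrightarrow> \<bar>bump 2 x\<bar> \<le> B2" using bump_bounded by blast
  \<comment> \<open>The two summands bound the two terms of the Laplacian of the bump, up to a
    factor 1/t^2. The remaining power t^(-d-1) decreases, so it is evaluated at the left end R/2 of
    the parameter interval.\<close>
  define B where "B = (R / 2) powr (- d - 1) * (4 * B2 + 2 * d * B1)"
  \<comment> \<open>Balls of radius up to 2R may leave \<Omega>; this is harmless, as the derivative
    of the kernel is known for every t > 0 and the equation is used at t = R alone.\<close>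
  have "((\<lambda>R. moll_avg \<Omega> f R z) has_real_derivative (\<integral>y. f y * k' R y \<partial>lebesgue_on \<Omega>)) (at R)"
    unfolding moll_avg_def
  proof (rule has_derivative_integral_param[OF f_integrable, where a="R/2" and b="2*R" and B=B])
    show "R \<in> {R / 2<..<2 * R}" using R by simp
    show "k' R \<in> borel_measurable (lebesgue_on \<Omega>)"
      unfolding k'_def laplacian_radial_bump divide_inverse
      using opn by (intro continuous_imp_measurable_on_sets_lebesgue continuous_intros continuous_on_radial_bump) auto
    fix t assume t: "t \<in> {R / 2<..<2 * R}"
    then have t0: "t > 0" using R by auto
    show "integrable (lebesgue_on \<Omega>) (\<lambda>x. f x * mollifier t z x)"
      by (intro L2_mult_integrable f mollifier_L2 t0)
    fix y
    show "((\<lambda>t. mollifier t z y) has_real_derivative k' t y) (at t)"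
      unfolding k'_def d_def by (rule mollifier_deriv[OF t0])
    have "\<bar>radial_bump 2 t z y * (4 * (norm (y - z))\<^sup>2 / t ^ 4)\<bar> \<le> B2 * (4 / t\<^sup>2)"
    proof (cases "norm (y - z) < t")
      case True
      have "(norm (y - z))\<^sup>2 \<le> t\<^sup>2" using True by (intro power_mono) auto
      then have "4 * (norm (y - z))\<^sup>2 / t ^ 4 \<le> 4 * t\<^sup>2 / t ^ 4"
        using t0 by (intro divide_right_mono) auto
      also have "\<dots> = 4 / t\<^sup>2" using t0 by (simp add: field_simps power2_eq_square power4_eq_xxxx)
      finally show ?thesis
        using B2 unfolding abs_mult by (intro mult_mono) (auto simp: radial_bump_def)
    next
      case False
      then have "radial_bump 2 t z y = 0" using t0 by (intro radial_bump_zero) auto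
      then show ?thesis using B2(1) by simp
    qed
    moreover have "\<bar>2 * d / t\<^sup>2 * radial_bump 1 t z y\<bar> \<le> 2 * d / t\<^sup>2 * B1"
      using B1 unfolding abs_mult by (intro mult_mono) (auto simp: radial_bump_def d_def)
    ultimately have "\<bar>laplacian (radial_bump 0 t z) y\<bar> \<le> B2 * (4 / t\<^sup>2) + 2 * d / t\<^sup>2 * B1"
      unfolding laplacian_radial_bump d_def by linarith
    also have "\<dots> = (4 * B2 + 2 * d * B1) / t\<^sup>2" by (simp add: add_divide_distrib)
    finally have "\<bar>k' t y\<bar> \<le> t powr (1 - d) * ((4 * B2 + 2 * d * B1) / t\<^sup>2)"
      unfolding k'_def abs_mult by (intro mult_mono) auto
    also have "\<dots> = t powr (- d - 1) * (4 * B2 + 2 * d * B1)"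
      using t0 by (simp add: powr_diff powr_minus power2_eq_square field_simps)
    also have "\<dots> \<le> B"
      unfolding B_def using B1(1) B2(1) t R by (intro mult_right_mono powr_mono2') (auto simp: d_def)
    finally show "\<bar>k' t y\<bar> \<le> B" .
  qed
  also have "(\<integral>y. f y * k' R y \<partial>lebesgue_on \<Omega>)
      = R powr (1 - d) * (\<integral>y. f y * laplacian (radial_bump 0 R z) y \<partial>lebesgue_on \<Omega>)"
    unfolding k'_def by (subst integral_mult_right_zero[symmetric]) (simp add: ac_simps)
  finally show ?thesis
    using weak_eq[OF radial_bump_test_function[OF R cb]] by (simp add: d_def)
qed

text \<open>The numerator comes from the L^2 norm of a bump supported in a ball, the denominator
  from integrating t^(1 - d/2); it is positive because d < 4.\<close>

definition ball_const :: real where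
  "ball_const = sqrt (unit_ball_vol DIM('a)) / (2 - real DIM('a) / 2)"

text \<open>The bound on the derivative is integrated by monotonicity: C t^(2 - d/2) plus or minus
  the average has a nonnegative derivative on [e, R]. The term with e is nonnegative and is dropped,
  which makes the bound independent of e.\<close>

lemma moll_avg_diff:
  assumes "0 < e" "e \<le> R" "cball z R \<subseteq> \<Omega>"
  shows "\<bar>moll_avg \<Omega> f R z - moll_avg \<Omega> f e z\<bar>
    \<le> ball_const * l2_norm \<Omega> g * R powr (2 - real DIM('a) / 2)"
proof -
  define d where "d = real DIM('a)"
  define C where "C = ball_const * l2_norm \<Omega> g"
  have d: "0 \<le> d" "d < 4" using dim by (auto simp: d_def)
  have C0: "0 \<le> C" using d by (auto simp: C_def ball_const_def d_def[symmetric] l2_norm_nonneg)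
  define F' where "F' t = - (t powr (1 - d) * (\<integral>y. g y * radial_bump 0 t z y \<partial>lebesgue_on \<Omega>))" for t
  have D: "((\<lambda>R. moll_avg \<Omega> f R z) has_real_derivative F' t) (at t)" if "e \<le> t" "t \<le> R" for t
    unfolding F'_def d_def using that assms by (intro moll_avg_deriv) auto
  have P: "((\<lambda>t. C * t powr (2 - d / 2)) has_real_derivative C * ((2 - d / 2) * t powr (1 - d / 2))) (at t)"
    if "e \<le> t" for t
    using DERIV_cmult[OF has_real_derivative_powr[of t "2 - d / 2"], of C] that assms by simp
  have bound: "\<bar>F' t\<bar> \<le> C * ((2 - d / 2) * t powr (1 - d / 2))" if "e \<le> t" "t \<le> R" for t
  proof -
    have t0: "t > 0" using that assms by simp
    have "\<bar>\<integral>y. g y * radial_bump 0 t z y \<partial>lebesgue_on \<Omega>\<bar> \<le> l2_norm \<Omega> g * l2_norm \<Omega> (radial_bump 0 t z)"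
      by (intro l2_cauchy_schwarz g radial_bump_L2 t0)
    also have "l2_norm \<Omega> (radial_bump 0 t z) \<le> 1 * sqrt (unit_ball_vol DIM('a)) * t powr (real DIM('a) / 2)"
      using radial_bump_le[OF t0]
      by (intro l2_norm_le_ball[OF opn bdd radial_bump_L2[OF t0], where z=z]) (auto simp: t0)
    finally have "\<bar>F' t\<bar> \<le> t powr (1 - d) * (l2_norm \<Omega> g * (sqrt (unit_ball_vol DIM('a)) * t powr (d / 2)))"
      by (simp add: F'_def abs_mult d_def mult_left_mono l2_norm_nonneg)
    also have "\<dots> = l2_norm \<Omega> g * sqrt (unit_ball_vol DIM('a)) * (t powr (1 - d) * t powr (d / 2))"
      by simp
    also have "t powr (1 - d) * t powr (d / 2) = t powr (1 - d / 2)"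
      by (simp add: powr_add[symmetric] field_simps)
    also have "l2_norm \<Omega> g * sqrt (unit_ball_vol DIM('a)) = C * (2 - d / 2)"
      using d by (simp add: C_def ball_const_def d_def[symmetric])
    finally show ?thesis by simp
  qed
  have "C * e powr (2 - d / 2) - moll_avg \<Omega> f e z \<le> C * R powr (2 - d / 2) - moll_avg \<Omega> f R z"
    using assms(2)
  proof (rule DERIV_nonneg_imp_nondecreasing)
    fix t assume t: "e \<le> t" "t \<le> R"
    show "\<exists>y. ((\<lambda>t. C * t powr (2 - d / 2) - moll_avg \<Omega> f t z) has_real_derivative y) (at t) \<and> 0 \<le> y"
      using DERIV_diff[OF P[OF t(1)] D[OF t]] bound[OF t] by (intro exI conjI) (assumption, linarith)
  qed
  moreover have "C * e powr (2 - d / 2) + moll_avg \<Omega> f e z \<le> C * R powr (2 - d / 2) + moll_avg \<Omega> f R z"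
    using assms(2)
  proof (rule DERIV_nonneg_imp_nondecreasing)
    fix t assume t: "e \<le> t" "t \<le> R"
    show "\<exists>y. ((\<lambda>t. C * t powr (2 - d / 2) + moll_avg \<Omega> f t z) has_real_derivative y) (at t) \<and> 0 \<le> y"
      using DERIV_add[OF P[OF t(1)] D[OF t]] bound[OF t] by (intro exI conjI) (assumption, linarith)
  qed
  moreover have "0 \<le> C * e powr (2 - d / 2)" using C0 by simp
  ultimately show ?thesis by (simp add: C_def d_def)
qed

lemma moll_avg_le:
  assumes "0 < R"
  shows "\<bar>moll_avg \<Omega> f R z\<bar> \<le> 4 * sqrt (unit_ball_vol DIM('a)) * l2_norm \<Omega> f * R powr (- real DIM('a) / 2)"
proof -
  have "l2_norm \<Omega> (mollifier R z)
      \<le> 4 * R powr (- real DIM('a)) * sqrt (unit_ball_vol DIM('a)) * R powr (real DIM('a) / 2)"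
    using mollifier_le[OF assms]
    by (intro l2_norm_le_ball[OF opn bdd mollifier_L2[OF assms], where z=z]) (auto simp: assms)
  also have "\<dots> = 4 * sqrt (unit_ball_vol DIM('a)) * (R powr (- real DIM('a)) * R powr (real DIM('a) / 2))"
    by simp
  also have "R powr (- real DIM('a)) * R powr (real DIM('a) / 2) = R powr (- real DIM('a) / 2)"
    by (simp add: powr_add[symmetric])
  finally have "l2_norm \<Omega> f * l2_norm \<Omega> (mollifier R z)
      \<le> l2_norm \<Omega> f * (4 * sqrt (unit_ball_vol DIM('a)) * R powr (- real DIM('a) / 2))"
    by (intro mult_left_mono l2_norm_nonneg)
  moreover have "\<bar>moll_avg \<Omega> f R z\<bar> \<le> l2_norm \<Omega> f * l2_norm \<Omega> (mollifier R z)"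
    unfolding moll_avg_def by (intro l2_cauchy_schwarz f mollifier_L2 assms)
  ultimately show ?thesis by (simp add: ac_simps)
qed

lemma moll_radius_tendsto:
  "(\<lambda>n. C * (1 / real (Suc n)) powr (2 - real DIM('a) / 2)) \<longlonglongrightarrow> 0"
proof -
  have "(\<lambda>n. (1 / real (Suc n)) powr (2 - real DIM('a) / 2)) \<longlonglongrightarrow> 0 powr (2 - real DIM('a) / 2)"
    using dim lim_1_over_n[THEN LIMSEQ_Suc] by (intro tendsto_powr2 tendsto_const) auto
  then show ?thesis using tendsto_mult_right_zero by fastforce
qed

text \<open>By \<open>moll_avg_diff\<close> two averages differ by at most a multiple of a positive
  power of the larger radius, so the sequence is Cauchy.\<close>

lemma moll_avg_tendsto:
  assumes "z \<in> \<Omega>"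
  shows "(\<lambda>n. moll_avg \<Omega> f (1 / real (Suc n)) z) \<longlonglongrightarrow> moll_lim \<Omega> f z"
proof -
  obtain \<delta> where \<delta>: "\<delta> > 0" "cball z \<delta> \<subseteq> \<Omega>" using opn assms open_contains_cball by metis
  define a where "a n = moll_avg \<Omega> f (1 / real (Suc n)) z" for n
  define C where "C = ball_const * l2_norm \<Omega> g"
  obtain N0 where N0: "1 / real (Suc N0) \<le> \<delta>"
    using nat_approx_posE[OF \<delta>(1)] by (metis less_imp_le)
  have est: "\<bar>a m - a n\<bar> \<le> C * (1 / real (Suc m)) powr (2 - real DIM('a) / 2)" if "N0 \<le> m" "m \<le> n" for m n
  proof -
    have "1 / real (Suc m) \<le> 1 / real (Suc N0)" using that by (simp add: frac_le)
    then have "cball z (1 / real (Suc m)) \<subseteq> \<Omega>" using N0 \<delta>(2) by auto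
    then show ?thesis
      unfolding a_def C_def using that by (intro moll_avg_diff) (auto simp: frac_le)
  qed
  have "Cauchy a"
  proof (rule metric_CauchyI)
    fix e :: real assume "e > 0"
    then obtain N1 where N1: "\<And>n. n \<ge> N1 \<Longrightarrow> \<bar>C * (1 / real (Suc n)) powr (2 - real DIM('a) / 2)\<bar> < e / 2"
      using LIMSEQ_D[OF moll_radius_tendsto, of "e/2" C] by auto
    define N where "N = max N0 N1"
    have near: "\<bar>a N - a n\<bar> < e / 2" if "n \<ge> N" for n
      using est[of N n] N1[of N] that by (simp add: N_def)
    show "\<exists>M. \<forall>m\<ge>M. \<forall>n\<ge>M. dist (a m) (a n) < e"
    proof (intro exI allI impI)
      fix m n assume "N \<le> m" "N \<le> n"
      then show "dist (a m) (a n) < e" using near[of m] near[of n] unfolding dist_real_def by linarith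
    qed
  qed
  then have "convergent a" by (rule Cauchy_convergent)
  moreover have a: "a = (\<lambda>n. moll_avg \<Omega> f (1 / real (Suc n)) z)"
    by (rule ext) (simp only: a_def)
  ultimately show ?thesis unfolding moll_lim_def a[symmetric] by (simp only: convergent_LIMSEQ_iff)
qed

lemma moll_avg_approx:
  assumes "0 < R" "cball z R \<subseteq> \<Omega>"
  shows "\<bar>moll_avg \<Omega> f R z - moll_lim \<Omega> f z\<bar> \<le> ball_const * l2_norm \<Omega> g * R powr (2 - real DIM('a) / 2)"
proof (rule tendsto_upperbound)
  have "z \<in> \<Omega>" using assms by auto
  then show "(\<lambda>n. \<bar>moll_avg \<Omega> f R z - moll_avg \<Omega> f (1 / real (Suc n)) z\<bar>)
      \<longlonglongrightarrow> \<bar>moll_avg \<Omega> f R z - moll_lim \<Omega> f z\<bar>"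
    by (intro tendsto_intros moll_avg_tendsto)
  obtain N0 where N0: "1 / real (Suc N0) \<le> R"
    using nat_approx_posE[OF assms(1)] by (metis less_imp_le)
  show "\<forall>\<^sub>F n in sequentially. \<bar>moll_avg \<Omega> f R z - moll_avg \<Omega> f (1 / real (Suc n)) z\<bar>
      \<le> ball_const * l2_norm \<Omega> g * R powr (2 - real DIM('a) / 2)"
    using eventually_ge_at_top[of N0]
  proof eventually_elim
    case (elim n)
    have "1 / real (Suc n) \<le> 1 / real (Suc N0)" using elim by (simp add: frac_le)
    then show ?case using N0 assms by (intro moll_avg_diff) auto
  qed
qed simp

text \<open>The interior estimate with the radius left free. Its two terms balance when R^2 is of
  the order of the quotient of the norms of f and g, that is 1/\<Lambda> for spectral
  combinations.\<close>

lemma moll_lim_le: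
  assumes "0 < R" "cball z R \<subseteq> \<Omega>"
  shows "\<bar>moll_lim \<Omega> f z\<bar> \<le> 4 * sqrt (unit_ball_vol DIM('a)) * l2_norm \<Omega> f * R powr (- real DIM('a) / 2)
    + ball_const * l2_norm \<Omega> g * R powr (2 - real DIM('a) / 2)"
  using moll_avg_approx[OF assms] moll_avg_le[OF assms(1), of z] by linarith

lemma continuous_on_moll_avg:
  assumes "R > 0"
  shows "continuous_on S (moll_avg \<Omega> f R)"
proof -
  have "(moll_avg \<Omega> f R \<circ> X) \<longlonglongrightarrow> moll_avg \<Omega> f R z" if X: "X \<longlonglongrightarrow> z" for X z
    unfolding moll_avg_def o_def
  proof (rule integral_dominated_convergence[where w="\<lambda>y. \<bar>f y\<bar> * (4 * R powr (- real DIM('a)))"])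
    show "AE y in lebesgue_on \<Omega>. (\<lambda>n. f y * mollifier R (X n) y) \<longlonglongrightarrow> f y * mollifier R z y"
    proof (intro AE_I2 tendsto_mult tendsto_const)
      fix y
      have "isCont (bump 1) t" for t using bump_deriv DERIV_isCont by blast
      then show "(\<lambda>n. mollifier R (X n) y) \<longlonglongrightarrow> mollifier R z y"
        unfolding mollifier_def radial_bump_def
        using assms by (intro tendsto_mult tendsto_const isCont_tendsto_compose[of _ "bump 1"] tendsto_intros X) auto
    qed
    show "AE y in lebesgue_on \<Omega>. norm (f y * mollifier R (X n) y) \<le> \<bar>f y\<bar> * (4 * R powr (- real DIM('a)))" for n
      using mollifier_le(3)[OF assms] by (auto simp: abs_mult intro!: AE_I2 mult_left_mono)
  qed (use L2_mult_integrable[OF f mollifier_L2[OF assms]] f_integrable in auto)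
  then show ?thesis
    by (auto simp: continuous_on_sequentially)
qed

text \<open>The rate in \<open>moll_avg_approx\<close> depends on z only through the requirement
  that the ball fits into \<Omega>. On a ball of half the available radius it is uniform, and the
  averages are continuous.\<close>

lemma continuous_on_moll_lim: "continuous_on \<Omega> (moll_lim \<Omega> f)"
proof -
  have "\<exists>e>0. continuous_on (ball z e) (moll_lim \<Omega> f)" if z: "z \<in> \<Omega>" for z
  proof -
    obtain \<delta> where \<delta>: "\<delta> > 0" "cball z \<delta> \<subseteq> \<Omega>" using opn z open_contains_cball by metis
    have sub: "cball x (\<delta> / 2) \<subseteq> \<Omega>" if "x \<in> ball z (\<delta> / 2)" for x
    proof
      fix y assume "y \<in> cball x (\<delta> / 2)"
      then have "dist z y \<le> \<delta>" using that dist_triangle[of z y x] by auto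
      then show "y \<in> \<Omega>" using \<delta>(2) by auto
    qed
    have "continuous_on (ball z (\<delta> / 2)) (moll_lim \<Omega> f)"
    proof (rule uniform_limit_theorem)
      show "\<forall>\<^sub>F n in sequentially. continuous_on (ball z (\<delta> / 2)) (moll_avg \<Omega> f (1 / real (Suc n)))"
        by (intro always_eventually allI continuous_on_moll_avg) simp
      show "uniform_limit (ball z (\<delta> / 2)) (\<lambda>n. moll_avg \<Omega> f (1 / real (Suc n))) (moll_lim \<Omega> f) sequentially"
      proof (rule uniform_limitI)
        fix e :: real assume "e > 0"
        obtain N0 where N0: "1 / real (Suc N0) \<le> \<delta> / 2"
          using nat_approx_posE[of "\<delta>/2"] \<delta>(1) by (metis half_gt_zero less_imp_le)
        have "\<forall>\<^sub>F n in sequentially. ball_const * l2_norm \<Omega> g * (1 / real (Suc n)) powr (2 - real DIM('a) / 2) < e"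
          by (rule order_tendstoD(2)[OF moll_radius_tendsto \<open>e > 0\<close>])
        then show "\<forall>\<^sub>F n in sequentially. \<forall>x\<in>ball z (\<delta> / 2).
            dist (moll_avg \<Omega> f (1 / real (Suc n)) x) (moll_lim \<Omega> f x) < e"
          using eventually_ge_at_top[of N0]
        proof eventually_elim
          case (elim n)
          have "1 / real (Suc n) \<le> 1 / real (Suc N0)" using elim by (simp add: frac_le)
          then have "1 / real (Suc n) \<le> \<delta> / 2" using N0 by linarith
          then have "cball x (1 / real (Suc n)) \<subseteq> \<Omega>" if "x \<in> ball z (\<delta> / 2)" for x
            using sub[OF that] by auto
          then show ?case
            using elim moll_avg_approx[of "1 / real (Suc n)"] by (fastforce simp: dist_real_def)
        qed
      qed
    qed simp
    then show ?thesis using \<delta>(1) by (intro exI[of _ "\<delta> / 2"]) auto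
  qed
  then have "\<forall>z\<in>\<Omega>. isCont (moll_lim \<Omega> f) z"
    by (metis centre_in_ball continuous_on_eq_continuous_at open_ball)
  then show ?thesis by (simp add: continuous_at_imp_continuous_on)
qed

end

section \<open>Mollification and the identification of the limit\<close>

lemma lborel_integral_affine:
  fixes h :: "'a::euclidean_space \<Rightarrow> real"
  assumes [measurable]: "h \<in> borel_measurable borel" and "c > 0"
  shows "(\<integral>x. h x \<partial>lborel) = c ^ DIM('a) * (\<integral>x. h (t + c *\<^sub>R x) \<partial>lborel)"
proof -
  have "(\<integral>x. h x \<partial>lborel)
      = (\<integral>x. h x \<partial>density (distr lborel borel (\<lambda>x. t + c *\<^sub>R x)) (\<lambda>_. ennreal (\<bar>c\<bar> ^ DIM('a))))"
    using lborel_affine[of c t] assms(2) by simp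
  also have "\<dots> = (\<integral>x. \<bar>c\<bar> ^ DIM('a) * h x \<partial>distr lborel borel (\<lambda>x. t + c *\<^sub>R x))"
    by (subst integral_density) auto
  also have "\<dots> = (\<integral>x. \<bar>c\<bar> ^ DIM('a) * h (t + c *\<^sub>R x) \<partial>lborel)"
    by (subst integral_distr) auto
  finally show ?thesis using assms(2) by simp
qed

text \<open>The type argument carries the dimension, on which the mass depends.\<close>

definition moll_mass :: "'a::euclidean_space itself \<Rightarrow> real" where
  "moll_mass _ = (\<integral>x. mollifier 1 (0::'a) x \<partial>lborel)"

lemma borel_measurable_mollifier [measurable]: "mollifier R z \<in> borel_measurable borel"
  by (intro borel_measurable_continuous_onI continuous_on_mollifier)

lemma mollifier_integrable: "R > 0 \<Longrightarrow> integrable lborel (mollifier R (z::'a::euclidean_space))"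
proof -
  assume R: "R > 0"
  have "integrable lborel (\<lambda>y. 4 * R powr (- real DIM('a)) * indicator (cball z R) y)"
    by (intro integrable_mult_right integrable_real_indicator emeasure_bounded_finite) auto
  then show ?thesis
    by (rule Bochner_Integration.integrable_bound)
      (use mollifier_le[OF R, of z] in \<open>auto intro!: AE_I2\<close>)
qed

lemma moll_mass_pos: "moll_mass TYPE('a::euclidean_space) > 0"
proof -
  let ?m = "mollifier 1 (0::'a)"
  have nn: "0 \<le> ?m x" for x by (rule mollifier_le) simp
  have "moll_mass TYPE('a) \<noteq> 0"
  proof
    assume "moll_mass TYPE('a) = 0"
    then have "AE x in lborel. ?m x = 0"
      unfolding moll_mass_def
      by (subst (asm) integral_nonneg_eq_0_iff_AE) (use nn in \<open>auto intro: mollifier_integrable\<close>)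
    then have "AE x in lborel. x \<notin> ball (0::'a) 1"
    proof eventually_elim
      case (elim x)
      show ?case
      proof
        assume "x \<in> ball 0 1"
        then have "(norm x)\<^sup>2 < 1" by (simp add: power_less_one_iff)
        then have "bump 1 (1 - (norm x)\<^sup>2) > 0" unfolding bump_1 by simp
        then show False using elim by (simp add: mollifier_def radial_bump_def)
      qed
    qed
    then have "ball (0::'a) 1 \<in> null_sets lborel"
      by (subst AE_iff_null_sets) auto
    then have "negligible (ball (0::'a) 1)"
      using negligible_iff_null_sets null_sets_completionI by blast
    then show False using open_not_negligible[of "ball (0::'a) 1"] by simp
  qed
  moreover have "moll_mass TYPE('a) \<ge> 0"
    unfolding moll_mass_def using nn by (intro Bochner_Integration.integral_nonneg) auto
  ultimately show ?thesis by simp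
qed

text \<open>The substitution z = y + R x moves R out of the kernel and into the argument of \<psi>,
  which leaves a fixed kernel when R tends to 0.\<close>

lemma mollify_eq:
  fixes \<psi> :: "'a::euclidean_space \<Rightarrow> real"
  assumes R: "R > 0" and [measurable]: "\<psi> \<in> borel_measurable borel"
  shows "(\<integral>z. mollifier R z y * \<psi> z \<partial>lborel) = (\<integral>x. mollifier 1 0 x * \<psi> (y + R *\<^sub>R x) \<partial>lborel)"
proof -
  have meas: "(\<lambda>z. mollifier R z y) \<in> borel_measurable borel"
  proof -
    have "(\<lambda>z. mollifier R z y) = mollifier R y"
      by (auto simp: mollifier_def radial_bump_def norm_minus_commute)
    then show ?thesis by simp
  qed
  have "(\<integral>z. mollifier R z y * \<psi> z \<partial>lborel)
      = R ^ DIM('a) * (\<integral>x. mollifier R (y + R *\<^sub>R x) y * \<psi> (y + R *\<^sub>R x) \<partial>lborel)"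
    by (intro lborel_integral_affine R borel_measurable_times meas) auto
  also have "\<dots> = (\<integral>x. R ^ DIM('a) * (mollifier R (y + R *\<^sub>R x) y * \<psi> (y + R *\<^sub>R x)) \<partial>lborel)"
    by simp
  also have "\<dots> = (\<integral>x. mollifier 1 0 x * \<psi> (y + R *\<^sub>R x) \<partial>lborel)"
    using R by (intro Bochner_Integration.integral_cong refl)
      (simp add: mollifier_def radial_bump_def power_mult_distrib powr_minus powr_realpow)
  finally show ?thesis .
qed

lemma mollify_le:
  fixes \<psi> :: "'a::euclidean_space \<Rightarrow> real"
  assumes R: "R > 0" and \<psi>: "\<psi> \<in> borel_measurable borel" "\<And>x. \<bar>\<psi> x\<bar> \<le> B"
  shows "\<bar>\<integral>z. mollifier R z y * \<psi> z \<partial>lborel\<bar> \<le> moll_mass TYPE('a) * B"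
proof -
  let ?m = "mollifier 1 (0::'a)"
  note [measurable] = \<psi>(1)
  have int: "integrable lborel (\<lambda>x. ?m x * B)"
    by (intro integrable_mult_left mollifier_integrable) simp
  have le: "norm (?m x * \<psi> (y + R *\<^sub>R x)) \<le> ?m x * B" for x
    using \<psi>(2) mollifier_le(1)[of 1 0 x] by (simp add: abs_mult mult_left_mono)
  have "\<bar>\<integral>x. ?m x * \<psi> (y + R *\<^sub>R x) \<partial>lborel\<bar> \<le> (\<integral>x. ?m x * B \<partial>lborel)"
  proof -
    have "integrable lborel (\<lambda>x. ?m x * \<psi> (y + R *\<^sub>R x))"
    proof (rule Bochner_Integration.integrable_bound[OF int])
      show "AE x in lborel. norm (?m x * \<psi> (y + R *\<^sub>R x)) \<le> norm (?m x * B)"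
        by (intro AE_I2 order_trans[OF le]) simp
    qed auto
    then have "(\<integral>x. norm (?m x * \<psi> (y + R *\<^sub>R x)) \<partial>lborel) \<le> (\<integral>x. ?m x * B \<partial>lborel)"
      by (intro integral_mono int le) auto
    then show ?thesis
      using integral_norm_bound[of lborel "\<lambda>x. ?m x * \<psi> (y + R *\<^sub>R x)"]
      unfolding real_norm_def by linarith
  qed
  then show ?thesis by (simp add: mollify_eq[OF R \<psi>(1)] moll_mass_def)
qed

lemma mollify_tendsto:
  fixes \<psi> :: "'a::euclidean_space \<Rightarrow> real"
  assumes r: "\<And>n. r n > 0" "r \<longlonglongrightarrow> 0" and \<psi>: "continuous_on UNIV \<psi>" "\<And>x. \<bar>\<psi> x\<bar> \<le> B"
  shows "(\<lambda>n. \<integral>z. mollifier (r n) z y * \<psi> z \<partial>lborel) \<longlonglongrightarrow> moll_mass TYPE('a) * \<psi> y"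
proof -
  let ?m = "mollifier 1 (0::'a)"
  have [measurable]: "\<psi> \<in> borel_measurable borel" using \<psi>(1) by (rule borel_measurable_continuous_onI)
  have "(\<lambda>n. \<integral>x. ?m x * \<psi> (y + r n *\<^sub>R x) \<partial>lborel) \<longlonglongrightarrow> (\<integral>x. ?m x * \<psi> y \<partial>lborel)"
  proof (rule integral_dominated_convergence[where w="\<lambda>x. ?m x * B"])
    show "integrable lborel (\<lambda>x. ?m x * B)"
      by (intro integrable_mult_left mollifier_integrable) simp
    show "AE x in lborel. (\<lambda>n. ?m x * \<psi> (y + r n *\<^sub>R x)) \<longlonglongrightarrow> ?m x * \<psi> y"
    proof (intro AE_I2 tendsto_mult tendsto_const)
      fix x
      have "(\<lambda>n. y + r n *\<^sub>R x) \<longlonglongrightarrow> y + 0 *\<^sub>R x" by (intro tendsto_intros r)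
      moreover have "isCont \<psi> y" using \<psi>(1) by (simp add: continuous_on_eq_continuous_at)
      ultimately show "(\<lambda>n. \<psi> (y + r n *\<^sub>R x)) \<longlonglongrightarrow> \<psi> y"
        using isCont_tendsto_compose by fastforce
    qed
    show "AE x in lborel. norm (?m x * \<psi> (y + r n *\<^sub>R x)) \<le> ?m x * B" for n
      using \<psi>(2) mollifier_le(1)[of 1 "0::'a"] by (auto simp: abs_mult mult_left_mono)
  qed auto
  then show ?thesis by (simp add: mollify_eq[OF r(1)] moll_mass_def)
qed

lemma mollifier_pair_measurable:
  "(\<lambda>p. mollifier R (fst p) (snd p)) \<in> borel_measurable (borel \<Otimes>\<^sub>M borel :: ('a::euclidean_space \<times> 'a) measure)"
proof -
  have [measurable]: "bump 1 \<in> borel_measurable borel"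
    by (intro borel_measurable_continuous_onI continuous_on_bump)
  show ?thesis unfolding mollifier_def radial_bump_def by measurable
qed

text \<open>For fixed R the kernel is bounded, so a multiple of |\<psi>(z) h(y)| is an integrable
  majorant on the product space.\<close>

lemma mollifier_fubini:
  fixes h \<psi> :: "'a::euclidean_space \<Rightarrow> real"
  assumes R: "R > 0" and h: "integrable lborel h" and \<psi>: "integrable lborel \<psi>"
  shows "(\<integral>z. \<psi> z * (\<integral>y. h y * mollifier R z y \<partial>lborel) \<partial>lborel)
    = (\<integral>y. h y * (\<integral>z. mollifier R z y * \<psi> z \<partial>lborel) \<partial>lborel)"
proof -
  have [measurable]: "h \<in> borel_measurable borel" "\<psi> \<in> borel_measurable borel"
    using borel_measurable_integrable[OF h] borel_measurable_integrable[OF \<psi>] by auto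
  have "integrable (lborel \<Otimes>\<^sub>M lborel) (\<lambda>p. \<psi> (fst p) * h (snd p))"
  proof (rule lborel_pair.Fubini_integrable)
    show "integrable lborel (\<lambda>x. \<integral>y. norm (\<psi> (fst (x, y)) * h (snd (x, y))) \<partial>lborel)"
      using \<psi> by (simp add: abs_mult)
    show "AE x in lborel. integrable lborel (\<lambda>y. \<psi> (fst (x, y)) * h (snd (x, y)))"
      using h by simp
  qed measurable
  then have prod: "integrable (lborel \<Otimes>\<^sub>M lborel) (\<lambda>p. 4 * R powr (- real DIM('a)) * (\<psi> (fst p) * h (snd p)))"
    by (rule integrable_mult_right)
  have m: "(\<lambda>p. mollifier R (fst p) (snd p)) \<in> borel_measurable (lborel \<Otimes>\<^sub>M lborel :: ('a \<times> 'a) measure)"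
    using mollifier_pair_measurable by (simp cong: measurable_cong_sets)
  have "integrable (lborel \<Otimes>\<^sub>M lborel) (\<lambda>(z, y). \<psi> z * (h y * mollifier R z y))"
  proof (rule Bochner_Integration.integrable_bound[OF prod])
    show "(\<lambda>(z, y). \<psi> z * (h y * mollifier R z y)) \<in> borel_measurable (lborel \<Otimes>\<^sub>M lborel)"
      unfolding case_prod_beta by (intro borel_measurable_times m) auto
    have "\<bar>\<psi> z * (h y * mollifier R z y)\<bar> \<le> 4 * R powr (- real DIM('a)) * \<bar>\<psi> z * h y\<bar>" for z y
      using mult_right_mono[OF mollifier_le(3)[OF R, of z y], of "\<bar>\<psi> z * h y\<bar>"]
      by (simp add: abs_mult ac_simps)
    then show "AE p in lborel \<Otimes>\<^sub>M lborel. norm (case p of (z, y) \<Rightarrow> \<psi> z * (h y * mollifier R z y))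
        \<le> norm (4 * R powr (- real DIM('a)) * (\<psi> (fst p) * h (snd p)))"
      by (intro AE_I2) (auto simp: abs_mult split: prod.splits)
  qed
  from lborel_pair.Fubini_integral[OF this]
  have "(\<integral>y. (\<integral>z. \<psi> z * (h y * mollifier R z y) \<partial>lborel) \<partial>lborel)
    = (\<integral>z. (\<integral>y. \<psi> z * (h y * mollifier R z y) \<partial>lborel) \<partial>lborel)" .
  moreover have "(\<integral>z. \<psi> z * (h y * mollifier R z y) \<partial>lborel) = h y * (\<integral>z. mollifier R z y * \<psi> z \<partial>lborel)" for y
    by (subst integral_mult_right_zero[symmetric]) (simp add: ac_simps)
  ultimately show ?thesis by simp
qed

context poisson_solution
begin

text \<open>Tested against \<psi>, the averaging moves from f to \<psi> by Fubini, where it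
  converges at every point because \<psi> is continuous. Both sides therefore have the same
  integrals against all test functions of the box.\<close>

lemma moll_lim_AE_on_box:
  assumes cd: "cbox c d \<subseteq> \<Omega>"
  shows "AE x in lebesgue_on (box c d). moll_lim \<Omega> f x = moll_mass TYPE('a) * f x"
proof -
  define m where "m = moll_mass TYPE('a)"
  let ?M = "lebesgue_on (box c d)"
  have bo: "open (box c d)" "bounded (box c d)" by auto
  have sub: "box c d \<subseteq> \<Omega>" using cd box_subset_cbox by blast
  obtain h where h: "integrable lborel h" "AE x in lebesgue. indicator \<Omega> x * f x = h x"
    using integrable_lborel_representative[OF opn f_integrable] .
  have avg: "moll_avg \<Omega> f R z = (\<integral>y. h y * mollifier R z y \<partial>lborel)" for R z
    unfolding moll_avg_def
    by (rule integral_lborel_representative[OF opn _ opn f_integrable h]) simp_all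
  obtain \<delta> where \<delta>: "\<delta> > 0" "(\<Union>x\<in>cbox c d. cball x \<delta>) \<subseteq> \<Omega>"
    using compact_subset_open_imp_cball_epsilon_subset[OF compact_cbox opn cd] by blast
  obtain N where N: "1 / real (Suc N) \<le> \<delta>"
    using nat_approx_posE[OF \<delta>(1)] by (metis less_imp_le)
  \<comment> \<open>Starting at N keeps all radii below \<delta>, so that from the first term on the
    balls around points of the box lie in \<Omega>.\<close>
  define r where "r n = 1 / real (Suc (n + N))" for n
  have r: "r n > 0" "r n \<le> \<delta>" for n
  proof -
    have "r n \<le> 1 / real (Suc N)" by (simp add: r_def frac_le)
    then show "r n > 0" "r n \<le> \<delta>" using N by (auto simp: r_def)
  qed
  have r0: "r \<longlonglongrightarrow> 0"
    unfolding r_def by (rule LIMSEQ_ignore_initial_segment[OF LIMSEQ_Suc[OF lim_1_over_n]])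
  have "compact (moll_lim \<Omega> f ` cbox c d)"
    using continuous_on_subset[OF continuous_on_moll_lim cd] by (intro compact_continuous_image) auto
  then obtain K where K: "K > 0" "\<And>x. x \<in> cbox c d \<Longrightarrow> \<bar>moll_lim \<Omega> f x\<bar> \<le> K"
    using bounded_pos compact_imp_bounded by (metis imageI real_norm_def)
  \<comment> \<open>A bound for all averages on the box: the continuous limit is bounded by K on the
    closed box, and the distance to it is largest at radius \<delta>.\<close>
  define K' where "K' = K + \<bar>ball_const * l2_norm \<Omega> g\<bar> * \<delta> powr (2 - real DIM('a) / 2)"
  have K': "\<bar>moll_avg \<Omega> f (r n) z\<bar> \<le> K'" if z: "z \<in> box c d" for n z
  proof -
    have zc: "z \<in> cbox c d" using z box_subset_cbox by blast
    then have "cball z (r n) \<subseteq> \<Omega>" using \<delta>(2) r(2)[of n] by fastforce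
    from moll_avg_approx[OF r(1) this]
    have "\<bar>moll_avg \<Omega> f (r n) z - moll_lim \<Omega> f z\<bar> \<le> ball_const * l2_norm \<Omega> g * r n powr (2 - real DIM('a) / 2)" .
    also have "\<dots> \<le> \<bar>ball_const * l2_norm \<Omega> g\<bar> * \<delta> powr (2 - real DIM('a) / 2)"
      using r[of n] dim by (intro mult_mono powr_mono2) auto
    finally show ?thesis using K(2)[OF zc] unfolding K'_def by linarith
  qed
  have mlm: "moll_lim \<Omega> f \<in> borel_measurable ?M"
    by (intro continuous_imp_measurable_on_sets_lebesgue continuous_on_subset[OF continuous_on_moll_lim sub]) auto
  interpret M: finite_measure ?M by (rule open_bounded_lebesgue[OF bo])
  have mli: "integrable ?M (moll_lim \<Omega> f)"
    using K(2) box_subset_cbox[of c d] mlm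
    by (intro M.integrable_const_bound[of _ K]) (auto intro!: AE_I2 simp: space_restrict_space)
  have fi: "integrable ?M f"
  proof -
    have "integrable lebesgue (\<lambda>x. indicator \<Omega> x *\<^sub>R f x)"
      using f_integrable opn by (simp add: integrable_restrict_space)
    then have "integrable lebesgue (\<lambda>x. indicator (box c d) x *\<^sub>R (indicator \<Omega> x *\<^sub>R f x))"
      by (rule integrable_mult_indicator[rotated]) simp
    moreover have "(\<lambda>x. indicator (box c d) x *\<^sub>R (indicator \<Omega> x *\<^sub>R f x)) = (\<lambda>x. indicator (box c d) x *\<^sub>R f x)"
      using sub by (auto simp: indicator_def fun_eq_iff)
    ultimately show ?thesis by (simp add: integrable_restrict_space del: real_scaleR_def)
  qed
  have "AE x in ?M. moll_lim \<Omega> f x - m * f x = 0"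
  proof (rule fundamental_lemma[OF _ bo(1)])
    show "integrable ?M (\<lambda>x. moll_lim \<Omega> f x - m * f x)" using mli fi by simp
    fix \<psi> assume \<psi>: "\<psi> \<in> test_functions (box c d)"
    obtain B where B: "B > 0" "\<And>x. \<bar>\<psi> x\<bar> \<le> B" using test_function_bounded[OF \<psi>] by blast
    have \<psi>b: "\<psi> \<in> borel_measurable borel"
      using test_functionD(4)[OF \<psi>] by (rule borel_measurable_continuous_onI)
    have \<psi>M: "\<psi> \<in> borel_measurable ?M" by (rule test_function_measurable[OF bo(1) \<psi>])
    have "integrable lborel (\<lambda>x. indicator (cbox c d) x *\<^sub>R \<psi> x)"
      using test_functionD(4)[OF \<psi>] by (intro borel_integrable_compact) auto
    moreover have "(\<lambda>x. indicator (cbox c d) x *\<^sub>R \<psi> x) = \<psi>"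
      using test_functionD(6)[OF \<psi>] box_subset_cbox[of c d] by (force simp: indicator_def)
    ultimately have \<psi>i: "integrable lborel \<psi>" by (simp only:)
    have "(\<lambda>n. \<integral>x. \<psi> x * moll_avg \<Omega> f (r n) x \<partial>?M) \<longlonglongrightarrow> (\<integral>x. \<psi> x * moll_lim \<Omega> f x \<partial>?M)"
    proof (rule integral_dominated_convergence[where w="\<lambda>x. B * K'"])
      show "AE x in ?M. (\<lambda>n. \<psi> x * moll_avg \<Omega> f (r n) x) \<longlonglongrightarrow> \<psi> x * moll_lim \<Omega> f x"
      proof (intro AE_I2 tendsto_mult tendsto_const)
        fix x assume "x \<in> space ?M"
        then have "x \<in> \<Omega>" using sub by (auto simp: space_restrict_space)
        then show "(\<lambda>n. moll_avg \<Omega> f (r n) x) \<longlonglongrightarrow> moll_lim \<Omega> f x"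
          unfolding r_def by (rule LIMSEQ_ignore_initial_segment[OF moll_avg_tendsto])
      qed
      show "AE x in ?M. norm (\<psi> x * moll_avg \<Omega> f (r n) x) \<le> B * K'" for n
      proof (rule AE_I2)
        fix x assume "x \<in> space ?M"
        then have "x \<in> box c d" by (auto simp: space_restrict_space)
        then show "norm (\<psi> x * moll_avg \<Omega> f (r n) x) \<le> B * K'"
          unfolding real_norm_def abs_mult using B K' by (intro mult_mono) auto
      qed
      show "(\<lambda>x. \<psi> x * moll_avg \<Omega> f (r n) x) \<in> borel_measurable ?M" for n
        by (intro borel_measurable_times \<psi>M continuous_imp_measurable_on_sets_lebesgue
            continuous_on_moll_avg r(1)) auto
    qed (use \<psi>M mlm in auto)
    moreover have "(\<integral>x. \<psi> x * moll_avg \<Omega> f (r n) x \<partial>?M)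
        = (\<integral>y. h y * (\<integral>z. mollifier (r n) z y * \<psi> z \<partial>lborel) \<partial>lborel)" for n
    proof -
      have "(\<integral>x. \<psi> x * moll_avg \<Omega> f (r n) x \<partial>?M) = (\<integral>x. \<psi> x * moll_avg \<Omega> f (r n) x \<partial>lborel)"
        using test_functionD(6)[OF \<psi>]
        by (intro lebesgue_on_integral_lborel bo borel_measurable_times \<psi>b
            borel_measurable_continuous_onI continuous_on_moll_avg r(1)) auto
      then show ?thesis unfolding avg using mollifier_fubini[OF r(1) h(1) \<psi>i] by simp
    qed
    moreover have "(\<lambda>n. \<integral>y. h y * (\<integral>z. mollifier (r n) z y * \<psi> z \<partial>lborel) \<partial>lborel)
        \<longlonglongrightarrow> (\<integral>y. h y * (m * \<psi> y) \<partial>lborel)"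
    proof (rule integral_dominated_convergence[where w="\<lambda>y. \<bar>h y\<bar> * (m * B)"])
      have hm: "h \<in> borel_measurable lborel" using h(1) by auto
      show "(\<lambda>y. h y * (m * \<psi> y)) \<in> borel_measurable lborel"
        using \<psi>b by (intro borel_measurable_times hm) auto
      show "(\<lambda>y. h y * (\<integral>z. mollifier (r n) z y * \<psi> z \<partial>lborel)) \<in> borel_measurable lborel" for n
      proof (intro borel_measurable_times hm lborel.borel_measurable_lebesgue_integral)
        have "(\<lambda>p. mollifier (r n) (fst (snd p, fst p)) (snd (snd p, fst p)))
            \<in> borel_measurable (borel \<Otimes>\<^sub>M borel :: ('a \<times> 'a) measure)"
          by (rule measurable_compose[OF _ mollifier_pair_measurable]) measurable
        then have "(\<lambda>p. mollifier (r n) (snd p) (fst p)) \<in> borel_measurable (lborel \<Otimes>\<^sub>M lborel :: ('a \<times> 'a) measure)"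
          by (simp cong: measurable_cong_sets)
        then show "(\<lambda>(y, z). mollifier (r n) z y * \<psi> z) \<in> borel_measurable (lborel \<Otimes>\<^sub>M lborel)"
          unfolding case_prod_beta using \<psi>b by (intro borel_measurable_times) auto
      qed
      show "AE y in lborel. (\<lambda>n. h y * (\<integral>z. mollifier (r n) z y * \<psi> z \<partial>lborel)) \<longlonglongrightarrow> h y * (m * \<psi> y)"
        unfolding m_def
        by (intro AE_I2 tendsto_mult tendsto_const mollify_tendsto[where B=B] r r0 test_functionD(4)[OF \<psi>] B(2))
      show "AE y in lborel. norm (h y * (\<integral>z. mollifier (r n) z y * \<psi> z \<partial>lborel)) \<le> \<bar>h y\<bar> * (m * B)" for n
        using mollify_le[OF r(1) \<psi>b B(2)] by (intro AE_I2) (simp add: abs_mult m_def mult_left_mono)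
    qed (use h(1) in auto)
    ultimately have "(\<integral>x. \<psi> x * moll_lim \<Omega> f x \<partial>?M) = (\<integral>y. h y * (m * \<psi> y) \<partial>lborel)"
      by (simp add: LIMSEQ_unique)
    also have "\<dots> = m * (\<integral>y. h y * \<psi> y \<partial>lborel)"
      by (subst integral_mult_right_zero[symmetric]) (simp add: ac_simps)
    also have "(\<integral>y. h y * \<psi> y \<partial>lborel) = (\<integral>x. f x * \<psi> x \<partial>?M)"
      using test_functionD(6)[OF \<psi>]
      by (intro integral_lborel_representative[symmetric, OF bo(1) sub opn f_integrable h \<psi>b]) auto
    finally have eq: "(\<integral>x. \<psi> x * moll_lim \<Omega> f x \<partial>?M) = m * (\<integral>x. f x * \<psi> x \<partial>?M)" .
    have bound: "integrable ?M (\<lambda>x. \<psi> x * u x)" if "integrable ?M u" for u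
    proof (rule Bochner_Integration.integrable_bound[of _ "\<lambda>x. B * u x"])
      show "AE x in ?M. norm (\<psi> x * u x) \<le> norm (B * u x)"
        using B by (intro AE_I2) (auto simp: abs_mult intro!: mult_right_mono)
    qed (use that \<psi>M in auto)
    have "(\<integral>x. (moll_lim \<Omega> f x - m * f x) * \<psi> x \<partial>?M)
        = (\<integral>x. \<psi> x * moll_lim \<Omega> f x - m * (\<psi> x * f x) \<partial>?M)"
      by (simp add: algebra_simps)
    also have "\<dots> = (\<integral>x. \<psi> x * moll_lim \<Omega> f x \<partial>?M) - m * (\<integral>x. \<psi> x * f x \<partial>?M)"
      using bound[OF mli] bound[OF fi] by simp
    finally show "(\<integral>x. (moll_lim \<Omega> f x - m * f x) * \<psi> x \<partial>?M) = 0"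
      using eq by (simp add: mult.commute)
  qed
  then show ?thesis by eventually_elim (simp add: m_def)
qed

lemma moll_lim_AE: "AE x in lebesgue_on \<Omega>. moll_lim \<Omega> f x = moll_mass TYPE('a) * f x"
  by (intro AE_on_open_if_boxes[OF opn] moll_lim_AE_on_box)

end

section \<open>Eigenfunctions at points\<close>

lemma integral_sum_mult:
  fixes F :: "'i \<Rightarrow> 'a::euclidean_space \<Rightarrow> real"
  assumes "\<And>i. F i \<in> L2 \<Omega>" "f \<in> L2 \<Omega>"
  shows "(\<integral>x. (\<Sum>i\<in>A. c i * F i x) * f x \<partial>lebesgue_on \<Omega>) = (\<Sum>i\<in>A. c i * (\<integral>x. F i x * f x \<partial>lebesgue_on \<Omega>))"
proof -
  have "(\<integral>x. (\<Sum>i\<in>A. c i * F i x) * f x \<partial>lebesgue_on \<Omega>) = (\<integral>x. (\<Sum>i\<in>A. c i * (F i x * f x)) \<partial>lebesgue_on \<Omega>)"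
    by (simp add: sum_distrib_right mult.assoc)
  also have "\<dots> = (\<Sum>i\<in>A. \<integral>x. c i * (F i x * f x) \<partial>lebesgue_on \<Omega>)"
    by (intro Bochner_Integration.integral_sum integrable_mult_right L2_mult_integrable assms)
  finally show ?thesis by simp
qed

locale dirichlet_spectrum =
  fixes \<Omega> :: "'a::euclidean_space set" and lam :: "nat \<Rightarrow> real" and \<phi> :: "nat \<Rightarrow> 'a \<Rightarrow> real"
  assumes dim: "DIM('a) < 4" and opn: "open \<Omega>" and bdd: "bounded \<Omega>"
    and eig: "dirichlet_eigenpairs \<Omega> lam \<phi>"
begin

lemma lam_pos: "lam k > 0"
  using eig by (simp add: dirichlet_eigenpairs_def)

lemma basis: "orthonormal_basis_L2 \<Omega> \<phi>"
  using eig by (simp add: dirichlet_eigenpairs_def)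

lemma phi_L2: "\<phi> k \<in> L2 \<Omega>"
  using basis by (simp add: orthonormal_basis_L2_def)

lemma phi_orthonormal: "(\<integral>x. \<phi> j x * \<phi> k x \<partial>lebesgue_on \<Omega>) = (if j = k then 1 else 0)"
  using basis by (simp add: orthonormal_basis_L2_def l2_inner_real)

text \<open>As \<open>lam\<close> tends to infinity, only finitely many eigenvalues lie below 1. The
  bound m later serves as the bottom of the dyadic scale.\<close>

lemma lam_lower_bound:
  obtains m where "m > 0" "\<And>k. m \<le> lam k"
proof -
  have "\<forall>\<^sub>F k in sequentially. 1 \<le> lam k"
    using eig by (simp add: dirichlet_eigenpairs_def filterlim_at_top)
  then obtain N where N: "\<And>k. k \<ge> N \<Longrightarrow> 1 \<le> lam k"
    by (auto simp: eventually_sequentially)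
  define m where "m = Min (insert 1 (lam ` {..<N}))"
  have "m > 0" unfolding m_def using lam_pos by (subst Min_gr_iff) auto
  moreover have "m \<le> lam k" for k
  proof (cases "k < N")
    case True
    then show ?thesis unfolding m_def by (intro Min_le) auto
  next
    case False
    have "m \<le> 1" unfolding m_def by (intro Min_le) auto
    then show ?thesis using N[of k] False by simp
  qed
  ultimately show ?thesis using that by blast
qed

definition lin_comb :: "(nat \<Rightarrow> real) \<Rightarrow> nat set \<Rightarrow> 'a \<Rightarrow> real" where
  "lin_comb c A x = (\<Sum>k\<in>A. c k * \<phi> k x)"

lemma lin_comb_L2: "lin_comb c A \<in> L2 \<Omega>"
  unfolding lin_comb_def[abs_def] by (intro L2_sum L2_cmult phi_L2)

lemma integral_lin_comb:
  assumes "f \<in> L2 \<Omega>"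
  shows "(\<integral>x. lin_comb c A x * f x \<partial>lebesgue_on \<Omega>) = (\<Sum>k\<in>A. c k * (\<integral>x. \<phi> k x * f x \<partial>lebesgue_on \<Omega>))"
  unfolding lin_comb_def by (rule integral_sum_mult[OF phi_L2 assms])

lemma coef_lin_comb:
  assumes "finite A"
  shows "coef \<Omega> \<phi> (lin_comb c A) j = (if j \<in> A then c j else 0)"
  using assms by (simp add: coef_def integral_lin_comb[OF phi_L2] phi_orthonormal if_distrib sum.delta cong: if_cong)

lemma lin_comb_norm:
  assumes "finite A"
  shows "(l2_norm \<Omega> (lin_comb c A))\<^sup>2 = (\<Sum>k\<in>A. (c k)\<^sup>2)"
proof -
  have "(l2_norm \<Omega> (lin_comb c A))\<^sup>2 = (\<Sum>k\<in>A. c k * coef \<Omega> \<phi> (lin_comb c A) k)"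
  proof -
    have "(l2_norm \<Omega> (lin_comb c A))\<^sup>2 = (\<integral>x. lin_comb c A x * lin_comb c A x \<partial>lebesgue_on \<Omega>)"
      by (simp only: l2_norm_power2) (simp only: power2_eq_square)
    then show ?thesis by (simp add: integral_lin_comb[OF lin_comb_L2] coef_def mult.commute)
  qed
  also have "\<dots> = (\<Sum>k\<in>A. (c k)\<^sup>2)"
    using coef_lin_comb[OF assms] by (intro sum.cong) (auto simp: power2_eq_square)
  finally show ?thesis .
qed

lemma lin_comb_poisson: "poisson_solution \<Omega> (lin_comb c A) (lin_comb (\<lambda>k. c k * lam k) A)"
proof
  fix \<psi> assume \<psi>: "\<psi> \<in> test_functions \<Omega>"
  have lap: "laplacian \<psi> \<in> L2 \<Omega>"
    unfolding laplacian_def[abs_def]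
    by (intro L2_sum test_function_L2[OF opn bdd test_function_deriv[OF test_function_deriv[OF \<psi>]]])
  have "(\<integral>x. \<phi> k x * laplacian \<psi> x \<partial>lebesgue_on \<Omega>) = - lam k * (\<integral>x. \<phi> k x * \<psi> x \<partial>lebesgue_on \<Omega>)" for k
    using eig by (intro weak_to_distributional[OF opn bdd _ \<psi>]) (auto simp: dirichlet_eigenpairs_def)
  then show "(\<integral>x. lin_comb c A x * laplacian \<psi> x \<partial>lebesgue_on \<Omega>)
      = - (\<integral>x. lin_comb (\<lambda>k. c k * lam k) A x * \<psi> x \<partial>lebesgue_on \<Omega>)"
    by (simp add: integral_lin_comb[OF lap] integral_lin_comb[OF test_function_L2[OF opn bdd \<psi>]]
        sum_negf mult.assoc)
qed (use dim opn bdd lin_comb_L2 in auto)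

lemma lin_comb_single: "lin_comb (\<lambda>_. 1) {k} = \<phi> k"
  by (simp add: lin_comb_def[abs_def])

lemma phi_poisson: "poisson_solution \<Omega> (\<phi> k) (lin_comb (\<lambda>k. lam k) {k})"
  using lin_comb_poisson[of "\<lambda>_. 1" "{k}"] by (simp add: lin_comb_single)

text \<open>The continuous version of \<phi>_k on \<Omega>; the division makes up for the mass of
  the kernel.\<close>

definition phi_at :: "nat \<Rightarrow> 'a \<Rightarrow> real" where
  "phi_at k z = moll_lim \<Omega> (\<phi> k) z / moll_mass TYPE('a)"

lemma continuous_on_phi_at: "continuous_on \<Omega> (phi_at k)"
  unfolding phi_at_def using moll_mass_pos[where 'a='a]
  by (intro continuous_intros poisson_solution.continuous_on_moll_lim[OF phi_poisson]) auto

lemma phi_at_AE: "AE x in lebesgue_on \<Omega>. phi_at k x = \<phi> k x"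
  using poisson_solution.moll_lim_AE[OF phi_poisson, of k]
  by eventually_elim (use moll_mass_pos[where 'a='a] in \<open>simp add: phi_at_def\<close>)

text \<open>This turns the interior estimate for a combination into an estimate for the point values
  of the eigenfunctions.\<close>

lemma moll_lim_lin_comb:
  assumes "z \<in> \<Omega>"
  shows "moll_lim \<Omega> (lin_comb c A) z = moll_mass TYPE('a) * (\<Sum>k\<in>A. c k * phi_at k z)"
proof -
  have "(\<lambda>n. \<Sum>k\<in>A. c k * moll_avg \<Omega> (\<phi> k) (1 / real (Suc n)) z) \<longlonglongrightarrow> (\<Sum>k\<in>A. c k * moll_lim \<Omega> (\<phi> k) z)"
    by (intro tendsto_intros poisson_solution.moll_avg_tendsto[OF phi_poisson assms])
  moreover have "(\<Sum>k\<in>A. c k * moll_avg \<Omega> (\<phi> k) (1 / real (Suc n)) z) = moll_avg \<Omega> (lin_comb c A) (1 / real (Suc n)) z" for n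
    unfolding moll_avg_def
    by (rule integral_lin_comb[symmetric]) (rule poisson_solution.mollifier_L2[OF phi_poisson], simp)
  ultimately have "moll_lim \<Omega> (lin_comb c A) z = (\<Sum>k\<in>A. c k * moll_lim \<Omega> (\<phi> k) z)"
    using poisson_solution.moll_avg_tendsto[OF lin_comb_poisson assms] LIMSEQ_unique by simp blast
  also have "\<dots> = moll_mass TYPE('a) * (\<Sum>k\<in>A. c k * phi_at k z)"
    using moll_mass_pos[where 'a='a] by (simp add: phi_at_def sum_divide_distrib[symmetric])
  finally show ?thesis .
qed

text \<open>Apply the interior estimate at the scale \<open>R \<sim> \<Lambda>\<^sup>-\<^sup>1\<^sup>/\<^sup>2\<close> to the combination whose
  coefficients are the values \<open>phi_at k z\<close> themselves.\<close>

lemma spectral_function_bound: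
  assumes \<delta>: "\<delta> > 0" and m: "m > 0" "\<And>k. m \<le> lam k"
  shows "\<exists>C\<ge>0. \<forall>z A \<Lambda>. cball z \<delta> \<subseteq> \<Omega> \<longrightarrow> finite A \<longrightarrow> m \<le> \<Lambda> \<longrightarrow> (\<forall>k\<in>A. lam k \<le> \<Lambda>) \<longrightarrow>
    (\<Sum>k\<in>A. (phi_at k z)\<^sup>2) \<le> C * \<Lambda> powr (real DIM('a) / 2)"
proof -
  define d where "d = real DIM('a)"
  define M where "M = moll_mass TYPE('a)"
  define K1 where "K1 = 4 * sqrt (unit_ball_vol d)"
  define K2 where "K2 = sqrt (unit_ball_vol d) / (2 - d / 2)"
  have M: "M > 0" unfolding M_def by (rule moll_mass_pos)
  have K: "K1 \<ge> 0" "K2 \<ge> 0" using dim by (auto simp: K1_def K2_def d_def)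
  \<comment> \<open>The choice of R below makes R^2 \<Lambda> equal to \<delta>^2 m, so both terms
    of the interior estimate scale like R^(-d/2) and L collects their constants.\<close>
  define L where "L = (K1 + K2 * (\<delta>\<^sup>2 * m)) / M"
  have L: "L \<ge> 0" using K M m by (simp add: L_def)
  define C where "C = L\<^sup>2 * (\<delta> powr (- d) * m powr (- d / 2))"
  have bound: "(\<Sum>k\<in>A. (phi_at k z)\<^sup>2) \<le> C * \<Lambda> powr (d / 2)"
    if z: "cball z \<delta> \<subseteq> \<Omega>" and A: "finite A" and \<Lambda>: "m \<le> \<Lambda>" "\<And>k. k \<in> A \<Longrightarrow> lam k \<le> \<Lambda>" for z A \<Lambda>
  proof -
    have \<Lambda>0: "\<Lambda> > 0" using m \<Lambda> by simp
    define S where "S = (\<Sum>k\<in>A. (phi_at k z)\<^sup>2)"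
    have S0: "S \<ge> 0" unfolding S_def by (intro sum_nonneg) auto
    define f where "f = lin_comb (\<lambda>k. phi_at k z) A"
    define g where "g = lin_comb (\<lambda>k. phi_at k z * lam k) A"
    interpret P: poisson_solution \<Omega> f g unfolding f_def g_def by (rule lin_comb_poisson)
    have nf: "l2_norm \<Omega> f = sqrt S"
      using lin_comb_norm[OF A, of "\<lambda>k. phi_at k z"] l2_norm_nonneg[of \<Omega> f]
      unfolding f_def[symmetric] S_def[symmetric] by (metis real_sqrt_unique)
    have "(l2_norm \<Omega> g)\<^sup>2 \<le> (\<Lambda> * sqrt S)\<^sup>2"
    proof -
      have "(l2_norm \<Omega> g)\<^sup>2 = (\<Sum>k\<in>A. (phi_at k z * lam k)\<^sup>2)"
        unfolding g_def by (rule lin_comb_norm[OF A])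
      also have "\<dots> \<le> (\<Sum>k\<in>A. \<Lambda>\<^sup>2 * (phi_at k z)\<^sup>2)"
      proof (rule sum_mono)
        fix k assume k: "k \<in> A"
        have "(lam k)\<^sup>2 \<le> \<Lambda>\<^sup>2" using \<Lambda>(2)[OF k] lam_pos[of k] by (intro power_mono) auto
        then show "(phi_at k z * lam k)\<^sup>2 \<le> \<Lambda>\<^sup>2 * (phi_at k z)\<^sup>2"
          by (simp add: power_mult_distrib mult.commute mult_right_mono)
      qed
      also have "\<dots> = (\<Lambda> * sqrt S)\<^sup>2"
        using S0 by (simp add: S_def sum_distrib_left power_mult_distrib)
      finally show ?thesis .
    qed
    then have ng: "l2_norm \<Omega> g \<le> \<Lambda> * sqrt S"
      by (rule power2_le_imp_le) (use \<Lambda>0 S0 in auto)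
    \<comment> \<open>A radius of order \<Lambda>^(-1/2) which stays below \<delta> because m \<le>
      \<Lambda>.\<close>
    define R where "R = \<delta> * (m / \<Lambda>) powr (1 / 2)"
    have R0: "R > 0" unfolding R_def using \<delta> m \<Lambda>0 by simp
    have "(m / \<Lambda>) powr (1 / 2) \<le> 1 powr (1 / 2)" using m \<Lambda> \<Lambda>0 by (intro powr_mono2) auto
    then have "R \<le> \<delta>" unfolding R_def using \<delta> by (simp add: mult_left_le)
    then have cb: "cball z R \<subseteq> \<Omega>" using z by auto
    then have zO: "z \<in> \<Omega>" using R0 by auto
    have "R\<^sup>2 = \<delta>\<^sup>2 * (m / \<Lambda>)"
      unfolding R_def using m \<Lambda>0 by (simp add: power_mult_distrib powr_power)
    then have R2: "R\<^sup>2 * \<Lambda> = \<delta>\<^sup>2 * m" using \<Lambda>0 by simp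
    \<comment> \<open>With the numbers \<open>phi_at k z\<close> as coefficients the value of f at z
      is S, while the norms of f and g are at most of order sqrt S; one factor sqrt S
      cancels.\<close>
    have "M * S = moll_lim \<Omega> f z"
      unfolding f_def M_def S_def by (simp add: moll_lim_lin_comb[OF zO] power2_eq_square)
    also have "\<dots> \<le> K1 * l2_norm \<Omega> f * R powr (- d / 2) + K2 * l2_norm \<Omega> g * R powr (2 - d / 2)"
      using P.moll_lim_le[OF R0 cb] unfolding K1_def K2_def d_def P.ball_const_def by linarith
    also have "\<dots> \<le> K1 * sqrt S * R powr (- d / 2) + K2 * (\<Lambda> * sqrt S) * R powr (2 - d / 2)"
      unfolding nf using ng K by (intro add_left_mono mult_right_mono mult_left_mono) auto
    also have "R powr (2 - d / 2) = R\<^sup>2 * R powr (- d / 2)"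
      using R0 powr_add[of R 2 "- d / 2"] by simp
    also have "K1 * sqrt S * R powr (- d / 2) + K2 * (\<Lambda> * sqrt S) * (R\<^sup>2 * R powr (- d / 2))
        = (K1 + K2 * (R\<^sup>2 * \<Lambda>)) * R powr (- d / 2) * sqrt S"
      by (simp add: algebra_simps)
    also have "\<dots> = M * (L * R powr (- d / 2) * sqrt S)"
      using M by (simp add: R2 L_def)
    finally have "S \<le> L * R powr (- d / 2) * sqrt S" using M by simp
    then have le: "sqrt S * sqrt S \<le> (L * R powr (- d / 2)) * sqrt S" using S0 by simp
    have "sqrt S \<le> L * R powr (- d / 2)"
    proof (cases "S = 0")
      case True
      then show ?thesis using L by simp
    next
      case False
      then show ?thesis using mult_right_le_imp_le[OF le] S0 by simp
    qed
    then have "S \<le> (L * R powr (- d / 2))\<^sup>2"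
      by (rule sqrt_le_D)
    also have "\<dots> = L\<^sup>2 * R powr (- d)"
    proof -
      have "(R powr (- d / 2))\<^sup>2 = R powr (- d)" using R0 by (simp add: powr_power)
      then show ?thesis by (simp only: power_mult_distrib)
    qed
    also have "R powr (- d) = \<delta> powr (- d) * (m / \<Lambda>) powr (- d / 2)"
    proof -
      have "R powr (- d) = \<delta> powr (- d) * ((m / \<Lambda>) powr (1 / 2)) powr (- d)"
        unfolding R_def by (rule powr_mult)
      then show ?thesis by (simp add: powr_powr)
    qed
    also have "(m / \<Lambda>) powr (- d / 2) = m powr (- d / 2) * \<Lambda> powr (d / 2)"
    proof -
      have "\<Lambda> powr (d / 2) = inverse (\<Lambda> powr (- d / 2))" by (simp add: powr_minus)
      moreover have "(m / \<Lambda>) powr (- d / 2) = m powr (- d / 2) / \<Lambda> powr (- d / 2)"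
        by (rule powr_divide)
      ultimately show ?thesis by (simp only: divide_inverse)
    qed
    finally show ?thesis unfolding S_def C_def by (simp only: mult.assoc)
  qed
  show ?thesis
  proof (intro exI[of _ C] conjI allI impI)
    show "C \<ge> 0" by (simp add: C_def)
    fix z A \<Lambda>
    assume "cball z \<delta> \<subseteq> \<Omega>" "finite A" "m \<le> \<Lambda>" "\<forall>k\<in>A. lam k \<le> \<Lambda>"
    then show "(\<Sum>k\<in>A. (phi_at k z)\<^sup>2) \<le> C * \<Lambda> powr (real DIM('a) / 2)"
      unfolding d_def[symmetric] by (intro bound) auto
  qed
qed

section \<open>Summation over dyadic blocks of the spectrum\<close>

text \<open>The bound is stated for finite index sets: uniformity in A gives summability, and
  uniformity in z gives uniform convergence of the eigenfunction expansions.\<close>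

lemma weighted_phi_at_bound:
  assumes \<delta>: "\<delta> > 0" and r: "r > real DIM('a) / 2"
  shows "\<exists>C\<ge>0. \<forall>z A. cball z \<delta> \<subseteq> \<Omega> \<longrightarrow> finite A \<longrightarrow>
    (\<Sum>k\<in>A. lam k powr (- r) * (phi_at k z)\<^sup>2) \<le> C"
proof -
  define d where "d = real DIM('a)"
  obtain m where m: "m > 0" "\<And>k. m \<le> lam k" using lam_lower_bound by blast
  obtain C where C: "C \<ge> 0" "\<And>z A \<Lambda>. cball z \<delta> \<subseteq> \<Omega> \<Longrightarrow> finite A \<Longrightarrow> m \<le> \<Lambda> \<Longrightarrow> (\<And>k. k \<in> A \<Longrightarrow> lam k \<le> \<Lambda>) \<Longrightarrow>
    (\<Sum>k\<in>A. (phi_at k z)\<^sup>2) \<le> C * \<Lambda> powr (d / 2)"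
    using spectral_function_bound[OF \<delta> m] unfolding d_def by metis
  \<comment> \<open>For eigenvalues between 2^i m and 2^(i+1) m the weight is at most (2^i m)^(-r)
    and the sum of squares at most C (2^(i+1) m)^(d/2). The product is K q^i, where the factor
    2^(d/2) of K stems from the upper end of the block.\<close>
  define q where "q = 2 powr (d / 2 - r)"
  have q: "0 < q" "q < 1" using r by (auto simp: q_def d_def powr_less_one)
  define K where "K = C * 2 powr (d / 2) * m powr (d / 2 - r)"
  have K: "K \<ge> 0" using C by (simp add: K_def)
  \<comment> \<open>The dyadic block of \<open>lam k\<close>; the logarithm is nonnegative because m
    \<le> \<open>lam k\<close>, so \<open>nat\<close> loses nothing.\<close>
  define j where "j k = nat \<lfloor>log 2 (lam k / m)\<rfloor>" for k
  have j: "2 ^ j k * m \<le> lam k" "lam k \<le> 2 ^ Suc (j k) * m" for k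
  proof -
    have "0 \<le> log 2 (lam k / m)" using m(1) m(2)[of k] by simp
    then have fl: "real (j k) \<le> log 2 (lam k / m)" "log 2 (lam k / m) < real (j k) + 1"
      by (auto simp: j_def)
    have pos: "lam k / m > 0" using m(1) lam_pos[of k] by simp
    have "2 powr real (j k) \<le> lam k / m" using fl(1) pos by (simp add: le_log_iff)
    then show "2 ^ j k * m \<le> lam k" using m(1) by (simp add: powr_realpow field_simps)
    have "lam k / m < 2 powr (real (j k) + 1)" using fl(2) pos by (simp add: log_less_iff)
    also have "2 powr (real (j k) + 1) = 2 ^ Suc (j k)" by (simp add: powr_add powr_realpow)
    finally show "lam k \<le> 2 ^ Suc (j k) * m" using m(1) by (simp add: field_simps)
  qed
  have bound: "(\<Sum>k\<in>A. lam k powr (- r) * (phi_at k z)\<^sup>2) \<le> K * (1 / (1 - q))"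
    if z: "cball z \<delta> \<subseteq> \<Omega>" and A: "finite A" for z A
  proof -
    have grp: "(\<Sum>k | k \<in> A \<and> j k = i. lam k powr (- r) * (phi_at k z)\<^sup>2) \<le> K * q ^ i" for i
    proof -
      let ?A = "{k. k \<in> A \<and> j k = i}"
      have p: "0 < 2 ^ i * m" using m(1) by simp
      have "(\<Sum>k\<in>?A. lam k powr (- r) * (phi_at k z)\<^sup>2) \<le> (\<Sum>k\<in>?A. (2 ^ i * m) powr (- r) * (phi_at k z)\<^sup>2)"
      proof (intro sum_mono mult_right_mono)
        fix k assume "k \<in> ?A"
        then have "2 ^ i * m \<le> lam k" using j(1)[of k] by auto
        moreover have "- r \<le> 0" using r order_less_imp_le[of 0 "real DIM('a) / 2"] by linarith
        ultimately show "lam k powr (- r) \<le> (2 ^ i * m) powr (- r)" using p by (intro powr_mono2')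
      qed auto
      also have "\<dots> = (2 ^ i * m) powr (- r) * (\<Sum>k\<in>?A. (phi_at k z)\<^sup>2)"
        by (simp add: sum_distrib_left)
      also have "\<dots> \<le> (2 ^ i * m) powr (- r) * (C * (2 * (2 ^ i * m)) powr (d / 2))"
      proof (intro mult_left_mono C(2) z)
        show "finite ?A" using A by simp
        have "1 * m \<le> 2 * 2 ^ i * m"
          using m(1) one_le_power[of "2::real" "Suc i"] by (intro mult_right_mono) auto
        then show "m \<le> 2 * (2 ^ i * m)" by simp
        show "lam k \<le> 2 * (2 ^ i * m)" if "k \<in> ?A" for k using j(2)[of k] that by auto
      qed auto
      also have "\<dots> = C * 2 powr (d / 2) * ((2 ^ i * m) powr (- r) * (2 ^ i * m) powr (d / 2))"
        using p by (simp add: powr_mult)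
      also have "(2 ^ i * m) powr (- r) * (2 ^ i * m) powr (d / 2) = (2 ^ i * m) powr (d / 2 - r)"
        by (simp add: powr_add[symmetric])
      also have "\<dots> = q ^ i * m powr (d / 2 - r)"
        using m(1) by (simp add: powr_mult q_def powr_power powr_powr powr_realpow[symmetric] mult.commute)
      finally show ?thesis by (simp add: K_def ac_simps)
    qed
    have "(\<Sum>k\<in>A. lam k powr (- r) * (phi_at k z)\<^sup>2)
        = (\<Sum>i\<in>j ` A. \<Sum>k | k \<in> A \<and> j k = i. lam k powr (- r) * (phi_at k z)\<^sup>2)"
      by (rule sum.image_gen[OF A])
    also have "\<dots> \<le> (\<Sum>i\<in>j ` A. K * q ^ i)" by (intro sum_mono grp)
    also have "\<dots> = K * (\<Sum>i\<in>j ` A. q ^ i)" by (simp add: sum_distrib_left)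
    also have "(\<Sum>i\<in>j ` A. q ^ i) \<le> (\<Sum>i. q ^ i)"
      using q A by (intro sum_le_suminf) (auto simp: summable_geometric)
    also have "(\<Sum>i. q ^ i) = 1 / (1 - q)" using q by (intro suminf_geometric) auto
    finally show ?thesis using K by (simp add: mult_left_mono)
  qed
  show ?thesis
  proof (intro exI[of _ "K * (1 / (1 - q))"] conjI allI impI)
    show "K * (1 / (1 - q)) \<ge> 0" using K q by simp
  qed (rule bound)
qed

lemma phi_at_weighted_summable:
  assumes "z \<in> \<Omega>" "r > real DIM('a) / 2"
  shows "summable (\<lambda>k. lam k powr (- r) * (phi_at k z)\<^sup>2)"
proof -
  obtain \<delta> where \<delta>: "\<delta> > 0" "cball z \<delta> \<subseteq> \<Omega>" using opn assms(1) open_contains_cball by metis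
  obtain C where "\<And>A. finite A \<Longrightarrow> (\<Sum>k\<in>A. lam k powr (- r) * (phi_at k z)\<^sup>2) \<le> C"
    using weighted_phi_at_bound[OF \<delta>(1) assms(2)] \<delta>(2) by blast
  then show ?thesis by (intro summableI_nonneg_bounded[where x=C]) auto
qed

section \<open>The continuous representative\<close>

text \<open>Inserting the factors \<open>lam k powr (r / 2)\<close> and
  \<open>lam k powr (- r / 2)\<close> pairs the H^r norm of the coefficients with the weighted sum
  of point values.\<close>

lemma weighted_cauchy_schwarz:
  "\<bar>\<Sum>k\<in>A. c k * phi_at k z\<bar>
    \<le> sqrt (\<Sum>k\<in>A. lam k powr r * (c k)\<^sup>2) * sqrt (\<Sum>k\<in>A. lam k powr (- r) * (phi_at k z)\<^sup>2)"
proof -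
  have sq: "(lam k powr (t / 2))\<^sup>2 = lam k powr t" for k t
    using lam_pos[of k] by (simp add: powr_power)
  have eq: "c k * phi_at k z = (lam k powr (r / 2) * c k) * (lam k powr (- r / 2) * phi_at k z)" for k
  proof -
    have "lam k powr (r / 2) * lam k powr (- r / 2) = 1"
      using lam_pos[of k] by (simp add: powr_add[symmetric])
    then have "(lam k powr (r / 2) * lam k powr (- r / 2)) * (c k * phi_at k z) = c k * phi_at k z" by simp
    then show ?thesis by (simp only: ac_simps)
  qed
  then have "(\<Sum>k\<in>A. c k * phi_at k z)\<^sup>2
      = (\<Sum>k\<in>A. (lam k powr (r / 2) * c k) * (lam k powr (- r / 2) * phi_at k z))\<^sup>2"
    by (intro arg_cong[of _ _ power2] sum.cong refl eq)
  also have "\<dots> \<le> (\<Sum>k\<in>A. (lam k powr (r / 2) * c k)\<^sup>2) * (\<Sum>k\<in>A. (lam k powr (- r / 2) * phi_at k z)\<^sup>2)"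
    by (rule Cauchy_Schwarz_ineq_sum)
  also have "\<dots> = (\<Sum>k\<in>A. lam k powr r * (c k)\<^sup>2) * (\<Sum>k\<in>A. lam k powr (- r) * (phi_at k z)\<^sup>2)"
    unfolding power_mult_distrib sq ..
  finally have "sqrt ((\<Sum>k\<in>A. c k * phi_at k z)\<^sup>2)
      \<le> sqrt ((\<Sum>k\<in>A. lam k powr r * (c k)\<^sup>2) * (\<Sum>k\<in>A. lam k powr (- r) * (phi_at k z)\<^sup>2))"
    by (rule real_sqrt_le_mono)
  then show ?thesis by (simp add: real_sqrt_mult)
qed

lemma phi_at_series_uniform:
  assumes r: "r > real DIM('a) / 2" and c: "summable (\<lambda>k. lam k powr r * (c k)\<^sup>2)" and \<delta>: "\<delta> > 0"
  shows "uniformly_Cauchy_on {z. cball z \<delta> \<subseteq> \<Omega>} (\<lambda>n z. \<Sum>k<n. c k * phi_at k z)"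
proof -
  obtain C where C: "C \<ge> 0" "\<And>z A. cball z \<delta> \<subseteq> \<Omega> \<Longrightarrow> finite A \<Longrightarrow>
    (\<Sum>k\<in>A. lam k powr (- r) * (phi_at k z)\<^sup>2) \<le> C"
    using weighted_phi_at_bound[OF \<delta> r] by metis
  show ?thesis
  proof (rule uniformly_Cauchy_onI')
    fix e :: real assume e: "e > 0"
    \<comment> \<open>Chosen so that sqrt e' times sqrt C is e sqrt C/(sqrt C + 1), which is less
      than e; the summand 1 covers C = 0.\<close>
    define e' where "e' = (e / (sqrt C + 1))\<^sup>2"
    have sC: "sqrt C + 1 > 0" using C by (simp add: add_nonneg_pos)
    have e': "e' > 0" using e sC by (simp add: e'_def)
    obtain N where N: "\<And>m n. m \<ge> N \<Longrightarrow> norm (\<Sum>k=m..<n. lam k powr r * (c k)\<^sup>2) < e'"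
      using c e' unfolding summable_Cauchy by metis
    show "\<exists>M. \<forall>z\<in>{z. cball z \<delta> \<subseteq> \<Omega>}. \<forall>m\<ge>M. \<forall>n>m.
        dist (\<Sum>k<m. c k * phi_at k z) (\<Sum>k<n. c k * phi_at k z) < e"
    proof (intro exI ballI allI impI)
      fix z m n assume z: "z \<in> {z. cball z \<delta> \<subseteq> \<Omega>}" and mn: "N \<le> m" "m < n"
      have "(\<Sum>k<n. c k * phi_at k z) - (\<Sum>k<m. c k * phi_at k z) = (\<Sum>k=m..<n. c k * phi_at k z)"
        using mn by (simp add: lessThan_atLeast0 sum_diff_nat_ivl)
      then have "dist (\<Sum>k<m. c k * phi_at k z) (\<Sum>k<n. c k * phi_at k z) = \<bar>\<Sum>k=m..<n. c k * phi_at k z\<bar>"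
        by (simp add: dist_real_def abs_minus_commute)
      also have "\<dots> \<le> sqrt (\<Sum>k=m..<n. lam k powr r * (c k)\<^sup>2) * sqrt (\<Sum>k=m..<n. lam k powr (- r) * (phi_at k z)\<^sup>2)"
        by (rule weighted_cauchy_schwarz)
      also have "\<dots> \<le> sqrt e' * sqrt C"
        using N[OF mn(1), of n] C z by (intro mult_mono real_sqrt_le_mono) (auto intro!: sum_nonneg)
      also have "\<dots> = e / (sqrt C + 1) * sqrt C"
        using e sC by (simp add: e'_def)
      also have "\<dots> = e * (sqrt C / (sqrt C + 1))" by simp
      also have "\<dots> < e * 1" using e sC by (intro mult_strict_left_mono) simp_all
      also have "\<dots> = e" by simp
      finally show "dist (\<Sum>k<m. c k * phi_at k z) (\<Sum>k<n. c k * phi_at k z) < e" .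
    qed
  qed
qed

lemma phi_at_series_summable:
  assumes "r > real DIM('a) / 2" "summable (\<lambda>k. lam k powr r * (c k)\<^sup>2)" "z \<in> \<Omega>"
  shows "summable (\<lambda>k. c k * phi_at k z)"
proof -
  obtain \<delta> where \<delta>: "\<delta> > 0" "cball z \<delta> \<subseteq> \<Omega>" using opn assms(3) open_contains_cball by metis
  have "Cauchy (\<lambda>n. \<Sum>k<n. c k * phi_at k z)"
    using uniformly_Cauchy_imp_Cauchy[OF phi_at_series_uniform[OF assms(1,2) \<delta>(1)]] \<delta>(2) by blast
  then show ?thesis by (simp add: summable_iff_convergent Cauchy_convergent_iff)
qed

text \<open>Uniform convergence holds on points at a fixed distance from the complement of \<Omega>,
  and a ball of half the available radius consists of such points.\<close>

lemma continuous_on_phi_at_series: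
  assumes "r > real DIM('a) / 2" "summable (\<lambda>k. lam k powr r * (c k)\<^sup>2)"
  shows "continuous_on \<Omega> (\<lambda>z. \<Sum>k. c k * phi_at k z)"
proof -
  have "\<exists>e>0. continuous_on (ball z e) (\<lambda>z. \<Sum>k. c k * phi_at k z)" if z: "z \<in> \<Omega>" for z
  proof -
    obtain \<delta> where \<delta>: "\<delta> > 0" "cball z \<delta> \<subseteq> \<Omega>" using opn z open_contains_cball by metis
    have sub: "cball x (\<delta> / 2) \<subseteq> \<Omega>" if "x \<in> ball z (\<delta> / 2)" for x
    proof
      fix y assume "y \<in> cball x (\<delta> / 2)"
      then have "dist z y \<le> \<delta>" using that dist_triangle[of z y x] by auto
      then show "y \<in> \<Omega>" using \<delta>(2) by auto
    qed
    have "uniformly_convergent_on (ball z (\<delta> / 2)) (\<lambda>n z. \<Sum>k<n. c k * phi_at k z)"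
    proof -
      have "ball z (\<delta> / 2) \<subseteq> {z. cball z (\<delta> / 2) \<subseteq> \<Omega>}" using sub by blast
      moreover have "uniformly_convergent_on {z. cball z (\<delta> / 2) \<subseteq> \<Omega>} (\<lambda>n z. \<Sum>k<n. c k * phi_at k z)"
        using \<delta>(1) by (intro Cauchy_uniformly_convergent phi_at_series_uniform[OF assms]) simp
      ultimately show ?thesis using uniformly_convergent_on_subset by blast
    qed
    then have ul: "uniform_limit (ball z (\<delta> / 2)) (\<lambda>n z. \<Sum>k<n. c k * phi_at k z)
        (\<lambda>z. lim (\<lambda>n. \<Sum>k<n. c k * phi_at k z)) sequentially"
      by (simp add: uniformly_convergent_uniform_limit_iff)
    have ct: "\<forall>\<^sub>F n in sequentially. continuous_on (ball z (\<delta> / 2)) (\<lambda>z. \<Sum>k<n. c k * phi_at k z)"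
    proof (intro always_eventually allI continuous_on_sum continuous_on_mult continuous_on_const)
      have "ball z (\<delta> / 2) \<subseteq> \<Omega>" using sub \<delta>(1) by fastforce
      then show "continuous_on (ball z (\<delta> / 2)) (phi_at k)" for k
        using continuous_on_phi_at continuous_on_subset by blast
    qed
    have "continuous_on (ball z (\<delta> / 2)) (\<lambda>z. lim (\<lambda>n. \<Sum>k<n. c k * phi_at k z))"
      by (rule uniform_limit_theorem[OF ct ul]) simp
    then show ?thesis using \<delta>(1) unfolding suminf_eq_lim by (intro exI[of _ "\<delta> / 2"]) auto
  qed
  then have "\<forall>z\<in>\<Omega>. isCont (\<lambda>z. \<Sum>k. c k * phi_at k z) z"
    by (metis centre_in_ball continuous_on_eq_continuous_at open_ball)
  then show ?thesis by (simp add: continuous_at_imp_continuous_on)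
qed

text \<open>Convergence in L^2 yields convergence almost everywhere along a subsequence only, which
  suffices because the whole sequence of partial sums is assumed to tend to v.\<close>

lemma basis_expansion_unique:
  assumes w: "w \<in> L2 \<Omega>" and S: "AE x in lebesgue_on \<Omega>. (\<lambda>n. \<Sum>k<n. coef \<Omega> \<phi> w k * \<phi> k x) \<longlonglongrightarrow> v x"
  shows "AE x in lebesgue_on \<Omega>. v x = w x"
proof -
  define S where "S n x = (\<Sum>k<n. coef \<Omega> \<phi> w k * \<phi> k x)" for n x
  have SL: "S n \<in> L2 \<Omega>" for n
    unfolding S_def[abs_def] by (intro L2_sum L2_cmult phi_L2)
  have "(\<lambda>n. l2_norm \<Omega> (\<lambda>x. w x - S n x)) \<longlonglongrightarrow> 0"
    using basis w by (simp add: orthonormal_basis_L2_def S_def)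
  then have "(\<lambda>n. (l2_norm \<Omega> (\<lambda>x. w x - S n x))\<^sup>2) \<longlonglongrightarrow> 0\<^sup>2" by (rule tendsto_power)
  then have L: "(\<lambda>n. \<integral>x. norm ((w x - S n x)\<^sup>2) \<partial>lebesgue_on \<Omega>) \<longlonglongrightarrow> 0"
    by (simp add: l2_norm_power2)
  have int: "integrable (lebesgue_on \<Omega>) (\<lambda>x. (w x - S n x)\<^sup>2)" for n
    by (rule L2_realD(2)[OF L2_diff[OF w SL]])
  obtain r where r: "strict_mono r" "AE x in lebesgue_on \<Omega>. (\<lambda>n. (w x - S (r n) x)\<^sup>2) \<longlonglongrightarrow> 0"
    using tendsto_L1_AE_subseq[OF int L] by blast
  from r(2) S show ?thesis
  proof eventually_elim
    case (elim x)
    have "(\<lambda>n. S (r n) x) \<longlonglongrightarrow> v x"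
      using LIMSEQ_subseq_LIMSEQ[OF elim(2) r(1)] by (simp add: o_def S_def)
    then have "(\<lambda>n. (w x - S (r n) x)\<^sup>2) \<longlonglongrightarrow> (w x - v x)\<^sup>2" by (intro tendsto_intros)
    then have "(w x - v x)\<^sup>2 = 0" using elim(1) LIMSEQ_unique by blast
    then show ?case by simp
  qed
qed

text \<open>The sum of the series is continuous on \<Omega> and agrees with v almost everywhere, so
  \<open>cont_rep_eq\<close> forces the chosen representative to take its values.\<close>

lemma cont_rep_sums:
  assumes r: "r > real DIM('a) / 2" and v: "v \<in> spectral_H \<Omega> lam \<phi> r" and z: "z \<in> \<Omega>"
  shows "(\<lambda>k. coef \<Omega> \<phi> v k * phi_at k z) sums cont_rep \<Omega> v z"
proof -
  define c where "c k = coef \<Omega> \<phi> v k" for k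
  have vL: "v \<in> L2 \<Omega>" and c: "summable (\<lambda>k. lam k powr r * (c k)\<^sup>2)"
    using v by (auto simp: spectral_H_def c_def)
  define V where "V z = (\<Sum>k. c k * phi_at k z)" for z
  have sums: "(\<lambda>k. c k * phi_at k x) sums V x" if "x \<in> \<Omega>" for x
    unfolding V_def by (rule summable_sums[OF phi_at_series_summable[OF r c that]])
  have "AE x in lebesgue_on \<Omega>. \<forall>k. phi_at k x = \<phi> k x"
    by (simp add: AE_all_countable phi_at_AE)
  moreover have "AE x in lebesgue_on \<Omega>. x \<in> \<Omega>"
    by (rule AE_I2) (simp add: space_restrict_space)
  ultimately have "AE x in lebesgue_on \<Omega>. (\<lambda>n. \<Sum>k<n. coef \<Omega> \<phi> v k * \<phi> k x) \<longlonglongrightarrow> V x"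
  proof eventually_elim
    case (elim x)
    then show ?case using sums[of x] by (simp add: sums_def c_def)
  qed
  then have "AE x in lebesgue_on \<Omega>. V x = v x"
    by (rule basis_expansion_unique[OF vL])
  moreover have "continuous_on \<Omega> V"
    unfolding V_def by (rule continuous_on_phi_at_series[OF r c])
  ultimately have "cont_rep \<Omega> v z = V z"
    using cont_rep_eq[OF opn _ _ z] by blast
  then show ?thesis using sums[OF z] by (simp add: c_def)
qed

end

section \<open>Functions with prescribed coefficients\<close>

lemma l2_norm_cong_AE:
  fixes f g :: "'a::euclidean_space \<Rightarrow> real"
  assumes "f \<in> borel_measurable (lebesgue_on \<Omega>)" "g \<in> borel_measurable (lebesgue_on \<Omega>)"
    "AE x in lebesgue_on \<Omega>. f x = g x"
  shows "l2_norm \<Omega> f = l2_norm \<Omega> g"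
proof -
  have "(\<integral>x. f x * f x \<partial>lebesgue_on \<Omega>) = (\<integral>x. g x * g x \<partial>lebesgue_on \<Omega>)"
  proof (rule integral_cong_AE)
    show "AE x in lebesgue_on \<Omega>. f x * f x = g x * g x" using assms(3) by eventually_elim simp
  qed (use assms in simp_all)
  then show ?thesis by (simp add: l2_norm_def l2_inner_real)
qed

context dirichlet_spectrum
begin

lemma coef_eq_imp_AE_eq:
  assumes u: "u \<in> L2 \<Omega>" and w: "w \<in> L2 \<Omega>" and eq: "\<And>k. coef \<Omega> \<phi> u k = coef \<Omega> \<phi> w k"
  shows "AE x in lebesgue_on \<Omega>. u x = w x"
proof -
  have d: "(\<lambda>x. u x - w x) \<in> L2 \<Omega>" by (rule L2_diff[OF u w])
  have "coef \<Omega> \<phi> (\<lambda>x. u x - w x) k = 0" for k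
    using eq[of k] L2_mult_integrable[OF u phi_L2] L2_mult_integrable[OF w phi_L2]
    by (simp add: coef_def left_diff_distrib)
  then have "AE x in lebesgue_on \<Omega>. 0 = u x - w x"
    by (intro basis_expansion_unique[OF d]) simp
  then show ?thesis by eventually_elim simp
qed

text \<open>The partial sums are Cauchy in L^2, hence in L^1 since \<Omega> is bounded, so a
  subsequence converges almost everywhere to some u. Fatou's lemma recovers the L^2 distance from u
  to the partial sums, and with it the coefficients.\<close>

lemma riesz_fischer:
  assumes c: "summable (\<lambda>k. (c k)\<^sup>2)"
  shows "\<exists>u\<in>L2 \<Omega>. \<forall>k. coef \<Omega> \<phi> u k = c k"
proof -
  let ?M = "lebesgue_on \<Omega>"
  define S where "S n = lin_comb c {..<n}" for n
  have SL: "S n \<in> L2 \<Omega>" for n unfolding S_def by (rule lin_comb_L2)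
  have diff: "(\<integral>x. (S i x - S n x)\<^sup>2 \<partial>?M) = (\<Sum>k=n..<i. (c k)\<^sup>2)" if "n \<le> i" for i n
  proof -
    have "S i x - S n x = lin_comb c {n..<i} x" for x
      using that by (simp add: S_def lin_comb_def lessThan_atLeast0 sum_diff_nat_ivl)
    then have "(\<integral>x. (S i x - S n x)\<^sup>2 \<partial>?M) = (l2_norm \<Omega> (lin_comb c {n..<i}))\<^sup>2"
      by (simp only: l2_norm_power2)
    then show ?thesis by (simp only: lin_comb_norm finite_atLeastLessThan)
  qed
  have one: "(\<lambda>x. 1::real) \<in> L2 \<Omega>" by (rule L2_bounded[OF opn bdd, of _ 1]) simp_all
  define A where "A = l2_norm \<Omega> (\<lambda>x. 1::real)"
  have A: "A \<ge> 0" unfolding A_def by (rule l2_norm_nonneg)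
  have small: "\<exists>N. \<forall>n\<ge>N. \<forall>i\<ge>n. (\<integral>x. (S i x - S n x)\<^sup>2 \<partial>?M) < e" if e: "e > 0" for e
  proof -
    obtain N where N: "\<forall>m\<ge>N. \<forall>n. norm (\<Sum>k=m..<n. (c k)\<^sup>2) < e"
      using c[unfolded summable_Cauchy, rule_format, OF e] by (rule exE)
    show ?thesis
    proof (intro exI allI impI)
      fix n i assume ni: "N \<le> n" "n \<le> i"
      have "norm (\<Sum>k=n..<i. (c k)\<^sup>2) < e" using N ni(1) by simp
      then show "(\<integral>x. (S i x - S n x)\<^sup>2 \<partial>?M) < e"
        unfolding diff[OF ni(2)] real_norm_def by linarith
    qed
  qed
  have cauchy: "\<exists>N. \<forall>i\<ge>N. \<forall>j\<ge>N. (\<integral>x. norm (S i x - S j x) \<partial>?M) < e" if e: "e > 0" for e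
  proof -
    \<comment> \<open>An L^2 distance below e/(A + 1) gives an L^1 distance of at most e A/(A + 1) <
      e, where A is the norm of the constant 1.\<close>
    have "(e / (A + 1))\<^sup>2 > 0" using e A by simp
    from small[OF this] obtain N
      where N: "\<forall>n\<ge>N. \<forall>i\<ge>n. (\<integral>x. (S i x - S n x)\<^sup>2 \<partial>?M) < (e / (A + 1))\<^sup>2" by (rule exE)
    have *: "(\<integral>x. \<bar>S i x - S j x\<bar> \<partial>?M) < e" if ij: "N \<le> j" "j \<le> i" for i j
    proof -
      define f where "f x = \<bar>S i x - S j x\<bar>" for x
      have fL: "f \<in> L2 \<Omega>"
        using L2_realD[OF L2_diff[OF SL SL, of i j]] by (simp add: L2_def f_def[abs_def])
      have "(l2_norm \<Omega> f)\<^sup>2 < (e / (A + 1))\<^sup>2" using N ij by (simp add: l2_norm_power2 f_def)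
      then have nf: "l2_norm \<Omega> f < e / (A + 1)" by (rule power2_less_imp_less) (use e A in simp)
      have "\<bar>\<integral>x. f x * 1 \<partial>?M\<bar> \<le> l2_norm \<Omega> f * A"
        unfolding A_def by (rule l2_cauchy_schwarz[OF fL one])
      also have "\<dots> \<le> e / (A + 1) * A" using nf A by (intro mult_right_mono) simp_all
      also have "\<dots> = e * (A / (A + 1))" by simp
      also have "\<dots> < e * 1" using e A by (intro mult_strict_left_mono) simp_all
      finally have "(\<integral>x. f x \<partial>?M) < e" by simp
      then show ?thesis unfolding f_def .
    qed
    show ?thesis
    proof (intro exI allI impI)
      fix i j assume ij: "N \<le> i" "N \<le> j"
      show "(\<integral>x. norm (S i x - S j x) \<partial>?M) < e"
      proof (cases "j \<le> i")
        case True
        then show ?thesis unfolding real_norm_def by (rule *[OF ij(2)])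
      next
        case False
        then have "(\<integral>x. \<bar>S j x - S i x\<bar> \<partial>?M) < e" by (intro *[OF ij(1)]) simp
        then show ?thesis unfolding real_norm_def by (subst abs_minus_commute)
      qed
    qed
  qed
  obtain r where r: "strict_mono r" "AE x in ?M. Cauchy (\<lambda>i. S (r i) x)"
    by (rule cauchy_L1_AE_cauchy_subseq[OF L2_integrable[OF opn bdd SL] cauchy])
  define u where "u x = lim (\<lambda>i. S (r i) x)" for x
  have um: "u \<in> borel_measurable ?M"
    unfolding u_def by (intro borel_measurable_lim_metric L2_realD[OF SL])
  have lim: "AE x in ?M. (\<lambda>i. S (r i) x) \<longlonglongrightarrow> u x"
    using r(2) by eventually_elim (simp only: u_def Cauchy_convergent_iff convergent_LIMSEQ_iff)
  have fatou: "(\<integral>\<^sup>+x. ennreal ((u x - S n x)\<^sup>2) \<partial>?M) \<le> ennreal e"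
    if n: "\<And>i. n \<le> i \<Longrightarrow> (\<integral>x. (S i x - S n x)\<^sup>2 \<partial>?M) \<le> e" for n e
  proof -
    have "(\<integral>\<^sup>+x. ennreal ((u x - S n x)\<^sup>2) \<partial>?M) = (\<integral>\<^sup>+x. liminf (\<lambda>i. ennreal ((S (r i) x - S n x)\<^sup>2)) \<partial>?M)"
    proof (rule nn_integral_cong_AE)
      show "AE x in ?M. ennreal ((u x - S n x)\<^sup>2) = liminf (\<lambda>i. ennreal ((S (r i) x - S n x)\<^sup>2))"
        using lim
      proof eventually_elim
        case (elim x)
        have "(\<lambda>i. ennreal ((S (r i) x - S n x)\<^sup>2)) \<longlonglongrightarrow> ennreal ((u x - S n x)\<^sup>2)"
          by (intro tendsto_ennrealI tendsto_intros elim)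
        then show ?case by (intro lim_imp_Liminf[symmetric]) simp_all
      qed
    qed
    also have "\<dots> \<le> liminf (\<lambda>i. \<integral>\<^sup>+x. ennreal ((S (r i) x - S n x)\<^sup>2) \<partial>?M)"
      by (intro nn_integral_liminf measurable_compose[OF _ measurable_ennreal] L2_realD[OF SL]
          borel_measurable_power borel_measurable_diff)
    also have "\<dots> \<le> ennreal e"
    proof (rule Liminf_le)
      show "\<forall>\<^sub>F i in sequentially. (\<integral>\<^sup>+x. ennreal ((S (r i) x - S n x)\<^sup>2) \<partial>?M) \<le> ennreal e"
        using eventually_ge_at_top[of n]
      proof eventually_elim
        case (elim i)
        have "(\<integral>\<^sup>+x. ennreal ((S (r i) x - S n x)\<^sup>2) \<partial>?M) = ennreal (\<integral>x. (S (r i) x - S n x)\<^sup>2 \<partial>?M)"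
          by (rule nn_integral_eq_integral[OF L2_realD(2)[OF L2_diff[OF SL SL]]]) simp
        moreover have "n \<le> r i" using elim seq_suble[OF r(1), of i] by linarith
        ultimately show ?case using n[of "r i"] by (simp add: ennreal_leI)
      qed
    qed simp
    finally show ?thesis .
  qed
  have uS: "(\<lambda>x. u x - S n x) \<in> L2 \<Omega>" "(\<integral>x. (u x - S n x)\<^sup>2 \<partial>?M) \<le> e"
    if n: "\<And>i. n \<le> i \<Longrightarrow> (\<integral>x. (S i x - S n x)\<^sup>2 \<partial>?M) \<le> e" and e: "e \<ge> 0" for n e
  proof -
    have m: "(\<lambda>x. u x - S n x) \<in> borel_measurable ?M"
      by (intro borel_measurable_diff um L2_realD[OF SL])
    have "(\<integral>\<^sup>+x. ennreal ((u x - S n x)\<^sup>2) \<partial>?M) < \<infinity>"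
      unfolding infinity_ennreal_def by (rule order_le_less_trans[OF fatou[OF n] ennreal_less_top])
    then have int: "integrable ?M (\<lambda>x. (u x - S n x)\<^sup>2)"
      using m by (intro integrableI_nonneg) simp_all
    then show "(\<lambda>x. u x - S n x) \<in> L2 \<Omega>" using m by (simp add: L2_def)
    have "ennreal (\<integral>x. (u x - S n x)\<^sup>2 \<partial>?M) \<le> ennreal e"
      using fatou[OF n] nn_integral_eq_integral[OF int] by simp
    then show "(\<integral>x. (u x - S n x)\<^sup>2 \<partial>?M) \<le> e" using e by (simp add: ennreal_le_iff)
  qed
  obtain N1 where "\<And>i. N1 \<le> i \<Longrightarrow> (\<integral>x. (S i x - S N1 x)\<^sup>2 \<partial>?M) < 1"
    using small[of 1] by auto
  then have "(\<lambda>x. u x - S N1 x) \<in> L2 \<Omega>" by (intro uS(1)[where e=1]) (simp_all add: less_imp_le)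
  from L2_add[OF this SL[of N1]] have uL: "u \<in> L2 \<Omega>" by simp
  moreover have "coef \<Omega> \<phi> u k = c k" for k
  proof -
    have "\<bar>coef \<Omega> \<phi> u k - c k\<bar> \<le> e" if e: "e > 0" for e
    proof -
      obtain N where N: "\<And>n i. N \<le> n \<Longrightarrow> n \<le> i \<Longrightarrow> (\<integral>x. (S i x - S n x)\<^sup>2 \<partial>?M) < e\<^sup>2"
        using small[of "e\<^sup>2"] e by auto
      \<comment> \<open>Since n > k, the partial sum \<open>S n\<close> already has the coefficient
        c k at index k.\<close>
      define n where "n = max N (Suc k)"
      have le: "(\<integral>x. (S i x - S n x)\<^sup>2 \<partial>?M) \<le> e\<^sup>2" if "n \<le> i" for i
        using N[of n i] that by (simp add: n_def)
      have dL: "(\<lambda>x. u x - S n x) \<in> L2 \<Omega>" by (rule uS(1)[OF le]) simp_all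
      have dn: "(\<integral>x. (u x - S n x)\<^sup>2 \<partial>?M) \<le> e\<^sup>2" by (rule uS(2)[OF le]) simp_all
      have "(l2_norm \<Omega> (\<lambda>x. u x - S n x))\<^sup>2 \<le> e\<^sup>2" using dn by (simp add: l2_norm_power2)
      then have nd: "l2_norm \<Omega> (\<lambda>x. u x - S n x) \<le> e" by (rule power2_le_imp_le) (use e in simp)
      have n1: "l2_norm \<Omega> (\<phi> k) = 1"
        using phi_orthonormal[of k k] by (simp add: l2_norm_def l2_inner_real)
      have "coef \<Omega> \<phi> (S n) k = c k" by (simp add: S_def coef_lin_comb n_def)
      then have "coef \<Omega> \<phi> u k - c k = (\<integral>x. (u x - S n x) * \<phi> k x \<partial>?M)"
        using L2_mult_integrable[OF uL phi_L2] L2_mult_integrable[OF SL phi_L2]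
        by (simp add: coef_def left_diff_distrib)
      then show ?thesis using l2_cauchy_schwarz[OF dL phi_L2, of k] nd n1 by simp
    qed
    then have "\<bar>coef \<Omega> \<phi> u k - c k\<bar> \<le> 0" by (rule field_le_epsilon[of _ 0, simplified])
    then show ?thesis by simp
  qed
  ultimately show ?thesis by blast
qed

end

section \<open>The control-to-state map\<close>

locale pointwise_control = dirichlet_spectrum \<Omega> lam \<phi>
  for \<Omega> :: "'a::euclidean_space set" and lam \<phi> +
  fixes D :: "'a set" and s \<theta> :: real
  assumes s: "s > real DIM('a) / 4" and s\<theta>: "s + \<theta> > real DIM('a) / 2"
    and D: "finite D" "D \<subseteq> \<Omega>"
begin

text \<open>The fundamental solution of the fractional Laplacian with pole z; its coefficients fix
  it up to a null set. The value 0 for poles outside \<Omega> makes membership in L^2 unconditional,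
  as \<open>integral_sum_mult\<close> asks for it at every index.\<close>

definition green :: "'a \<Rightarrow> 'a \<Rightarrow> real" where
  "green z = (if z \<in> \<Omega> then SOME u. u \<in> L2 \<Omega> \<and> (\<forall>k. coef \<Omega> \<phi> u k = lam k powr (- s) * phi_at k z)
    else (\<lambda>x. 0))"

text \<open>Squared, the prescribed coefficients form the weighted sum at r = 2s, and 2s > d/2 is
  the condition s > d/4.\<close>

lemma green:
  shows "green z \<in> L2 \<Omega>" and "z \<in> \<Omega> \<Longrightarrow> coef \<Omega> \<phi> (green z) k = lam k powr (- s) * phi_at k z"
proof -
  have "green z \<in> L2 \<Omega> \<and> (\<forall>k. coef \<Omega> \<phi> (green z) k = lam k powr (- s) * phi_at k z)" if z: "z \<in> \<Omega>"
  proof -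
    have "(lam k powr (- s) * phi_at k z)\<^sup>2 = lam k powr (- (2 * s)) * (phi_at k z)\<^sup>2" for k
      using lam_pos[of k] by (simp add: power_mult_distrib powr_power mult.commute)
    moreover have "summable (\<lambda>k. lam k powr (- (2 * s)) * (phi_at k z)\<^sup>2)"
      using s by (intro phi_at_weighted_summable z) simp
    ultimately have "\<exists>u. u \<in> L2 \<Omega> \<and> (\<forall>k. coef \<Omega> \<phi> u k = lam k powr (- s) * phi_at k z)"
      using riesz_fischer[of "\<lambda>k. lam k powr (- s) * phi_at k z"] by auto
    from someI_ex[OF this] show ?thesis using z by (simp add: green_def)
  qed
  then show "green z \<in> L2 \<Omega>" "z \<in> \<Omega> \<Longrightarrow> coef \<Omega> \<phi> (green z) k = lam k powr (- s) * phi_at k z"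
    by (cases "z \<in> \<Omega>"; simp add: green_def L2_zero)+
qed

definition state :: "('a \<Rightarrow> real) \<Rightarrow> 'a \<Rightarrow> real" where
  "state q x = (\<Sum>z\<in>D. q z * green z x)"

lemma state_L2: "state q \<in> L2 \<Omega>"
  unfolding state_def[abs_def] by (intro L2_sum L2_cmult green)

lemma coef_state: "coef \<Omega> \<phi> (state q) k = lam k powr (- s) * (\<Sum>z\<in>D. q z * phi_at k z)"
proof -
  have "coef \<Omega> \<phi> (state q) k = (\<Sum>z\<in>D. q z * coef \<Omega> \<phi> (green z) k)"
    unfolding coef_def state_def by (rule integral_sum_mult[OF green(1) phi_L2])
  also have "\<dots> = (\<Sum>z\<in>D. q z * (lam k powr (- s) * phi_at k z))"
    using D by (intro sum.cong refl) (simp add: green(2) subsetD)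
  finally show ?thesis by (simp add: sum_distrib_left ac_simps)
qed

text \<open>The weight s - \<theta> and the squared factor of exponent -2s combine to -(s +
  \<theta>), an exponent for which the weighted sum converges at each of the finitely many
  poles.\<close>

lemma state_spectral_H: "state q \<in> spectral_H \<Omega> lam \<phi> (s - \<theta>)"
proof -
  have "summable (\<lambda>k. lam k powr (s - \<theta>) * \<bar>coef \<Omega> \<phi> (state q) k\<bar>\<^sup>2)"
  proof (rule summable_comparison_test')
    show "summable (\<lambda>k. (\<Sum>z\<in>D. (q z)\<^sup>2 * (lam k powr (- (s + \<theta>)) * (phi_at k z)\<^sup>2)) * real (card D))"
      using D s\<theta> by (intro summable_mult2 summable_sum summable_mult phi_at_weighted_summable) auto
    fix k
    have p: "lam k powr (s - \<theta>) * (lam k powr (- s))\<^sup>2 = lam k powr (- (s + \<theta>))"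
      using lam_pos[of k] by (simp add: powr_power powr_add[symmetric])
    have "lam k powr (s - \<theta>) * \<bar>coef \<Omega> \<phi> (state q) k\<bar>\<^sup>2
        = lam k powr (- (s + \<theta>)) * (\<Sum>z\<in>D. q z * phi_at k z)\<^sup>2"
      unfolding coef_state power2_abs power_mult_distrib p[symmetric] by (simp only: mult.assoc)
    also have "\<dots> \<le> lam k powr (- (s + \<theta>)) * ((\<Sum>z\<in>D. (q z * phi_at k z)\<^sup>2) * real (card D))"
      by (intro mult_left_mono sum_squared_le_sum_of_squares) simp_all
    also have "\<dots> = (\<Sum>z\<in>D. (q z)\<^sup>2 * (lam k powr (- (s + \<theta>)) * (phi_at k z)\<^sup>2)) * real (card D)"
      by (simp add: sum_distrib_left power_mult_distrib ac_simps)
    finally show "norm (lam k powr (s - \<theta>) * \<bar>coef \<Omega> \<phi> (state q) k\<bar>\<^sup>2)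
        \<le> (\<Sum>z\<in>D. (q z)\<^sup>2 * (lam k powr (- (s + \<theta>)) * (phi_at k z)\<^sup>2)) * real (card D)"
      by simp
  qed
  then show ?thesis using state_L2 by (simp add: spectral_H_def)
qed

lemma coef_phi: "coef \<Omega> \<phi> (\<phi> k) j = (if j = k then 1 else 0)"
  by (simp add: coef_def phi_orthonormal)

lemma phi_spectral_H: "\<phi> k \<in> spectral_H \<Omega> lam \<phi> r"
proof -
  have "summable (\<lambda>j. lam j powr r * \<bar>coef \<Omega> \<phi> (\<phi> k) j\<bar>\<^sup>2)"
    by (rule summable_finite[of "{k}"]) (simp_all add: coef_phi)
  then show ?thesis by (simp add: spectral_H_def phi_L2)
qed

text \<open>Testing with \<phi>_k isolates one coefficient, since the bilinear series has a single
  nonzero term. Conversely, a finite combination over D of the pointwise expansions of v is the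
  bilinear series.\<close>

lemma state_eq_iff:
  "state_eq \<Omega> lam \<phi> s \<theta> D u q \<longleftrightarrow>
    (\<forall>k. coef \<Omega> \<phi> u k = lam k powr (- s) * (\<Sum>z\<in>D. q z * phi_at k z))"
proof
  assume eq: "state_eq \<Omega> lam \<phi> s \<theta> D u q"
  show "\<forall>k. coef \<Omega> \<phi> u k = lam k powr (- s) * (\<Sum>z\<in>D. q z * phi_at k z)"
  proof
    fix k
    have "bilinear_A \<Omega> lam \<phi> s u (\<phi> k) = (\<Sum>j\<in>{k}. lam j powr s * coef \<Omega> \<phi> u j * coef \<Omega> \<phi> (\<phi> k) j)"
      unfolding bilinear_A_def by (rule suminf_finite) (simp_all add: coef_phi)
    also have "\<dots> = lam k powr s * coef \<Omega> \<phi> u k" by (simp add: coef_phi)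
    finally have "lam k powr s * coef \<Omega> \<phi> u k = (\<Sum>z\<in>D. q z * cont_rep \<Omega> (\<phi> k) z)"
      using eq phi_spectral_H[of k "s + \<theta>"] by (simp add: state_eq_def)
    also have "\<dots> = (\<Sum>z\<in>D. q z * phi_at k z)"
      using D by (intro sum.cong refl) (simp add: cont_rep_eq[OF opn continuous_on_phi_at phi_at_AE] subsetD)
    finally have "lam k powr (- s) * (lam k powr s * coef \<Omega> \<phi> u k) = lam k powr (- s) * (\<Sum>z\<in>D. q z * phi_at k z)"
      by simp
    moreover have "lam k powr (- s) * lam k powr s = 1"
      using lam_pos[of k] by (simp add: powr_add[symmetric])
    ultimately show "coef \<Omega> \<phi> u k = lam k powr (- s) * (\<Sum>z\<in>D. q z * phi_at k z)"
      by (simp add: mult.assoc[symmetric])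
  qed
next
  assume eq: "\<forall>k. coef \<Omega> \<phi> u k = lam k powr (- s) * (\<Sum>z\<in>D. q z * phi_at k z)"
  show "state_eq \<Omega> lam \<phi> s \<theta> D u q"
    unfolding state_eq_def
  proof
    fix v assume v: "v \<in> spectral_H \<Omega> lam \<phi> (s + \<theta>)"
    have "(\<lambda>k. \<Sum>z\<in>D. q z * (coef \<Omega> \<phi> v k * phi_at k z)) sums (\<Sum>z\<in>D. q z * cont_rep \<Omega> v z)"
      using D by (intro sums_sum sums_mult cont_rep_sums[OF s\<theta> v]) auto
    moreover have "lam k powr s * coef \<Omega> \<phi> u k * coef \<Omega> \<phi> v k = (\<Sum>z\<in>D. q z * (coef \<Omega> \<phi> v k * phi_at k z))" for k
    proof -
      have "lam k powr s * lam k powr (- s) = 1"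
        using lam_pos[of k] by (simp add: powr_add[symmetric])
      then have "lam k powr s * coef \<Omega> \<phi> u k = (\<Sum>z\<in>D. q z * phi_at k z)"
        by (simp add: eq mult.assoc[symmetric])
      then show ?thesis by (simp add: sum_distrib_right sum_distrib_left ac_simps)
    qed
    ultimately show "bilinear_A \<Omega> lam \<phi> s u v = (\<Sum>z\<in>D. q z * cont_rep \<Omega> v z)"
      by (simp add: bilinear_A_def sums_iff)
  qed
qed

lemma state_eq_state: "state_eq \<Omega> lam \<phi> s \<theta> D (state q) q"
  by (simp add: state_eq_iff coef_state)

lemma state_unique:
  assumes "u \<in> L2 \<Omega>" "state_eq \<Omega> lam \<phi> s \<theta> D u q"
  shows "AE x in lebesgue_on \<Omega>. u x = state q x"
  using assms by (intro coef_eq_imp_AE_eq state_L2) (simp_all add: state_eq_iff coef_state)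

section \<open>The reduced cost\<close>

lemma L2_set_power2: "(L2_set q A)\<^sup>2 = (\<Sum>z\<in>A. (q z)\<^sup>2)"
  by (simp add: L2_set_def sum_nonneg)

definition reduced_cost :: "('a \<Rightarrow> real) \<Rightarrow> real \<Rightarrow> ('a \<Rightarrow> real) \<Rightarrow> real" where
  "reduced_cost w \<alpha> q = cost_J \<Omega> D w \<alpha> (state q) q"

lemma cost_eq_reduced_cost:
  assumes "w \<in> L2 \<Omega>" "u \<in> L2 \<Omega>" "state_eq \<Omega> lam \<phi> s \<theta> D u q"
  shows "cost_J \<Omega> D w \<alpha> u q = reduced_cost w \<alpha> q"
proof -
  have "l2_norm \<Omega> (\<lambda>x. u x - w x) = l2_norm \<Omega> (\<lambda>x. state q x - w x)"
  proof (rule l2_norm_cong_AE)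
    show "AE x in lebesgue_on \<Omega>. u x - w x = state q x - w x"
      using state_unique[OF assms(2,3)] by eventually_elim simp
  qed (intro L2_realD L2_diff assms state_L2)+
  then show ?thesis by (simp add: reduced_cost_def cost_J_def)
qed

text \<open>By linearity of the state the cost is a quadratic polynomial in the finitely many
  coordinates \<open>q z\<close>, hence continuous in the product topology, the one in which
  \<open>Q_ad\<close> is compact.\<close>

lemma continuous_on_reduced_cost:
  assumes w: "w \<in> L2 \<Omega>"
  shows "continuous_on S (reduced_cost w \<alpha>)"
proof -
  let ?I = "\<lambda>f g. \<integral>x. f x * g x \<partial>lebesgue_on \<Omega>"
  have st: "?I (state q) f = (\<Sum>z\<in>D. q z * ?I (green z) f)" if "f \<in> L2 \<Omega>" for q f
    unfolding state_def by (rule integral_sum_mult[OF green(1) that])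
  have "reduced_cost w \<alpha> q = 1 / 2 * ((\<Sum>z\<in>D. q z * (\<Sum>y\<in>D. q y * ?I (green y) (green z)))
      - 2 * (\<Sum>z\<in>D. q z * ?I (green z) w) + ?I w w) + \<alpha> / 2 * (\<Sum>z\<in>D. (q z)\<^sup>2)" for q
  proof -
    have "(l2_norm \<Omega> (\<lambda>x. state q x - w x))\<^sup>2
        = (\<integral>x. state q x * state q x - 2 * (state q x * w x) + w x * w x \<partial>lebesgue_on \<Omega>)"
      unfolding l2_norm_power2
      by (intro Bochner_Integration.integral_cong refl) (simp add: power2_eq_square algebra_simps)
    also have "\<dots> = ?I (state q) (state q) - 2 * ?I (state q) w + ?I w w"
      using L2_mult_integrable[OF state_L2 state_L2] L2_mult_integrable[OF state_L2 w]
        L2_mult_integrable[OF w w] by simp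
    also have "?I (state q) (state q) = (\<Sum>z\<in>D. q z * ?I (state q) (green z))"
      unfolding st[OF state_L2] by (simp only: mult.commute[of "green _ _"])
    also have "\<dots> = (\<Sum>z\<in>D. q z * (\<Sum>y\<in>D. q y * ?I (green y) (green z)))"
      unfolding st[OF green(1)] ..
    finally show ?thesis
      unfolding reduced_cost_def cost_J_def L2_set_power2 st[OF w] by (simp only:)
  qed
  then have "reduced_cost w \<alpha> = (\<lambda>q. 1 / 2 * ((\<Sum>z\<in>D. q z * (\<Sum>y\<in>D. q y * ?I (green y) (green z)))
      - 2 * (\<Sum>z\<in>D. q z * ?I (green z) w) + ?I w w) + \<alpha> / 2 * (\<Sum>z\<in>D. (q z)\<^sup>2))"
    by (rule ext)
  moreover have "continuous_on S (\<lambda>q::'a \<Rightarrow> real. q z)" for z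
    by (rule continuous_on_subset[OF continuous_on_product_coordinates subset_UNIV])
  ultimately show ?thesis
    by (simp only:) (intro continuous_on_add continuous_on_diff continuous_on_mult continuous_on_sum
        continuous_on_power continuous_on_const)
qed

text \<open>Strict convexity in quantitative form. The tracking term contributes convexity only; the
  parallelogram identity for the control term produces the gain (\<alpha>/2)(1/4).\<close>

lemma reduced_cost_midpoint:
  assumes w: "w \<in> L2 \<Omega>" and m: "\<And>z. z \<in> D \<Longrightarrow> m z = (p z + q z) / 2"
  shows "reduced_cost w \<alpha> m \<le> (reduced_cost w \<alpha> p + reduced_cost w \<alpha> q) / 2
    - \<alpha> / 8 * (\<Sum>z\<in>D. (p z - q z)\<^sup>2)"
proof -
  have "state m x = (\<Sum>z\<in>D. (p z * green z x + q z * green z x) / 2)" for x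
    unfolding state_def by (intro sum.cong refl) (simp add: m algebra_simps)
  then have stm: "state m x = (state p x + state q x) / 2" for x
    by (simp add: state_def sum.distrib sum_divide_distrib[symmetric])
  have int: "integrable (lebesgue_on \<Omega>) (\<lambda>x. (state r x - w x)\<^sup>2)" for r
    by (rule L2_realD(2)[OF L2_diff[OF state_L2 w]])
  have sq: "((a + b) / 2 - c)\<^sup>2 \<le> ((a - c)\<^sup>2 + (b - c)\<^sup>2) / 2" for a b c :: real
  proof -
    have "((a - c)\<^sup>2 + (b - c)\<^sup>2) / 2 - ((a + b) / 2 - c)\<^sup>2 = ((a - b) / 2)\<^sup>2"
      by (simp add: power2_eq_square field_simps)
    then show ?thesis using zero_le_power2[of "(a - b) / 2"] by linarith
  qed
  have "(l2_norm \<Omega> (\<lambda>x. state m x - w x))\<^sup>2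
      \<le> (\<integral>x. ((state p x - w x)\<^sup>2 + (state q x - w x)\<^sup>2) / 2 \<partial>lebesgue_on \<Omega>)"
    unfolding l2_norm_power2
  proof (rule integral_mono[OF int])
    show "integrable (lebesgue_on \<Omega>) (\<lambda>x. ((state p x - w x)\<^sup>2 + (state q x - w x)\<^sup>2) / 2)"
      by (intro integrable_divide_zero Bochner_Integration.integrable_add int)
    show "(state m x - w x)\<^sup>2 \<le> ((state p x - w x)\<^sup>2 + (state q x - w x)\<^sup>2) / 2" for x
      unfolding stm by (rule sq)
  qed
  also have "\<dots> = ((l2_norm \<Omega> (\<lambda>x. state p x - w x))\<^sup>2 + (l2_norm \<Omega> (\<lambda>x. state q x - w x))\<^sup>2) / 2"
    unfolding l2_norm_power2 using int by simp
  finally have L: "(l2_norm \<Omega> (\<lambda>x. state m x - w x))\<^sup>2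
    \<le> ((l2_norm \<Omega> (\<lambda>x. state p x - w x))\<^sup>2 + (l2_norm \<Omega> (\<lambda>x. state q x - w x))\<^sup>2) / 2" .
  have "(\<Sum>z\<in>D. (m z)\<^sup>2) = (\<Sum>z\<in>D. ((p z)\<^sup>2 + (q z)\<^sup>2) / 2 - (p z - q z)\<^sup>2 / 4)"
    by (intro sum.cong refl) (simp add: m power2_eq_square field_simps)
  also have "\<dots> = ((\<Sum>z\<in>D. (p z)\<^sup>2) + (\<Sum>z\<in>D. (q z)\<^sup>2)) / 2 - (\<Sum>z\<in>D. (p z - q z)\<^sup>2) / 4"
    by (simp add: sum_subtractf sum.distrib sum_divide_distrib[symmetric])
  finally have Q: "\<alpha> / 2 * (\<Sum>z\<in>D. (m z)\<^sup>2) = \<alpha> / 2 * (((\<Sum>z\<in>D. (p z)\<^sup>2) + (\<Sum>z\<in>D. (q z)\<^sup>2)) / 2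
      - (\<Sum>z\<in>D. (p z - q z)\<^sup>2) / 4)" by simp
  have "reduced_cost w \<alpha> r = 1 / 2 * (l2_norm \<Omega> (\<lambda>x. state r x - w x))\<^sup>2 + \<alpha> / 2 * (\<Sum>z\<in>D. (r z)\<^sup>2)" for r
    unfolding reduced_cost_def cost_J_def L2_set_power2 ..
  then show ?thesis using L Q by (simp add: algebra_simps)
qed

end

section \<open>Existence and uniqueness of the optimal control\<close>

text \<open>An extensional function takes the value \<open>undefined\<close> outside D, so the box
  is a full product whose remaining factors are singletons, and Tychonoff's theorem applies.\<close>

lemma compact_Q_ad: "compact (Q_ad D a b)"
proof -
  have "Q_ad D a b = PiE UNIV (\<lambda>z. if z \<in> D then {a z..b z} else {undefined})"
    by (auto simp: Q_ad_def PiE_iff extensional_def split: if_splits)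
  moreover have "compactin (product_topology (\<lambda>i. euclidean) UNIV)
      (PiE UNIV (\<lambda>z. if z \<in> D then {a z..b z} else {undefined}))"
    by (subst compactin_PiE) simp
  ultimately show ?thesis by (simp add: euclidean_product_topology)
qed

text \<open>States are functions representing elements of L^2, so their uniqueness is up to null
  sets; controls are extensional, so for them it is equality.\<close>

theorem theorem2:
  fixes \<Omega> D :: "'a::euclidean_space set"
    and lam :: "nat \<Rightarrow> real" and \<phi> :: "nat \<Rightarrow> 'a \<Rightarrow> real"
    and s \<theta> \<alpha> :: real and u\<^sub>\<Omega> a b :: "'a \<Rightarrow> real"
  assumes "DIM('a) \<in> {2, 3}"
    and "open \<Omega>" and "bounded \<Omega>" and "convex \<Omega>" and "polytope (closure \<Omega>)"
    and "dirichlet_eigenpairs \<Omega> lam \<phi>"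
    and "s \<in> {real DIM('a) / 4<..<1}"
    and "\<theta> \<in> {real DIM('a) / 2 - s<..<s}"
    and "finite D" and "D \<subseteq> \<Omega>"
    and "u\<^sub>\<Omega> \<in> L2 \<Omega>" and "\<alpha> > 0"
    and "\<And>z. z \<in> D \<Longrightarrow> a z < b z"
  shows "\<exists>u q. is_optimal \<Omega> lam \<phi> s \<theta> D u\<^sub>\<Omega> \<alpha> a b u q \<and>
           (\<forall>u' q'. is_optimal \<Omega> lam \<phi> s \<theta> D u\<^sub>\<Omega> \<alpha> a b u' q' \<longrightarrow>
              (AE x in lebesgue_on \<Omega>. u' x = u x) \<and> q' = q)"
proof -
  interpret pointwise_control \<Omega> lam \<phi> D s \<theta>
    using assms by unfold_locales auto
  let ?J = "reduced_cost u\<^sub>\<Omega> \<alpha>"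
  \<comment> \<open>An admissible state agrees almost everywhere with \<open>state q\<close>, so its
    cost depends on q alone and the problem becomes one over the box.\<close>
  have optimal_iff: "is_optimal \<Omega> lam \<phi> s \<theta> D u\<^sub>\<Omega> \<alpha> a b u q \<longleftrightarrow>
      u \<in> spectral_H \<Omega> lam \<phi> (s - \<theta>) \<and> state_eq \<Omega> lam \<phi> s \<theta> D u q \<and>
      q \<in> Q_ad D a b \<and> (\<forall>q'\<in>Q_ad D a b. ?J q \<le> ?J q')" for u q
  proof -
    have J: "cost_J \<Omega> D u\<^sub>\<Omega> \<alpha> u q = ?J q"
      if "u \<in> spectral_H \<Omega> lam \<phi> (s - \<theta>)" "state_eq \<Omega> lam \<phi> s \<theta> D u q" for u q
      using that by (intro cost_eq_reduced_cost assms(11)) (simp_all add: spectral_H_def)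
    show ?thesis
    proof
      assume opt: "is_optimal \<Omega> lam \<phi> s \<theta> D u\<^sub>\<Omega> \<alpha> a b u q"
      then have u: "u \<in> spectral_H \<Omega> lam \<phi> (s - \<theta>)" "state_eq \<Omega> lam \<phi> s \<theta> D u q" "q \<in> Q_ad D a b"
        by (auto simp: is_optimal_def is_arg_min_def)
      have "?J q \<le> ?J q'" if "q' \<in> Q_ad D a b" for q'
      proof -
        have "\<not> cost_J \<Omega> D u\<^sub>\<Omega> \<alpha> (state q') q' < cost_J \<Omega> D u\<^sub>\<Omega> \<alpha> u q"
          using opt that state_spectral_H[of q'] state_eq_state[of q']
          by (auto simp: is_optimal_def is_arg_min_def)
        then show ?thesis using J[OF u(1,2)] by (simp add: reduced_cost_def)
      qed
      then show "u \<in> spectral_H \<Omega> lam \<phi> (s - \<theta>) \<and> state_eq \<Omega> lam \<phi> s \<theta> D u q \<and>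
        q \<in> Q_ad D a b \<and> (\<forall>q'\<in>Q_ad D a b. ?J q \<le> ?J q')" using u by simp
    next
      assume R: "u \<in> spectral_H \<Omega> lam \<phi> (s - \<theta>) \<and> state_eq \<Omega> lam \<phi> s \<theta> D u q \<and>
        q \<in> Q_ad D a b \<and> (\<forall>q'\<in>Q_ad D a b. ?J q \<le> ?J q')"
      then show "is_optimal \<Omega> lam \<phi> s \<theta> D u\<^sub>\<Omega> \<alpha> a b u q"
        using J by (auto simp: is_optimal_def is_arg_min_def not_less)
    qed
  qed
  \<comment> \<open>The lower corner shows that the box is nonempty, as attainment of the minimum
    requires.\<close>
  have "restrict a D \<in> Q_ad D a b"
    using assms(13) by (auto simp: Q_ad_def less_imp_le)
  then obtain q where q: "q \<in> Q_ad D a b" "\<And>q'. q' \<in> Q_ad D a b \<Longrightarrow> ?J q \<le> ?J q'"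
    using continuous_attains_inf[OF compact_Q_ad _ continuous_on_reduced_cost[OF assms(11), of _ \<alpha>], of D a b]
    by blast
  have unique: "q' = q" if q': "q' \<in> Q_ad D a b" "?J q' \<le> ?J q" for q'
  proof -
    \<comment> \<open>The midpoint of two minimizers, restricted to D to stay extensional. Its cost
      would undercut the minimum unless the two agree on D.\<close>
    define m where "m = restrict (\<lambda>z. (q z + q' z) / 2) D"
    have "m z \<in> {a z..b z}" if "z \<in> D" for z
    proof -
      have "q z \<in> {a z..b z}" "q' z \<in> {a z..b z}" using q(1) q'(1) that by (auto simp: Q_ad_def)
      then show ?thesis using that by (simp add: m_def)
    qed
    then have "m \<in> Q_ad D a b" by (auto simp: Q_ad_def m_def)
    then have "?J q \<le> ?J m" by (rule q(2))
    also have "?J m \<le> (?J q + ?J q') / 2 - \<alpha> / 8 * (\<Sum>z\<in>D. (q z - q' z)\<^sup>2)"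
      by (rule reduced_cost_midpoint[OF assms(11)]) (simp add: m_def)
    finally have mid: "?J q \<le> (?J q + ?J q') / 2 - \<alpha> / 8 * (\<Sum>z\<in>D. (q z - q' z)\<^sup>2)" .
    have "t \<le> 0" if "x \<le> (x + y) / 2 - t" "y \<le> x" for x y t :: real
      using that by (simp add: field_simps)
    from this[OF mid q'(2)] have "\<alpha> / 8 * (\<Sum>z\<in>D. (q z - q' z)\<^sup>2) \<le> 0" .
    then have "(\<Sum>z\<in>D. (q z - q' z)\<^sup>2) \<le> 0" using assms(12) by (simp add: mult_le_0_iff)
    moreover have "(\<Sum>z\<in>D. (q z - q' z)\<^sup>2) \<ge> 0" by (intro sum_nonneg) simp
    ultimately have "(\<Sum>z\<in>D. (q z - q' z)\<^sup>2) = 0" by linarith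
    then have "\<forall>z\<in>D. q z = q' z" using assms(9) by (simp add: sum_nonneg_eq_0_iff)
    then show ?thesis
      using q(1) q'(1) unfolding Q_ad_def by (intro PiE_ext[of q' D _ q]) auto
  qed
  show ?thesis
  proof (intro exI conjI allI impI)
    show "is_optimal \<Omega> lam \<phi> s \<theta> D u\<^sub>\<Omega> \<alpha> a b (state q) q"
      using q state_spectral_H state_eq_state by (simp add: optimal_iff)
    fix u' q' assume opt: "is_optimal \<Omega> lam \<phi> s \<theta> D u\<^sub>\<Omega> \<alpha> a b u' q'"
    then show "q' = q" using q(1) by (intro unique) (simp_all add: optimal_iff)
    with opt show "AE x in lebesgue_on \<Omega>. u' x = state q x"
      by (intro state_unique) (simp_all add: optimal_iff spectral_H_def)
  qed
qed

end
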